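(* Let $n\ge2$ and $\alpha\in(0,1)$. If $F\in\mathcal{DM}^{\alpha,\infty}(\mathbb{R}^n)$ and $E\subset\mathbb{R}^n$ is such that $\chi_E\in W^{\alpha,1}(\mathbb{R}^n)$, then $$\int_{E^1}d\operatorname{div}^\alpha F=-\int_{\mathscr{F}^\alpha E}F\cdot\nu^\alpha_E\,|\nabla^\alpha\chi_E|\,dx,$$ where $$E^1=\left\{x\in\mathbb{R}^n:\ \exists\lim_{r\to0^+}\frac{|E\cap B_r(x)|}{|B_r(x)|}=1\right\}.$$
   Context: For $\alpha\in(0,1)$, the fractional $\alpha$-gradient of $\xi:\mathbb{R}^n\to\mathbb{R}$ is $$\nabla^\alpha\xi(x)=\mu_{n,\alpha}\int_{\mathbb{R}^n}\frac{(\xi(y)-\xi(x))(y-x)}{|y-x|^{n+\alpha+1}}\,dy,\qquad \mu_{n,\alpha}=2^\alpha\pi^{-\frac n2}\frac{\Gamma\left(\frac{n+\alpha+1}{2}\right)}{\Gamma\left(\frac{1-\alpha}{2}\right)}$$ (for $\xi\in W^{\alpha,1}(\mathbb{R}^n)$ the integral converges absolutely for a.e. $x$ and defines an element of $L^1(\mathbb{R}^n;\mathbb{R}^n)$), where $W^{\alpha,1}(\mathbb{R}^n)=\{u\in L^1(\mathbb{R}^n):\int_{\mathbb{R}^n}\int_{\mathbb{R}^n}\frac{|u(x)-u(y)|}{|x-y|^{n+\alpha}}\,dx\,dy<+\infty\}$. $\mathcal{DM}^{\alpha,\infty}(\mathbb{R}^n)$ is the space of vector fields $F\in L^\infty(\mathbb{R}^n;\mathbb{R}^n)$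 such that $$\sup\left\{\int_{\mathbb{R}^n}F\cdot\nabla^\alpha\xi\,dx:\ \xi\in C^\infty_c(\mathbb{R}^n),\ \|\xi\|_{L^\infty(\mathbb{R}^n)}\le1\right\}<+\infty;$$ equivalently, there is a (unique) finite signed Radon measure $\operatorname{div}^\alpha F$ on $\mathbb{R}^n$ with $\int_{\mathbb{R}^n}F\cdot\nabla^\alpha\xi\,dx=-\int_{\mathbb{R}^n}\xi\,d\operatorname{div}^\alpha F$ for all $\xi\in C^\infty_c(\mathbb{R}^n)$. For $\chi_E\in W^{\alpha,1}(\mathbb{R}^n)$, let $D^\alpha\chi_E=\nabla^\alpha\chi_E\,\mathcal{L}^n$, a finite $\mathbb{R}^n$-valued Radon measure with total variation measure $|D^\alpha\chi_E|=|\nabla^\alpha\chi_E|\,\mathcal{L}^n$, where $\mathcal{L}^n$ is Lebesgue measure. The fractional reduced boundary $\mathscr{F}^\alpha E$ is the set of points $x\in\operatorname{supp}|D^\alpha\chi_E|$ such that the limit $$\nu_E^\alpha(x)=\lim_{r\to0^+}\frac{D^\alpha\chi_E(B_r(x))}{|D^\alpha\chi_E|(B_r(x))}$$ exists and belongs to the unit sphere $\mathbb{S}^{n-1}$; the map $\nu^\alpha_E:\mathscr{F}^\alpha E\to\mathbb{S}^{n-1}$ so defined is the inner fractional normal of $E$. *)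

theory Defs
  imports "HOL-Analysis.Analysis"
begin

primrec C_times :: "nat \<Rightarrow> ('a::euclidean_space \<Rightarrow> real) \<Rightarrow> bool" where
  "C_times 0 f \<longleftrightarrow> continuous_on UNIV f"
| "C_times (Suc k) f \<longleftrightarrow> f differentiable_on UNIV \<and>
     (\<forall>b\<in>Basis. C_times k (\<lambda>x. frechet_derivative f (at x) b))"

definition test_functions :: "('a::euclidean_space \<Rightarrow> real) set" where
  "test_functions = {\<xi>. (\<forall>k. C_times k \<xi>) \<and> compact (closure {x. \<xi> x \<noteq> 0})}"

definition frac_const :: "nat \<Rightarrow> real \<Rightarrow> real" where
  "frac_const n \<alpha> = 2 powr \<alpha> * pi powr (- real n / 2) *
     Gamma ((real n + \<alpha> + 1) / 2) / Gamma ((1 - \<alpha>) / 2)"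

definition frac_grad :: "real \<Rightarrow> ('a::euclidean_space \<Rightarrow> real) \<Rightarrow> 'a \<Rightarrow> 'a" where
  "frac_grad \<alpha> \<xi> x = frac_const DIM('a) \<alpha> *\<^sub>R
     (LINT y|lebesgue. ((\<xi> y - \<xi> x) / norm (y - x) powr (real DIM('a) + \<alpha> + 1)) *\<^sub>R (y - x))"

definition frac_Sobolev :: "real \<Rightarrow> ('a::euclidean_space \<Rightarrow> real) set" where
  "frac_Sobolev \<alpha> = {u. integrable lebesgue u \<and>
     (\<integral>\<^sup>+ x. \<integral>\<^sup>+ y. ennreal (\<bar>u x - u y\<bar> / norm (x - y) powr (real DIM('a) + \<alpha>)) \<partial>lebesgue \<partial>lebesgue) < \<infinity>}"

definition frac_DM :: "real \<Rightarrow> ('a::euclidean_space \<Rightarrow> 'a) set" where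
  "frac_DM \<alpha> = {F. F \<in> borel_measurable lebesgue \<and> (\<exists>C. AE x in lebesgue. norm (F x) \<le> C) \<and>
     bdd_above {LINT x|lebesgue. F x \<bullet> frac_grad \<alpha> \<xi> x | \<xi>.
       \<xi> \<in> test_functions \<and> (AE x in lebesgue. \<bar>\<xi> x\<bar> \<le> 1)}}"

text \<open>
  A finite signed Radon measure is a real-valued set function, given as the difference of two
  finite Borel measures; the integral against it is the difference of the two integrals, which
  does not depend on the chosen decomposition. On a Euclidean space every finite Borel measure is
  Radon. Outside the Borel sets the set function is fixed to be \<open>0\<close>, so that it is uniquely
  determined, as the definite description in \<open>frac_div\<close> requires.
\<close>

definition signed_decomp :: "('a::euclidean_space set \<Rightarrow> real) \<Rightarrow> 'a measure \<Rightarrow> 'a measure \<Rightarrow> bool" where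
  "signed_decomp \<mu> P N \<longleftrightarrow> finite_measure P \<and> finite_measure N \<and> sets P = sets borel \<and> sets N = sets borel \<and>
     (\<forall>A. \<mu> A = (if A \<in> sets borel then measure P A - measure N A else 0))"

definition frac_div :: "real \<Rightarrow> ('a::euclidean_space \<Rightarrow> 'a) \<Rightarrow> 'a set \<Rightarrow> real" where
  "frac_div \<alpha> F = (THE \<mu>. \<exists>P N. signed_decomp \<mu> P N \<and>
     (\<forall>\<xi>\<in>test_functions. (LINT x|lebesgue. F x \<bullet> frac_grad \<alpha> \<xi> x) =
        - ((LINT x|P. \<xi> x) - (LINT x|N. \<xi> x))))"

definition frac_var :: "real \<Rightarrow> 'a::euclidean_space set \<Rightarrow> 'a set \<Rightarrow> 'a" where
  "frac_var \<alpha> E A = (LINT x:A|lebesgue. frac_grad \<alpha> (indicat_real E) x)"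

definition frac_total_var :: "real \<Rightarrow> 'a::euclidean_space set \<Rightarrow> 'a measure" where
  "frac_total_var \<alpha> E = density lebesgue (\<lambda>x. ennreal (norm (frac_grad \<alpha> (indicat_real E) x)))"

definition measure_support :: "'a::topological_space measure \<Rightarrow> 'a set" where
  "measure_support M = {x. \<forall>U. open U \<and> x \<in> U \<longrightarrow> emeasure M U > 0}"

definition frac_polar_ratio :: "real \<Rightarrow> 'a::euclidean_space set \<Rightarrow> 'a \<Rightarrow> real \<Rightarrow> 'a" where
  "frac_polar_ratio \<alpha> E x r =
     frac_var \<alpha> E (ball x r) /\<^sub>R measure (frac_total_var \<alpha> E) (ball x r)"

definition frac_reduced_boundary :: "real \<Rightarrow> 'a::euclidean_space set \<Rightarrow> 'a set" where
  "frac_reduced_boundary \<alpha> E = {x \<in> measure_support (frac_total_var \<alpha> E).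
     \<exists>\<nu>\<in>sphere 0 1. (frac_polar_ratio \<alpha> E x \<longlongrightarrow> \<nu>) (at_right 0)}"

definition frac_normal :: "real \<Rightarrow> 'a::euclidean_space set \<Rightarrow> 'a \<Rightarrow> 'a" where
  "frac_normal \<alpha> E x = Lim (at_right 0) (frac_polar_ratio \<alpha> E x)"

definition density_one_points :: "'a::euclidean_space set \<Rightarrow> 'a set" where
  "density_one_points E = {x.
     ((\<lambda>r. measure lebesgue (E \<inter> ball x r) / measure lebesgue (ball x r)) \<longlongrightarrow> 1) (at_right 0)}"

end

theory Submission imports Defs begin

text \<open>
  Compactly supported Lipschitz functions have finite Gagliardo seminorm and are uniform limits of mollified
  test functions that converge in this seminorm too, so the bounded functional of a fractional
  divergence-measure field extends to them; the Riesz representation theorem for this lattice provides the fractional divergence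
  as a difference of two finite measures \<open>P - N\<close>.

  Let \<open>\<theta>\<^sub>k(x)\<close> be the density of \<open>E\<close> in the ball of radius \<open>2\<^sup>-\<^sup>k\<close> about \<open>x\<close>. The Gagliardo seminorms and the
  integrals of the Lipschitz functions \<open>\<theta>\<^sub>k(1 - \<theta>\<^sub>k)\<close> are summable over \<open>k\<close>. Since \<open>P - N\<close> is controlled by the
  Gagliardo seminorm, truncated tails of this series show that \<open>P\<close> and \<open>N\<close> agree on every Borel set of points
  where \<open>\<theta>\<^sub>k(1 - \<theta>\<^sub>k)\<close> does not tend to \<open>0\<close>. At all other points \<open>\<theta>\<^sub>k\<close> tends to \<open>1\<close> on \<open>E\<^sup>1\<close> and to \<open>0\<close> off \<open>E\<^sup>1\<close>.
  As \<open>\<theta>\<^sub>k\<close>, suitably cut off, converges to the indicator of \<open>E\<close> in the Gagliardo seminorm, the duality between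
  the divergence and the fractional gradient passes to the limit. Lebesgue differentiation
  identifies the fractional gradient of the indicator with its length times the fractional normal, almost
  everywhere on the fractional reduced boundary, and shows that it vanishes almost everywhere off it.
\<close>

section \<open>Riesz representation on compactly supported Lipschitz functions\<close>

text \<open>The difficulty is that the divergence may charge Lebesgue null sets, so almost
  everywhere convergence of the densities of \<open>E\<close> does not suffice. What is available is
  that its pairing with a Lipschitz function is bounded by the Gagliardo seminorm, which turns the
  question into one about capacity. The product of density and co-density is used because it is at
  most a double average of |chi(x+y) - chi(x+z)|, chi being the indicator of \<open>E\<close>:
  Tonelli then bounds its integral and its translation differences by averages of the translation
  differences of chi, and summing over dyadic radii reproduces the kernel |w|^-(n+\<alpha>).

  Smooth functions are not closed under the minima and truncations that the Riesz theorem and the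
  capacity estimate require. Compactly supported Lipschitz functions are, and \<alpha> < 1 makes the
  seminorm finite on them. \<open>P\<close> and \<open>N\<close> are not claimed to be mutually
  singular: what counts is that they have equal restrictions to the exceptional set, so that this
  set contributes nothing to the pairing, whatever the densities do there.\<close>

definition lipc :: "('a::euclidean_space \<Rightarrow> real) set" where
  "lipc = {f. (\<exists>L. L-lipschitz_on UNIV f) \<and> bounded {x. f x \<noteq> 0}}"

lemma lipc_I: "L-lipschitz_on UNIV f \<Longrightarrow> bounded {x. f x \<noteq> 0} \<Longrightarrow> f \<in> lipc"
  by (auto simp: lipc_def)

lemma lipschitz_on_realI:
  fixes f :: "'a::metric_space \<Rightarrow> real"
  assumes "\<And>x y. f x - f y \<le> L * dist x y" "0 \<le> L"
  shows "L-lipschitz_on UNIV f"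
proof (rule lipschitz_onI)
  fix x y show "dist (f x) (f y) \<le> L * dist x y"
    using assms(1)[of x y] assms(1)[of y x] by (auto simp: dist_real_def dist_commute abs_le_iff)
qed (use assms in auto)

lemma lipschitz_on_realD:
  fixes f :: "'a::metric_space \<Rightarrow> real"
  assumes "L-lipschitz_on UNIV f"
  shows "f x - f y \<le> L * dist x y" "\<bar>f x - f y\<bar> \<le> L * dist x y"
  using lipschitz_onD[OF assms, of x y] by (auto simp: dist_real_def)

text \<open>One estimate for \<open>h\<close>, Lipschitz in the l1 norm of its two arguments, serves
  sums, differences, minima and maxima alike.\<close>

lemma lipc_binop:
  assumes f: "f \<in> lipc" and g: "g \<in> lipc" and z: "h 0 0 = (0::real)"
    and h: "\<And>a b c d. \<bar>h a b - h c d\<bar> \<le> \<bar>a - c\<bar> + \<bar>b - d\<bar>"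
  shows "(\<lambda>x. h (f x) (g x)) \<in> lipc"
proof -
  obtain L1 L2 where L: "L1-lipschitz_on UNIV f" "L2-lipschitz_on UNIV g"
    using f g by (auto simp: lipc_def)
  have "(L1 + L2)-lipschitz_on UNIV (\<lambda>x. h (f x) (g x))"
  proof (rule lipschitz_on_realI)
    fix x y
    show "h (f x) (g x) - h (f y) (g y) \<le> (L1 + L2) * dist x y"
      using lipschitz_on_realD(2)[OF L(1), of x y] lipschitz_on_realD(2)[OF L(2), of x y]
        h[of "f x" "g x" "f y" "g y"] by (simp add: algebra_simps)
    show "0 \<le> L1 + L2" using L[THEN lipschitz_on_nonneg] by simp
  qed
  moreover have "bounded {x. h (f x) (g x) \<noteq> 0}"
    by (rule bounded_subset[of "{x. f x \<noteq> 0} \<union> {x. g x \<noteq> 0}"])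
      (use f g z in \<open>auto simp: lipc_def\<close>)
  ultimately show ?thesis by (rule lipc_I)
qed

lemma lipc_zero [simp]: "(\<lambda>x. 0) \<in> lipc"
  by (rule lipc_I[of 0]) (auto intro: lipschitz_on_realI)

lemma lipc_add: "f \<in> lipc \<Longrightarrow> g \<in> lipc \<Longrightarrow> (\<lambda>x. f x + g x) \<in> lipc"
  by (erule (1) lipc_binop[of f g "(+)"]) auto

lemma lipc_diff: "f \<in> lipc \<Longrightarrow> g \<in> lipc \<Longrightarrow> (\<lambda>x. f x - g x) \<in> lipc"
  by (erule (1) lipc_binop[of f g "(-)"]) auto

lemma lipc_min: "f \<in> lipc \<Longrightarrow> g \<in> lipc \<Longrightarrow> (\<lambda>x. min (f x) (g x)) \<in> lipc"
  by (erule (1) lipc_binop[of f g min]) (auto simp: min_def)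

lemma lipc_max: "f \<in> lipc \<Longrightarrow> g \<in> lipc \<Longrightarrow> (\<lambda>x. max (f x) (g x)) \<in> lipc"
  by (erule (1) lipc_binop[of f g max]) (auto simp: max_def)

lemma lipc_cmult: 
  assumes "f \<in> lipc" shows "(\<lambda>x. c * f x) \<in> lipc"
proof -
  obtain L where L: "L-lipschitz_on UNIV f" using assms by (auto simp: lipc_def)
  have "(\<bar>c\<bar> * L)-lipschitz_on UNIV (\<lambda>x. c * f x)"
    using lipschitz_on_cmult_real[OF L] by simp
  moreover have "bounded {x. c * f x \<noteq> 0}"
    by (rule bounded_subset[of "{x. f x \<noteq> 0}"]) (use assms in \<open>auto simp: lipc_def\<close>)
  ultimately show ?thesis by (rule lipc_I)
qed

lemma lipc_clip:
  assumes f: "f \<in> lipc" and "\<phi> 0 = (0::real)" and "L-lipschitz_on UNIV \<phi>"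
  shows "(\<lambda>x. \<phi> (f x)) \<in> lipc"
proof -
  obtain M where M: "M-lipschitz_on UNIV f" using f by (auto simp: lipc_def)
  have "(L * M)-lipschitz_on UNIV (\<lambda>x. \<phi> (f x))"
    by (rule lipschitz_on_compose2[OF M]) (use assms(3) lipschitz_on_subset in blast)
  moreover have "bounded {x. \<phi> (f x) \<noteq> 0}"
    by (rule bounded_subset[of "{x. f x \<noteq> 0}"]) (use assms in \<open>auto simp: lipc_def\<close>)
  ultimately show ?thesis by (rule lipc_I)
qed

lemma lipc_sum: "(\<And>i. i \<in> I \<Longrightarrow> f i \<in> lipc) \<Longrightarrow> (\<lambda>x. \<Sum>i\<in>I. f i x) \<in> lipc"
  by (induction I rule: infinite_finite_induct) (auto intro: lipc_add)

lemma lipc_continuous: "f \<in> lipc \<Longrightarrow> continuous_on S f"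
  by (auto simp: lipc_def intro: lipschitz_on_continuous_on continuous_on_subset)

lemma lipc_measurable: "f \<in> lipc \<Longrightarrow> f \<in> borel_measurable borel"
  by (intro borel_measurable_continuous_onI lipc_continuous)

lemma continuous_bounded_support_bounded:
  fixes f :: "'a::euclidean_space \<Rightarrow> real"
  assumes "continuous_on UNIV f" "bounded {x. f x \<noteq> 0}"
  shows "\<exists>M\<ge>0. \<forall>x. \<bar>f x\<bar> \<le> M"
proof -
  have "compact (f ` closure {x. f x \<noteq> 0})"
    using assms by (intro compact_continuous_image) (auto intro: continuous_on_subset)
  then have "bounded (f ` closure {x. f x \<noteq> 0})" by (rule compact_imp_bounded)
  then obtain M where M: "\<forall>y \<in> f ` closure {x. f x \<noteq> 0}. \<bar>y\<bar> \<le> M"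
    unfolding bounded_real by (rule exE)
  have "\<bar>f x\<bar> \<le> max 0 M" for x
  proof (cases "f x = 0")
    case False
    then have "x \<in> closure {x. f x \<noteq> 0}" using closure_subset[of "{x. f x \<noteq> 0}"] by auto
    then show ?thesis using M by (auto intro: max.coboundedI2)
  qed auto
  then show ?thesis by (intro exI[of _ "max 0 M"]) auto
qed

lemma lipc_bounded:
  assumes "f \<in> lipc" obtains M where "0 \<le> M" "\<And>x. \<bar>f x\<bar> \<le> M"
  using continuous_bounded_support_bounded[OF lipc_continuous[OF assms]] assms that
  by (auto simp: lipc_def)

lemma lipc_integrable:
  assumes f: "f \<in> lipc" and P: "finite_measure P" "sets P = sets borel"
  shows "integrable P f"
proof -
  interpret finite_measure P by fact
  obtain M where "\<And>x. \<bar>f x\<bar> \<le> M" using lipc_bounded[OF f] by blast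
  then show ?thesis using f
    by (intro integrable_const_bound[of _ M]) (auto simp: measurable_cong_sets[OF P(2) refl] lipc_measurable)
qed

text \<open>Dini's theorem. Compactness is needed only on the closed support of \<open>w\<close>:
  elsewhere \<open>w\<close> is 0 and nonnegativity of \<open>s N\<close> suffices.\<close>

lemma lipc_Dini:
  assumes w: "w \<in> lipc" and s: "\<And>N. continuous_on UNIV (s N)"
    and mono: "\<And>N x. s N x \<le> s (Suc N) x" and nonneg: "\<And>N x. 0 \<le> s N x"
    and lim: "\<And>x. (\<lambda>N. s N x) \<longlonglongrightarrow> w x" and e: "0 < e"
  shows "\<exists>N. \<forall>x. w x - s N x < e"
proof -
  define K where "K = closure {x. w x \<noteq> 0}"
  define U where "U N = {x. w x - s N x < e}" for N
  have cK: "compact K" using w by (auto simp: lipc_def K_def)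
  have inc: "incseq (\<lambda>N. s N x)" for x using mono by (intro incseq_SucI) auto
  have oU: "open (U N)" for N
    unfolding U_def by (intro open_Collect_less continuous_intros lipc_continuous w s)
  have cov: "K \<subseteq> (\<Union>N\<in>UNIV. U N)"
  proof
    fix x assume "x \<in> K"
    have "(\<lambda>N. w x - s N x) \<longlonglongrightarrow> w x - w x" by (intro tendsto_intros lim)
    then have "\<forall>\<^sub>F N in sequentially. w x - s N x < e"
      using e by (intro order_tendstoD(2)[where a=e]) auto
    then show "x \<in> (\<Union>N\<in>UNIV. U N)" 
      by (auto simp: U_def eventually_sequentially)
  qed
  obtain D where D: "finite D" "K \<subseteq> (\<Union>N\<in>D. U N)"
    using compactE_image[OF cK _ cov] oU by metis
  \<comment> \<open>The added 0 covers the case of an empty subcover.\<close>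
  define N where "N = Max (insert 0 D)"
  have "w x - s N x < e" for x
  proof (cases "x \<in> K")
    case True
    then obtain M where "M \<in> D" "w x - s M x < e" using D by (auto simp: U_def)
    moreover from \<open>M \<in> D\<close> have "M \<le> N" using D(1) by (auto simp: N_def)
    then have "s M x \<le> s N x" using inc[of x] by (auto simp: incseq_def)
    ultimately show ?thesis by auto
  next
    case False
    then have "w x = 0" using closure_subset[of "{x. w x \<noteq> 0}"] by (auto simp: K_def)
    then show ?thesis using nonneg[of N x] e by auto
  qed
  then show ?thesis by blast
qed

section \<open>Lipschitz approximation of indicators of bounded open sets from below\<close>

definition dist_cutoff :: "'a::metric_space set \<Rightarrow> nat \<Rightarrow> 'a \<Rightarrow> real" where
  "dist_cutoff U k x = min 1 (real k * infdist x (- U))"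

lemma dist_cutoff:
  fixes U :: "'a::euclidean_space set"
  assumes "bounded U"
  shows "dist_cutoff U k \<in> lipc" "0 \<le> dist_cutoff U k x" "dist_cutoff U k x \<le> 1"
    "dist_cutoff U k x \<le> dist_cutoff U (Suc k) x"
proof -
  have "(\<lambda>x. infdist x (- U)) \<in> lipc"
  proof (rule lipc_I)
    show "1-lipschitz_on UNIV (\<lambda>x. infdist x (- U))"
      by (rule lipschitz_on_realI) (auto simp: diff_le_eq, metis add.commute infdist_triangle)
    show "bounded {x. infdist x (- U) \<noteq> 0}"
      by (rule bounded_subset[OF assms]) (use infdist_zero[of _ "- U"] in fastforce)
  qed
  moreover have "(real k)-lipschitz_on UNIV (\<lambda>t. min 1 (real k * t))"
  proof (rule lipschitz_on_realI)
    fix x y :: real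
    show "min 1 (real k * x) - min 1 (real k * y) \<le> real k * dist x y"
    proof -
      have "real k * x - real k * y \<le> real k * dist x y"
        unfolding right_diff_distrib[symmetric]
        by (intro mult_left_mono) (auto simp: dist_real_def)
      moreover have "0 \<le> real k * dist x y" by simp
      ultimately show ?thesis unfolding min_def by (smt (verit))
    qed
  qed simp
  ultimately show "dist_cutoff U k \<in> lipc"
    using lipc_clip[of "\<lambda>x. infdist x (- U)" "\<lambda>t. min 1 (real k * t)" "real k"]
    unfolding dist_cutoff_def[abs_def] by simp
  have d: "0 \<le> infdist x (- U)" by (rule infdist_nonneg)
  then show "0 \<le> dist_cutoff U k x" "dist_cutoff U k x \<le> 1" unfolding dist_cutoff_def by simp_all
  have "real k * infdist x (- U) \<le> real (Suc k) * infdist x (- U)"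
    by (rule mult_right_mono[OF _ d]) simp
  then show "dist_cutoff U k x \<le> dist_cutoff U (Suc k) x" unfolding dist_cutoff_def by (intro min.mono order_refl)
qed

lemma dist_cutoff_eq_1:
  fixes U :: "'a::euclidean_space set"
  assumes "bounded U" "open U" "x \<in> U"
  obtains k where "\<And>j. k \<le> j \<Longrightarrow> dist_cutoff U j x = 1"
proof -
  \<comment> \<open>The distance to the empty set is 0 by convention, so the complement of
    \<open>U\<close> has to be nonempty.\<close>
  have "- U \<noteq> {}"
  proof
    assume "- U = {}"
    then have "U = UNIV" by auto
    then show False using assms(1) not_bounded_UNIV[where 'a='a] by simp
  qed
  then have d: "0 < infdist x (- U)"
    using assms by (intro infdist_pos_not_in_closed) (auto simp: closed_Compl)
  obtain k where k: "1 < real k * infdist x (- U)"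
    using reals_Archimedean3[OF d] by blast
  have "dist_cutoff U j x = 1" if "k \<le> j" for j
  proof -
    have "real k * infdist x (- U) \<le> real j * infdist x (- U)"
      using that d by (intro mult_right_mono) auto
    then show ?thesis using k by (simp add: dist_cutoff_def)
  qed
  then show thesis by (rule that)
qed

lemma dist_cutoff_eq_0: "x \<notin> U \<Longrightarrow> dist_cutoff U k x = 0"
  by (simp add: dist_cutoff_def)

section \<open>The Riesz theorem for positive and for signed functionals\<close>

lemma sums_interval_lengths:
  fixes a b :: "nat \<Rightarrow> real"
  assumes ab: "\<And>n. a n \<le> b n" "c \<le> d"
    and disj: "disjoint_family (\<lambda>n. {a n..<b n})" and un: "(\<Union>n. {a n..<b n}) = {c..<d}"
  shows "(\<lambda>n. b n - a n) sums (d - c)"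
proof -
  have "(\<lambda>n. emeasure lborel {a n..<b n}) sums emeasure lborel (\<Union>n. {a n..<b n})"
    by (rule suminf_emeasure[OF _ disj, THEN sums_iff[THEN iffD2, OF conjI[OF summableI]]]) auto
  then have "(\<lambda>n. ennreal (b n - a n)) sums ennreal (d - c)"
    unfolding un using ab by simp
  then show ?thesis
    by (subst (asm) sums_ennreal) (use ab in auto)
qed

text \<open>The measure is obtained by Caratheodory extension from the semiring of regions between two graphs,
  on which countable additivity is Dini's theorem, and then restricted to strips of height one.\<close>

theorem lipc_Riesz_positive:
  fixes \<Lambda> :: "('a::euclidean_space \<Rightarrow> real) \<Rightarrow> real"
  assumes add: "\<And>f g. f \<in> lipc \<Longrightarrow> g \<in> lipc \<Longrightarrow> (\<And>x. 0 \<le> f x) \<Longrightarrow> (\<And>x. 0 \<le> g x) \<Longrightarrow>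
      \<Lambda> (\<lambda>x. f x + g x) = \<Lambda> f + \<Lambda> g"
    and scale: "\<And>f c. f \<in> lipc \<Longrightarrow> (\<And>x. 0 \<le> f x) \<Longrightarrow> 0 \<le> c \<Longrightarrow> \<Lambda> (\<lambda>x. c * f x) = c * \<Lambda> f"
    and nonneg: "\<And>f. f \<in> lipc \<Longrightarrow> (\<And>x. 0 \<le> f x) \<Longrightarrow> 0 \<le> \<Lambda> f"
    and bound: "\<And>f c. f \<in> lipc \<Longrightarrow> (\<And>x. 0 \<le> f x) \<Longrightarrow> (\<And>x. f x \<le> c) \<Longrightarrow> \<Lambda> f \<le> C * c"
  obtains P where "finite_measure P" "sets P = sets borel"
    "\<And>f. f \<in> lipc \<Longrightarrow> (\<And>x. 0 \<le> f x) \<Longrightarrow> \<Lambda> f = (LINT x|P. f x)"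
proof -
  have \<Lambda>0: "\<Lambda> (\<lambda>x. 0) = 0" using scale[of "\<lambda>x. 0" 0] by simp
  have mono: "\<Lambda> f \<le> \<Lambda> g" if "f \<in> lipc" "g \<in> lipc" "\<And>x. 0 \<le> f x" "\<And>x. f x \<le> g x" for f g
    using add[of f "\<lambda>x. g x - f x"] nonneg[of "\<lambda>x. g x - f x"] that lipc_diff[of g f] by simp
  have C0: "0 \<le> C" using bound[of "\<lambda>x. 0" 1] \<Lambda>0 by simp
  have sum\<Lambda>: "\<Lambda> (\<lambda>x. \<Sum>i<N. f i x) = (\<Sum>i<N. \<Lambda> (f i))"
    if "\<And>i. i < N \<Longrightarrow> f i \<in> lipc" "\<And>i x. i < N \<Longrightarrow> 0 \<le> f i x" for f and N::nat
    using that
  proof (induction N)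
    case (Suc N)
    have "\<Lambda> (\<lambda>x. (\<Sum>i<N. f i x) + f N x) = \<Lambda> (\<lambda>x. \<Sum>i<N. f i x) + \<Lambda> (f N)"
      by (intro add lipc_sum sum_nonneg) (use Suc.prems in auto)
    then show ?case using Suc by simp
  qed (simp add: \<Lambda>0)
  \<comment> \<open>Closed below and open above in the vertical variable, so that a difference of
    two regions is again a disjoint union of regions.\<close>
  define G :: "('a \<Rightarrow> real) \<Rightarrow> ('a \<Rightarrow> real) \<Rightarrow> ('a \<times> real) set"
    where "G f g = {(x,t). f x \<le> t \<and> t < g x}" for f g
  define I where "I f g \<longleftrightarrow> f \<in> lipc \<and> g \<in> lipc \<and> (\<forall>x. f x \<le> g x)" for f g :: "'a \<Rightarrow> real"
  define \<mu> where "\<mu> f g = ennreal (\<Lambda> (\<lambda>x. g x - f x))" for f g :: "'a \<Rightarrow> real"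
  define M where "M = extend_measure UNIV {(f,g). I f g} (\<lambda>(f,g). G f g) (\<lambda>(f,g). \<mu> f g)"
  have Gmem: "(x,t) \<in> G f g \<longleftrightarrow> f x \<le> t \<and> t < g x" for x t f g by (simp add: G_def)
  have semiring: "semiring_of_sets UNIV {G f g | f g. I f g}"
  proof
    show "{} \<in> {G f g |f g. I f g}"
      by (rule CollectI, rule exI[of _ "\<lambda>x. 0"], rule exI[of _ "\<lambda>x. 0"]) (auto simp: G_def I_def)
  next
    fix a b assume "a \<in> {G f g |f g. I f g}" "b \<in> {G f g |f g. I f g}"
    then obtain f g f' g' where I: "I f g" "I f' g'" and a: "a = G f g" and b: "b = G f' g'" by auto
    show "a \<inter> b \<in> {G f g |f g. I f g}"
      by (rule CollectI, rule exI[of _ "\<lambda>x. max (f x) (f' x)"],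
          rule exI[of _ "\<lambda>x. max (max (f x) (f' x)) (min (g x) (g' x))"])
        (use I in \<open>auto simp: a b G_def I_def intro!: lipc_max lipc_min\<close>)
    \<comment> \<open>The part of the first region below the graph of \<open>f'\<close> and the part
      above the graph of \<open>g'\<close>. The outer \<open>max\<close> and \<open>min\<close> keep
      the two bounding graphs in order where a part is empty.\<close>
    define A1 where "A1 = G f (\<lambda>x. max (f x) (min (g x) (f' x)))"
    define A2 where "A2 = G (\<lambda>x. min (g x) (max (f x) (g' x))) g"
    have fg: "\<And>x. f x \<le> g x" "\<And>x. f' x \<le> g' x" using I by (auto simp: I_def)
    have ab: "a - b = A1 \<union> A2"
    proof (rule set_eqI, clarify)
      fix x t
      show "(x,t) \<in> a - b \<longleftrightarrow> (x,t) \<in> A1 \<union> A2"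
        using fg[of x] unfolding a b A1_def A2_def by (auto simp: Gmem max_def min_def)
    qed
    have "A1 \<inter> A2 = {}"
    proof -
      have "(x,t) \<notin> A1 \<inter> A2" for x t
        using fg[of x] unfolding A1_def A2_def by (auto simp: Gmem max_def min_def split: if_splits)
      then show ?thesis by auto
    qed
    then have "disjoint {A1, A2}" by (auto simp: disjoint_def)
    moreover have "{A1,A2} \<subseteq> {G f g |f g. I f g}"
      using I fg by (auto simp: A1_def A2_def I_def intro!: exI lipc_max lipc_min)
    ultimately show "\<exists>C\<subseteq>{G f g |f g. I f g}. finite C \<and> disjoint C \<and> a - b = \<Union> C"
      using ab by (intro exI[of _ "{A1,A2}"]) auto
  qed auto
  have eM: "emeasure M (G f g) = \<mu> f g" if "I f g" for f g
  proof (rule extend_measure_caratheodory_pair[OF M_def that semiring])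
    fix i j assume ij: "I i j" "G i j = {}"
    have "i x = j x" for x
      using ij Gmem[of x "i x" i j] by (auto simp: I_def intro!: antisym)
    then have "i = j" by auto
    then show "\<mu> i j = 0" by (simp add: \<mu>_def \<Lambda>0)
  next
    fix i j k l assume ij: "I i j" "I k l" and eq: "G i j = G k l"
    \<comment> \<open>Where a fibre is empty the region does not determine the two graphs, but it
      always determines the fibre length, and \<open>\<mu>\<close> depends on nothing else.\<close>
    have "j x - i x = l x - k x" for x
    proof -
      have "{i x..<j x} = {k x..<l x}"
        using eq by (auto simp: set_eq_iff G_def)
      moreover have "i x \<le> j x" "k x \<le> l x" using ij by (auto simp: I_def)
      ultimately show ?thesis
        by (metis measure_lborel_Ico)
    qed
    then show "\<mu> i j = \<mu> k l" by (simp add: \<mu>_def)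
  next
    fix A B :: "nat \<Rightarrow> 'a \<Rightarrow> real" and j k
    assume AB: "\<And>n. I (A n) (B n)" and jk: "I j k" and disj: "disjoint_family (\<lambda>n. G (A n) (B n))"
      and un: "(\<Union>i. G (A i) (B i)) = G j k"
    define d where "d n x = B n x - A n x" for n x
    define w where "w x = k x - j x" for x
    have d: "d n \<in> lipc" "0 \<le> d n x" for n x
      using AB[of n] unfolding d_def[abs_def] by (auto simp: I_def intro: lipc_diff)
    have w: "w \<in> lipc" "0 \<le> w x" for x
      using jk unfolding w_def[abs_def] by (auto simp: I_def intro: lipc_diff)
    \<comment> \<open>Fibrewise this is countable additivity of Lebesgue measure on half-open
      intervals.\<close>
    have sums: "(\<lambda>n. d n x) sums w x" for x
      unfolding d_def w_def
    proof (rule sums_interval_lengths)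
      show "A n x \<le> B n x" for n using AB by (auto simp: I_def)
      show "j x \<le> k x" using jk by (auto simp: I_def)
      have sl: "{t. (x,t) \<in> G f g} = {f x..<g x}" for f g by (auto simp: G_def)
      show "disjoint_family (\<lambda>n. {A n x..<B n x})"
        using disj unfolding sl[symmetric] disjoint_family_on_def by blast
      show "(\<Union>n. {A n x..<B n x}) = {j x..<k x}"
        using un unfolding sl[symmetric] by blast
    qed
    define s where "s N x = (\<Sum>n<N. d n x)" for N x
    have s: "s N \<in> lipc" "0 \<le> s N x" "s N x \<le> s (Suc N) x" for N x
      using d by (auto simp: s_def[abs_def] intro!: lipc_sum sum_nonneg)
    have slim: "(\<lambda>N. s N x) \<longlonglongrightarrow> w x" for x
      using sums[of x] by (simp add: sums_def s_def)
    have sw: "s N x \<le> w x" for N x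
      by (rule incseq_le[OF _ slim]) (use s in \<open>auto intro: incseq_SucI\<close>)
    have "(\<lambda>n. \<Lambda> (d n)) sums \<Lambda> w"
      unfolding sums_def
    proof (rule LIMSEQ_I)
      fix e :: real assume e: "0 < e"
      \<comment> \<open>Dini leaves a remainder uniformly below \<open>e'\<close>, which
        \<open>bound\<close> turns into at most \<open>C * e'\<close>. The \<open>+ 1\<close> allows
        \<open>C = 0\<close>.\<close>
      define e' where "e' = e / (C + 1)"
      have e': "0 < e'" "C * e' < e" using e C0 by (auto simp: e'_def field_simps)
      have "\<exists>N. \<forall>x. w x - s N x < e'"
        by (rule lipc_Dini) (use w s slim e' in \<open>auto intro: lipc_continuous\<close>)
      then obtain N where N: "\<And>x. w x - s N x < e'" by blast
      have "norm ((\<Sum>n<m. \<Lambda> (d n)) - \<Lambda> w) < e" if "m \<ge> N" for m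
      proof -
        have "s N x \<le> s m x" for x
          using that s(3) by (meson lift_Suc_mono_le)
        then have wm: "w x - s m x \<le> e'" for x using N[of x] less_imp_le by (smt (verit))
        have 1: "(\<Sum>n<m. \<Lambda> (d n)) = \<Lambda> (s m)"
          unfolding s_def[abs_def] by (intro sum\<Lambda>[symmetric] d)
        have "\<Lambda> (\<lambda>x. s m x + (w x - s m x)) = \<Lambda> (s m) + \<Lambda> (\<lambda>x. w x - s m x)"
          by (intro add s lipc_diff w) (use sw in auto)
        then have 2: "\<Lambda> w - \<Lambda> (s m) = \<Lambda> (\<lambda>x. w x - s m x)" by simp
        have "0 \<le> \<Lambda> (\<lambda>x. w x - s m x)" "\<Lambda> (\<lambda>x. w x - s m x) \<le> C * e'"
          by (intro nonneg bound lipc_diff w s; use sw wm in auto)+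
        then show ?thesis using 1 2 e' by auto
      qed
      then show "\<exists>no. \<forall>n\<ge>no. norm ((\<Sum>n<n. \<Lambda> (d n)) - \<Lambda> w) < e" by blast
    qed
    then have "(\<lambda>n. ennreal (\<Lambda> (d n))) sums ennreal (\<Lambda> w)"
      by (subst sums_ennreal) (auto intro!: nonneg d w)
    then show "(\<Sum>n. \<mu> (A n) (B n)) = \<mu> j k"
      unfolding \<mu>_def d_def[abs_def] w_def[abs_def] by (rule sums_unique[symmetric])
  qed auto
  have GPow: "(\<lambda>(f,g). G f g) ` {(f,g). I f g} \<subseteq> Pow UNIV" by simp
  have spM: "space M = UNIV"
    unfolding M_def by (rule space_extend_measure) simp
  have GM: "G f g \<in> sets M" if "I f g" for f g
    unfolding M_def sets_extend_measure[OF GPow] using that by (intro sigma_sets.Basic) auto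
  have bf: "dist_cutoff U k \<in> lipc" "0 \<le> dist_cutoff U k x" "dist_cutoff U k x \<le> 1"
    "dist_cutoff U k x \<le> dist_cutoff U (Suc k) x"
    if "bounded U" for U :: "'a set" and k x
    using dist_cutoff[OF that] by auto
  have Ibf: "I (\<lambda>x. 0) (dist_cutoff U k)" if "bounded U" for U k
    using bf[OF that] by (auto simp: I_def)
  \<comment> \<open>Strips of height one over bounded open sets are increasing unions of generating
    regions. This makes them measurable, and \<open>bound\<close> with \<open>c = 1\<close> limits
    their mass by \<open>C\<close>.\<close>
  have strip: "U \<times> {0..<1} = (\<Union>k. G (\<lambda>x. 0) (dist_cutoff U k))" if U: "bounded U" "open U" for U
  proof (rule set_eqI, clarify)
    fix x and t :: real
    show "(x, t) \<in> U \<times> {0..<1} \<longleftrightarrow> (x, t) \<in> (\<Union>k. G (\<lambda>x. 0) (dist_cutoff U k))"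
    proof (cases "x \<in> U")
      case True
      then obtain k where "dist_cutoff U k x = 1" using dist_cutoff_eq_1[OF U] by blast
      then show ?thesis using True bf(3)[OF U(1), of _ x]
        by (auto simp: G_def intro: exI[of _ k] order_less_le_trans)
    next
      case False
      then have "dist_cutoff U k x = 0" for k by (simp add: dist_cutoff_def)
      then show ?thesis using False by (auto simp: G_def)
    qed
  qed
  have stripM: "U \<times> {0..<1} \<in> sets M" if "bounded U" "open U" for U
    unfolding strip[OF that] using GM[OF Ibf[OF that(1)]] by (intro sets.countable_UN) auto
  have stripC: "emeasure M (U \<times> {0..<1}) \<le> ennreal C" if U: "bounded U" "open U" for U
  proof -
    have "emeasure M (U \<times> {0..<1}) = (SUP k. emeasure M (G (\<lambda>x. 0) (dist_cutoff U k)))"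
      unfolding strip[OF U]
    proof (rule SUP_emeasure_incseq[symmetric])
      show "range (\<lambda>k. G (\<lambda>x. 0) (dist_cutoff U k)) \<subseteq> sets M" using GM[OF Ibf[OF U(1)]] by auto
      show "incseq (\<lambda>k. G (\<lambda>x. 0) (dist_cutoff U k))"
        by (rule incseq_SucI) (use bf(4)[OF U(1)] in \<open>auto simp: G_def intro: less_le_trans\<close>)
    qed
    also have "\<dots> \<le> ennreal C"
    proof (rule SUP_least)
      fix k
      have "\<Lambda> (dist_cutoff U k) \<le> C * 1" by (rule bound) (use bf[OF U(1)] in auto)
      then show "emeasure M (G (\<lambda>x. 0) (dist_cutoff U k)) \<le> ennreal C"
        by (subst eM[OF Ibf[OF U(1)]]) (simp add: \<mu>_def ennreal_leI)
    qed
    finally show ?thesis .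
  qed
  define H :: "('a \<times> real) set" where "H = UNIV \<times> {0..<1}"
  define Bn where "Bn n = box (- (real n *\<^sub>R One)) (real n *\<^sub>R (One::'a))" for n :: nat
  have Bn: "bounded (Bn n)" "open (Bn n)" for n by (auto simp: Bn_def bounded_box)
  have UBn: "(\<Union>n. Bn n) = UNIV" unfolding Bn_def by (rule UN_box_eq_UNIV)
  have HU: "H = (\<Union>n. Bn n \<times> {0..<1})" using UBn by (auto simp: H_def)
  have HM: "H \<in> sets M" unfolding HU using stripM[OF Bn] by (intro sets.countable_UN) auto
  have incBn: "incseq (\<lambda>n. Bn n \<times> {0..<1::real})"
    by (rule incseq_SucI, rule Sigma_mono)
      (auto simp: Bn_def mem_box algebra_simps intro: order_less_le_trans[OF _ order_refl],
       force+)
  have HC: "emeasure M H \<le> ennreal C"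
  proof -
    have "emeasure M H = (SUP n. emeasure M (Bn n \<times> {0..<1}))"
      unfolding HU by (rule SUP_emeasure_incseq[symmetric]) (use incBn stripM[OF Bn] in auto)
    also have "\<dots> \<le> ennreal C" by (intro SUP_least stripC Bn)
    finally show ?thesis .
  qed
  define R where "R = restrict_space M H"
  have spR: "space R = H" by (simp add: R_def space_restrict_space spM)
  have fm: "fst \<in> measurable R borel"
    unfolding borel_eq_box
  proof (rule measurable_sigma_sets[where \<Omega>=UNIV and A="range (\<lambda>(a,b). box a b)"])
    fix y assume "y \<in> range (\<lambda>(a, b). box a (b::'a))"
    then obtain a b where y: "y = box a b" by auto
    have "fst -` y \<inter> space R = box a b \<times> {0..<1}" by (auto simp: y spR H_def)
    also have "\<dots> \<in> sets R"
      unfolding R_def using stripM[of "box a b"] HM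
      by (subst sets_restrict_space_iff) (auto simp: bounded_box spM H_def)
    finally show "fst -` y \<inter> space R \<in> sets R" .
  qed auto
  \<comment> \<open>The projection gives \<open>A\<close> the mass of the strip of height one over
    \<open>A\<close>. The region below a function with values in [0,1] lies in that strip.\<close>
  define P where "P = distr R borel fst"
  have sP: "sets P = sets borel" by (simp add: P_def)
  have eP: "emeasure P A = emeasure M (A \<times> {0..<1})" and mP: "A \<times> {0..<1::real} \<in> sets M"
    if "A \<in> sets borel" for A
  proof -
    have *: "fst -` A \<inter> space R = A \<times> {0..<1}" by (auto simp: spR H_def)
    have **: "A \<times> {0..<1} \<in> sets R" using measurable_sets[OF fm that] * by simp
    have sub: "A \<times> {0..<1} \<subseteq> H" by (auto simp: H_def)
    show "A \<times> {0..<1::real} \<in> sets M" using ** HM unfolding R_def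
      by (subst (asm) sets_restrict_space_iff) (auto simp: spM)
    show "emeasure P A = emeasure M (A \<times> {0..<1})"
    proof -
      have "emeasure P A = emeasure R (fst -` A \<inter> space R)"
        unfolding P_def by (rule emeasure_distr[OF fm that])
      also have "\<dots> = emeasure M (A \<times> {0..<1})"
        unfolding * unfolding R_def by (rule emeasure_restrict_space) (use sub HM in \<open>auto simp: spM\<close>)
      finally show ?thesis .
    qed
  qed
  have "emeasure P UNIV \<le> ennreal C" using eP[of UNIV] HC by (simp add: H_def)
  then interpret P: finite_measure P
    by (intro finite_measureI) (auto simp: P_def top_unique)
  define p where "p = measure P UNIV"
  have main1: "\<Lambda> f = (LINT x|P. f x)" if f: "f \<in> lipc" "\<And>x. 0 \<le> f x" "\<And>x. f x \<le> 1" for f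
  proof -
    \<comment> \<open>The function is cut into \<open>N\<close> layers \<open>fi i\<close>, each
      stretched to height one. Both the functional and the integral of layer \<open>i\<close> lie
      between the masses of the superlevel sets \<open>A (Suc i)\<close> and \<open>A i\<close>, so
      the \<open>N\<close> errors telescope to at most the total mass \<open>p\<close>. As
      \<open>N\<close> is arbitrary, the difference is zero.\<close>
    have est: "real N * \<bar>\<Lambda> f - (LINT x|P. f x)\<bar> \<le> p" if N: "0 < N" for N :: nat
    proof -
      define fi where "fi i x = min 1 (max 0 (real N * f x - real i))" for i :: nat and x
      define A where "A i = {x. real i < real N * f x}" for i :: nat
      have fi: "fi i \<in> lipc" "0 \<le> fi i x" "fi i x \<le> 1" for i x
        unfolding fi_def[abs_def]
        by (rule lipc_clip[of "\<lambda>x. real N * f x" "\<lambda>t. min 1 (max 0 (t - real i))" 1])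
          (auto intro!: lipc_cmult f lipschitz_on_realI simp: dist_real_def min_def max_def)
      have sum_fi: "(\<Sum>i<K. fi i x) = min (real K) (real N * f x)" for K x
        by (induction K) (use f(2)[of x] in \<open>auto simp: fi_def min_def max_def\<close>)
      have sum_fi': "(\<lambda>x. \<Sum>i<N. fi i x) = (\<lambda>x. real N * f x)"
        unfolding sum_fi using f(3) by (intro ext min.absorb2) (simp add: mult_left_le)
      have Ab: "A i \<in> sets borel" for i
        unfolding A_def using lipc_measurable[OF f(1)] by measurable
      have AP: "A i \<in> sets P" for i using Ab by (simp add: sP)
      have AS: "x \<in> A (Suc i) \<Longrightarrow> fi i x = 1" "x \<notin> A i \<Longrightarrow> fi i x = 0" for i x
        by (auto simp: A_def fi_def)
      have Ifi: "I (\<lambda>x. 0) (fi i)" for i using fi by (auto simp: I_def)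
      have L1: "measure P (A (Suc i)) \<le> \<Lambda> (fi i)" "\<Lambda> (fi i) \<le> measure P (A i)" for i
      proof -
        have e: "emeasure M (G (\<lambda>x. 0) (fi i)) = ennreal (\<Lambda> (fi i))"
          by (subst eM[OF Ifi]) (simp add: \<mu>_def)
        have "emeasure M (A (Suc i) \<times> {0..<1}) \<le> emeasure M (G (\<lambda>x. 0) (fi i))"
          by (rule emeasure_mono) (use GM[OF Ifi] AS(1) in \<open>auto simp: G_def\<close>)
        then show "measure P (A (Suc i)) \<le> \<Lambda> (fi i)"
          unfolding e eP[OF Ab, symmetric] P.emeasure_eq_measure using nonneg[OF fi(1) fi(2), of i]
          by (simp add: ennreal_le_iff)
        have "x \<in> A i \<and> t < 1" if "0 \<le> t" "t < fi i x" for x t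
          using that AS(2)[of x i] fi(3)[of i x] by (cases "x \<in> A i") auto
        then have "emeasure M (G (\<lambda>x. 0) (fi i)) \<le> emeasure M (A i \<times> {0..<1})"
          by (intro emeasure_mono mP Ab) (auto simp: G_def)
        then show "\<Lambda> (fi i) \<le> measure P (A i)"
          unfolding e eP[OF Ab, symmetric] P.emeasure_eq_measure
          by (simp add: ennreal_le_iff)
      qed
      have intfi: "integrable P (fi i)" for i
        by (rule lipc_integrable[OF fi(1) P.finite_measure_axioms sP])
      have L2: "measure P (A (Suc i)) \<le> (LINT x|P. fi i x)" "(LINT x|P. fi i x) \<le> measure P (A i)" for i
      proof -
        have *: "measure P (A j) = (LINT x|P. indicat_real (A j) x)" for j
          using AP by simp
        have **: "integrable P (indicat_real (A j))" for j
          using AP[of j] by (simp add: P.emeasure_eq_measure)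
        show "measure P (A (Suc i)) \<le> (LINT x|P. fi i x)" unfolding *
          by (rule integral_mono[OF ** intfi]) (use AS(1) fi in \<open>auto simp: indicator_def\<close>)
        show "(LINT x|P. fi i x) \<le> measure P (A i)" unfolding *
          by (rule integral_mono[OF intfi **]) (use AS(2) fi in \<open>auto simp: indicator_def\<close>)
      qed
      have "real N * (\<Lambda> f - (LINT x|P. f x)) = \<Lambda> (\<lambda>x. \<Sum>i<N. fi i x) - (LINT x|P. (\<Sum>i<N. fi i x))"
        unfolding sum_fi' using scale[OF f(1,2), of "real N"] by (simp add: algebra_simps)
      also have "\<dots> = (\<Sum>i<N. \<Lambda> (fi i) - (LINT x|P. fi i x))"
        using intfi by (subst sum\<Lambda>) (auto simp: fi sum_subtractf)
      finally have "real N * \<bar>\<Lambda> f - (LINT x|P. f x)\<bar> = \<bar>\<Sum>i<N. \<Lambda> (fi i) - (LINT x|P. fi i x)\<bar>"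
        by (metis abs_mult abs_of_nat)
      also have "\<dots> \<le> (\<Sum>i<N. \<bar>\<Lambda> (fi i) - (LINT x|P. fi i x)\<bar>)" by (rule sum_abs)
      also have "\<dots> \<le> (\<Sum>i<N. measure P (A i) - measure P (A (Suc i)))"
        by (rule sum_mono) (use L1 L2 in \<open>smt (verit)\<close>)
      also have "\<dots> = measure P (A 0) - measure P (A N)" by (rule sum_lessThan_telescope')
      also have "\<dots> \<le> p" unfolding p_def
        using P.bounded_measure[of "A 0"] measure_nonneg[of P "A N"] sets_eq_imp_space_eq[OF sP]
        unfolding space_borel by (metis diff_ge_0_iff_ge diff_right_mono add_increasing2 diff_le_eq)
      finally show ?thesis .
    qed
    show ?thesis
    proof (rule ccontr)
      assume "\<Lambda> f \<noteq> (LINT x|P. f x)"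
      then have "0 < \<bar>\<Lambda> f - (LINT x|P. f x)\<bar>" by simp
      then obtain N :: nat where "p < real N * \<bar>\<Lambda> f - (LINT x|P. f x)\<bar>"
        using reals_Archimedean3 by blast
      moreover have "0 \<le> p" by (simp add: p_def)
      ultimately show False using est[of N] by (cases "N = 0") auto
    qed
  qed
  have "\<Lambda> f = (LINT x|P. f x)" if f: "f \<in> lipc" "\<And>x. 0 \<le> f x" for f
  proof -
    obtain K where K: "0 \<le> K" "\<And>x. \<bar>f x\<bar> \<le> K" using lipc_bounded[OF f(1)] by blast
    \<comment> \<open>Division by \<open>c\<close> brings the values into [0,1], where
      \<open>main1\<close> applies; the \<open>+ 1\<close> keeps \<open>c\<close> positive.\<close>
    define c where "c = K + 1"
    have c: "0 < c" "\<And>x. f x \<le> c" using K by (auto simp: c_def abs_le_iff add_increasing2)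
    have "\<Lambda> (\<lambda>x. (1 / c) * f x) = (LINT x|P. (1 / c) * f x)"
      by (rule main1[OF lipc_cmult[OF f(1)]]) (use c f in \<open>auto simp: field_simps\<close>)
    then show ?thesis
      using scale[OF f, of "1 / c"] c by simp
  qed
  then show thesis using that[of P] P.finite_measure_axioms sP by blast
qed

text \<open>The positive part of \<open>L\<close> at \<open>f\<close> is the supremum of
  \<open>L g\<close> over admissible \<open>g\<close> between 0 and \<open>f\<close>. It is additive
  on nonnegative functions because minima split competitors, and subtracting \<open>L\<close> from
  it leaves a second positive functional.\<close>

theorem lipc_Riesz_signed:
  fixes L :: "('a::euclidean_space \<Rightarrow> real) \<Rightarrow> real"
  assumes add: "\<And>f g. f \<in> lipc \<Longrightarrow> g \<in> lipc \<Longrightarrow> L (\<lambda>x. f x + g x) = L f + L g"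
    and scale: "\<And>f c. f \<in> lipc \<Longrightarrow> L (\<lambda>x. c * f x) = c * L f"
    and bound: "\<And>f c. f \<in> lipc \<Longrightarrow> (\<And>x. \<bar>f x\<bar> \<le> c) \<Longrightarrow> \<bar>L f\<bar> \<le> C * c"
  obtains P N where "finite_measure P" "finite_measure N" "sets P = sets borel" "sets N = sets borel"
    "\<And>f. f \<in> lipc \<Longrightarrow> L f = (LINT x|P. f x) - (LINT x|N. f x)"
proof -
  have L0: "L (\<lambda>x. 0) = 0" using scale[of "\<lambda>x. 0" 0] by simp
  have sub: "L (\<lambda>x. f x - g x) = L f - L g" if "f \<in> lipc" "g \<in> lipc" for f g
    using add[OF that(1) lipc_cmult[OF that(2)], of "-1"] scale[OF that(2), of "-1"] by simp
  have C0: "0 \<le> C" using bound[of "\<lambda>x. 0" 1] L0 by simp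
  define S where "S f = {L g | g. g \<in> lipc \<and> (\<forall>x. 0 \<le> g x) \<and> (\<forall>x. g x \<le> f x)}" for f
  define \<Lambda> where "\<Lambda> f = Sup (S f)" for f
  have S_bd: "s \<le> C * c" if s: "s \<in> S f" "\<And>x. f x \<le> c" for s f c
  proof -
    obtain g where g: "s = L g" "g \<in> lipc" "\<And>x. 0 \<le> g x" "\<And>x. g x \<le> f x"
      using s(1) unfolding S_def by blast
    have "\<bar>L g\<bar> \<le> C * c" 
      by (rule bound[OF g(2)]) (use g(3,4) that(2) in \<open>auto intro: order_trans\<close>)
    then show ?thesis using g by auto
  qed
  have S_bdd: "bdd_above (S f)" if f: "f \<in> lipc" for f
  proof -
    obtain K where "\<And>x. \<bar>f x\<bar> \<le> K" using lipc_bounded[OF f] by blast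
    then show ?thesis using S_bd[of _ f K] by (intro bdd_aboveI[of _ "C * K"]) (auto simp: abs_le_iff)
  qed
  have S0: "0 \<in> S f" if "\<And>x. 0 \<le> f x" for f
    unfolding S_def using L0 that by (intro CollectI exI[of _ "\<lambda>x. 0"]) auto
  have SL: "L f \<in> S f" if "f \<in> lipc" "\<And>x. 0 \<le> f x" for f
    unfolding S_def using that by auto
  have upper: "s \<le> \<Lambda> f" if "s \<in> S f" "f \<in> lipc" for s f
    unfolding \<Lambda>_def by (rule cSup_upper[OF that(1) S_bdd[OF that(2)]])
  have \<Lambda>nonneg: "0 \<le> \<Lambda> f" if "f \<in> lipc" "\<And>x. 0 \<le> f x" for f
    using upper[OF S0 that(1)] that by blast
  have \<Lambda>bound: "\<Lambda> f \<le> C * c" if "f \<in> lipc" "\<And>x. 0 \<le> f x" "\<And>x. f x \<le> c" for f c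
    unfolding \<Lambda>_def using S0[of f] S_bd[of _ f c] that by (intro cSup_least) auto
  have \<Lambda>add: "\<Lambda> (\<lambda>x. f x + g x) = \<Lambda> f + \<Lambda> g"
    if fg: "f \<in> lipc" "g \<in> lipc" "\<And>x. 0 \<le> f x" "\<And>x. 0 \<le> g x" for f g
  proof (rule antisym)
    show "\<Lambda> (\<lambda>x. f x + g x) \<le> \<Lambda> f + \<Lambda> g"
      unfolding \<Lambda>_def[of "\<lambda>x. f x + g x"]
    proof (rule cSup_least)
      show "S (\<lambda>x. f x + g x) \<noteq> {}" using S0[of "\<lambda>x. f x + g x"] fg by auto
      fix s assume "s \<in> S (\<lambda>x. f x + g x)"
      then obtain h where h: "s = L h" "h \<in> lipc" "\<And>x. 0 \<le> h x" "\<And>x. h x \<le> f x + g x"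
        unfolding S_def by blast
      \<comment> \<open>Riesz decomposition: the part of \<open>h\<close> below \<open>f\<close>
        competes for \<open>f\<close>, and the rest is at most \<open>g\<close>.\<close>
      define h1 where "h1 x = min (h x) (f x)" for x
      have h1: "h1 \<in> lipc" unfolding h1_def[abs_def] by (intro lipc_min h fg)
      have "L h1 \<in> S f" unfolding S_def using h1 h(3) fg(3) by (auto simp: h1_def)
      moreover have "L (\<lambda>x. h x - h1 x) \<in> S g"
        unfolding S_def using lipc_diff[OF h(2) h1] h(4) fg(4)
        by (intro CollectI exI[of _ "\<lambda>x. h x - h1 x"]) (auto simp: h1_def min_def algebra_simps)
      moreover have "L h = L h1 + L (\<lambda>x. h x - h1 x)" using sub[OF h(2) h1] by simp
      ultimately show "s \<le> \<Lambda> f + \<Lambda> g" using upper fg h(1) by (metis add_mono)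
    qed
    have "\<Lambda> f \<le> \<Lambda> (\<lambda>x. f x + g x) - \<Lambda> g"
      unfolding \<Lambda>_def[of f]
    proof (rule cSup_least)
      show "S f \<noteq> {}" using S0[of f] fg by auto
      fix s assume s: "s \<in> S f"
      have "\<Lambda> g \<le> \<Lambda> (\<lambda>x. f x + g x) - s"
        unfolding \<Lambda>_def[of g]
      proof (rule cSup_least)
        show "S g \<noteq> {}" using S0[of g] fg by auto
        fix t assume "t \<in> S g"
        then obtain h2 where h2: "t = L h2" "h2 \<in> lipc" "\<And>x. 0 \<le> h2 x" "\<And>x. h2 x \<le> g x"
          unfolding S_def by blast
        obtain h1 where h1: "s = L h1" "h1 \<in> lipc" "\<And>x. 0 \<le> h1 x" "\<And>x. h1 x \<le> f x"
          using s unfolding S_def by blast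
        have "s + t \<in> S (\<lambda>x. f x + g x)"
          unfolding S_def using add[OF h1(2) h2(2)] h1 h2 lipc_add[OF h1(2) h2(2)]
          by (intro CollectI exI[of _ "\<lambda>x. h1 x + h2 x"]) (auto intro: add_mono)
        then have "s + t \<le> \<Lambda> (\<lambda>x. f x + g x)" by (rule upper[OF _ lipc_add[OF fg(1,2)]])
        then show "t \<le> \<Lambda> (\<lambda>x. f x + g x) - s" by simp
      qed
      then show "s \<le> \<Lambda> (\<lambda>x. f x + g x) - \<Lambda> g" by simp
    qed
    then show "\<Lambda> f + \<Lambda> g \<le> \<Lambda> (\<lambda>x. f x + g x)" by simp
  qed
  have \<Lambda>scale_le: "c * \<Lambda> f \<le> \<Lambda> (\<lambda>x. c * f x)"
    if f: "f \<in> lipc" "\<And>x. 0 \<le> f x" and c: "0 < c" for f c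
  proof -
    have "\<Lambda> f \<le> \<Lambda> (\<lambda>x. c * f x) / c"
      unfolding \<Lambda>_def[of f]
    proof (rule cSup_least)
      show "S f \<noteq> {}" using S0[of f] f by auto
      fix s assume "s \<in> S f"
      then obtain h where h: "s = L h" "h \<in> lipc" "\<And>x. 0 \<le> h x" "\<And>x. h x \<le> f x"
        unfolding S_def by blast
      have "c * s \<in> S (\<lambda>x. c * f x)"
        unfolding S_def using scale[OF h(2), of c] h c lipc_cmult[OF h(2), of c]
        by (intro CollectI exI[of _ "\<lambda>x. c * h x"]) auto
      then have "c * s \<le> \<Lambda> (\<lambda>x. c * f x)" by (rule upper[OF _ lipc_cmult[OF f(1)]])
      then show "s \<le> \<Lambda> (\<lambda>x. c * f x) / c" using c by (simp add: field_simps)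
    qed
    then show ?thesis using c by (simp add: field_simps)
  qed
  have \<Lambda>scale: "\<Lambda> (\<lambda>x. c * f x) = c * \<Lambda> f" if f: "f \<in> lipc" "\<And>x. 0 \<le> f x" and c: "0 \<le> c" for f c
  proof (cases "c = 0")
    case True
    then show ?thesis using \<Lambda>add[of "\<lambda>x. 0" "\<lambda>x. 0"] by simp
  next
    case False
    then have c: "0 < c" using c by simp
    have "(1 / c) * \<Lambda> (\<lambda>x. c * f x) \<le> \<Lambda> (\<lambda>x. (1 / c) * (c * f x))"
      by (rule \<Lambda>scale_le[OF lipc_cmult[OF f(1)]]) (use f c in auto)
    then have "\<Lambda> (\<lambda>x. c * f x) \<le> c * \<Lambda> f" using c by (simp add: field_simps)
    then show ?thesis using \<Lambda>scale_le[OF f c] by simp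
  qed
  obtain P where P: "finite_measure P" "sets P = sets borel"
    "\<And>f. f \<in> lipc \<Longrightarrow> (\<And>x. 0 \<le> f x) \<Longrightarrow> \<Lambda> f = (LINT x|P. f x)"
    by (rule lipc_Riesz_positive[of \<Lambda> C]) (use \<Lambda>add \<Lambda>scale \<Lambda>nonneg \<Lambda>bound in auto)
  \<comment> \<open>Nonnegative on nonnegative \<open>f\<close>, since \<open>f\<close> itself
    competes in the supremum.\<close>
  define \<Gamma> where "\<Gamma> f = \<Lambda> f - L f" for f
  have \<Gamma>bound: "\<Gamma> f \<le> (2 * C) * c" if f: "f \<in> lipc" "\<And>x. 0 \<le> f x" "\<And>x. f x \<le> c" for f c
    using \<Lambda>bound[OF f] bound[OF f(1), of c] f(2,3) by (auto simp: \<Gamma>_def abs_le_iff)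
  obtain N where N: "finite_measure N" "sets N = sets borel"
    "\<And>f. f \<in> lipc \<Longrightarrow> (\<And>x. 0 \<le> f x) \<Longrightarrow> \<Gamma> f = (LINT x|N. f x)"
  proof (rule lipc_Riesz_positive[of \<Gamma> "2 * C"])
    show "0 \<le> \<Gamma> f" if "f \<in> lipc" "\<And>x. 0 \<le> f x" for f
      unfolding \<Gamma>_def using upper[OF SL[OF that] that(1)] by simp
  qed (use \<Lambda>add \<Lambda>scale add scale \<Gamma>bound in \<open>auto simp: \<Gamma>_def algebra_simps\<close>)
  have pos: "L f = (LINT x|P. f x) - (LINT x|N. f x)" if "f \<in> lipc" "\<And>x. 0 \<le> f x" for f
    using P(3)[OF that] N(3)[OF that] by (simp add: \<Gamma>_def)
  have "L f = (LINT x|P. f x) - (LINT x|N. f x)" if f: "f \<in> lipc" for f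
  proof -
    define a where "a x = max (f x) 0" for x
    define b where "b x = max (0 - f x) 0" for x
    have ab: "a \<in> lipc" "b \<in> lipc" unfolding a_def[abs_def] b_def[abs_def]
      by (intro lipc_max f lipc_zero lipc_diff)+
    have fab: "f = (\<lambda>x. a x - b x)" by (auto simp: a_def b_def)
    have i: "integrable P a" "integrable P b" "integrable N a" "integrable N b"
      using ab P N by (auto intro: lipc_integrable)
    have "L f = L a - L b" unfolding fab by (rule sub[OF ab])
    also have "\<dots> = (LINT x|P. f x) - (LINT x|N. f x)"
    proof -
      have "0 \<le> a x" "0 \<le> b x" for x by (auto simp: a_def b_def)
      then show ?thesis using pos[OF ab(1)] pos[OF ab(2)] i unfolding fab by simp
    qed
    finally show ?thesis .
  qed
  then show thesis using that[of P N] P N by blast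
qed

section \<open>Lebesgue differentiation on balls\<close>

text \<open>Vitali's covering theorem in the form that both density estimates use. The set
  \<open>S\<close> is arbitrary, so the sets of bad points need not be shown measurable.\<close>

lemma Vitali_balls_in_open:
  fixes S :: "'a::euclidean_space set"
  assumes U: "open U" "S \<subseteq> U"
    and Q: "\<And>x d. x \<in> S \<Longrightarrow> 0 < d \<Longrightarrow> \<exists>r. 0 < r \<and> r < d \<and> Q x r"
  obtains C where "countable C" "\<And>p. p \<in> C \<Longrightarrow> 0 < snd p \<and> ball (fst p) (snd p) \<subseteq> U \<and> Q (fst p) (snd p)"
    "disjoint_family_on (\<lambda>p. ball (fst p) (snd p)) C"
    "S - (\<Union>p\<in>C. ball (fst p) (snd p)) \<in> null_sets lebesgue"
proof -
  define K where "K = {p. 0 < snd p \<and> ball (fst p) (snd p) \<subseteq> U \<and> Q (fst p) (snd p)}"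
  have "\<exists>i. i \<in> K \<and> x \<in> ball (fst i) (snd i) \<and> snd i < d" if x: "x \<in> S" and d: "0 < d" for x d
  proof -
    obtain e where e: "0 < e" "ball x e \<subseteq> U" using U x open_contains_ball by blast
    obtain r where r: "0 < r" "r < min d e" "Q x r" using Q[OF x, of "min d e"] d e by auto
    have "ball x r \<subseteq> U" using e(2) r(2) subset_ball[of r e x] by auto
    then show ?thesis using r by (intro exI[of _ "(x,r)"]) (auto simp: K_def)
  qed
  then obtain C where C: "countable C" "C \<subseteq> K"
     "pairwise (\<lambda>i j. disjnt (ball (fst i) (snd i)) (ball (fst j) (snd j))) C"
     "negligible(S - (\<Union>i \<in> C. ball (fst i) (snd i)))"
    using Vitali_covering_theorem_balls[of S K fst snd] by blast
  show thesis
  proof (rule that[OF C(1)])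
    show "disjoint_family_on (\<lambda>p. ball (fst p) (snd p)) C"
      using C(3) by (auto simp: disjoint_family_on_def pairwise_def disjnt_def)
  qed (use C in \<open>auto simp: K_def negligible_iff_null_sets\<close>)
qed

lemma emeasure_disjoint_UN_mono:
  assumes "countable C" "disjoint_family_on B C" "\<And>i. i \<in> C \<Longrightarrow> B i \<in> sets M" "\<And>i. i \<in> C \<Longrightarrow> B i \<in> sets N"
    and "\<And>i. i \<in> C \<Longrightarrow> (a::ennreal) * emeasure M (B i) \<le> b * emeasure N (B i)"
  shows "a * emeasure M (\<Union>i\<in>C. B i) \<le> b * emeasure N (\<Union>i\<in>C. B i)"
proof -
  have "a * emeasure M (\<Union>i\<in>C. B i) = (\<integral>\<^sup>+i. a * emeasure M (B i) \<partial>count_space C)"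
    using assms by (subst emeasure_UN_countable) (auto simp: nn_integral_cmult)
  also have "\<dots> \<le> (\<integral>\<^sup>+i. b * emeasure N (B i) \<partial>count_space C)"
    by (rule nn_integral_mono) (use assms in auto)
  also have "\<dots> = b * emeasure N (\<Union>i\<in>C. B i)"
    using assms by (subst emeasure_UN_countable) (auto simp: nn_integral_cmult)
  finally show ?thesis .
qed

text \<open>Here \<open>H\<close> is a measurable hull of \<open>S\<close>: a Borel set that covers
  almost all of \<open>S\<close> meets the hull in full measure.\<close>

lemma null_set_subset_lborel:
  assumes "S - T \<in> null_sets lebesgue" "T \<in> sets borel" "S \<subseteq> H" "H \<in> sets borel"
    and "emeasure lborel H = outer_measure_of lborel S"
  shows "emeasure lborel H \<le> emeasure lborel (T \<inter> H)"
proof -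
  obtain N where N: "N \<in> null_sets lborel" "S - T \<subseteq> N"
    using assms(1) unfolding null_sets_completion_iff2 by blast
  have Nb: "N \<in> sets lborel" using N by auto
  have S: "S \<subseteq> (T \<inter> H) \<union> N" using N(2) assms(3) by blast
  have TH: "T \<inter> H \<in> sets lborel" using assms(2,4) by simp
  have "outer_measure_of lborel S \<le> outer_measure_of lborel ((T \<inter> H) \<union> N)"
    by (rule outer_measure_of_mono[OF S])
  also have "\<dots> = emeasure lborel ((T \<inter> H) \<union> N)"
    by (rule outer_measure_of_eq[OF sets.Un[OF TH Nb]])
  also have "\<dots> = emeasure lborel (T \<inter> H)"
    by (rule emeasure_Un_null_set[OF TH N(1)])
  finally show ?thesis unfolding assms(5) .
qed

lemma ennreal_mult_le_imp_zero:
  assumes "0 \<le> a" "a < b" "(m::ennreal) < \<infinity>"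
    and "\<And>e. 0 < e \<Longrightarrow> ennreal b * m \<le> ennreal a * m + ennreal e"
  shows "m = 0"
proof -
  obtain x where x: "m = ennreal x" "0 \<le> x" using assms(3) by (cases m) auto
  have "b * x \<le> a * x + e" if "0 < e" for e
    using assms(4)[OF that] assms(1,2) x that
    by (simp add: ennreal_mult[symmetric] ennreal_plus[symmetric] del: ennreal_plus)
  then have "b * x \<le> a * x" by (rule field_le_epsilon)
  then have "(b - a) * x \<le> 0" by (simp add: algebra_simps)
  then have "x \<le> 0" using assms(2) by (simp add: mult_le_0_iff)
  then show ?thesis using x by simp
qed

section \<open>Upper and lower density estimates for an absolutely continuous measure\<close>

context
  fixes f :: "'a::euclidean_space \<Rightarrow> real" and \<nu>
  assumes f: "integrable lborel f" and f0: "\<And>x. 0 \<le> f x"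
  defines "\<nu> \<equiv> density lborel (\<lambda>x. ennreal (f x))"
begin

lemma density_fm: "f \<in> borel_measurable borel" "finite_measure \<nu>" "sets \<nu> = sets borel"
proof -
  show fb: "f \<in> borel_measurable borel" using f by auto
  show "finite_measure \<nu>"
  proof (rule finite_measureI)
    have "emeasure \<nu> (space \<nu>) = (\<integral>\<^sup>+x. ennreal (f x) \<partial>lborel)"
      unfolding \<nu>_def using fb by (subst emeasure_density) (auto intro!: nn_integral_cong)
    then show "emeasure \<nu> (space \<nu>) \<noteq> \<infinity>" using f f0 by (simp add: nn_integral_eq_integral)
  qed
qed (simp add: \<nu>_def)

text \<open>Outer regularity gives decreasing open sets whose Lebesgue excess over \<open>H\<close>
  tends to 0. The limiting excess is a Lebesgue null set, hence null for \<open>\<nu>\<close>, and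
  continuity from above for the finite measure \<open>\<nu>\<close> makes one of the open sets good
  for both measures.\<close>

lemma absolutely_continuous_density:
  assumes H: "H \<in> sets borel" and e: "0 < e"
  obtains U where "open U" "H \<subseteq> U" "emeasure \<nu> (U - H) \<le> ennreal e" "emeasure lborel (U - H) \<le> ennreal e"
proof -
  interpret finite_measure \<nu> by (rule density_fm)
  define d where "d n = e / 4 * (1/2)^n" for n :: nat
  have "\<exists>U. open U \<and> H \<subseteq> U \<and> emeasure lborel (U - H) < ennreal (d n)" for n
    using outer_regular_lborel[OF H, of "d n"] e by (force simp: d_def)
  then obtain V where V: "\<And>n. open (V n)" "\<And>n. H \<subseteq> V n" "\<And>n. emeasure lborel (V n - H) < ennreal (d n)"
    by metis
  define W where "W n = (\<Inter>k\<le>n. V k)" for n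
  have W: "open (W n)" "H \<subseteq> W n" "W n \<subseteq> V n" for n
    using V by (auto simp: W_def)
  have Wb: "W n \<in> sets borel" for n using W by auto
  have Wd: "emeasure lborel (W n - H) \<le> ennreal (d n)" for n
  proof -
    have "W n - H \<subseteq> V n - H" using W(3)[of n] by blast
    moreover have "V n - H \<in> sets lborel" using borel_open[OF V(1)[of n]] H by simp
    ultimately have "emeasure lborel (W n - H) \<le> emeasure lborel (V n - H)" by (rule emeasure_mono)
    then show ?thesis using V(3)[of n] by simp
  qed
  have d0: "d \<longlonglongrightarrow> 0" unfolding d_def by (intro tendsto_mult_right_zero LIMSEQ_power_zero) auto
  have "decseq (\<lambda>n. W n - H)" unfolding decseq_def W_def by fastforce
  then have "(\<lambda>n. emeasure \<nu> (W n - H)) \<longlonglongrightarrow> emeasure \<nu> (\<Inter>n. W n - H)"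
    using Wb H by (intro Lim_emeasure_decseq) (auto simp: density_fm(3))
  moreover have "emeasure lborel (\<Inter>n. W n - H) \<le> 0"
  proof (rule LIMSEQ_le_const)
    show "(\<lambda>n. ennreal (d n)) \<longlonglongrightarrow> 0" using tendsto_ennrealI[OF d0] by simp
    have "emeasure lborel (\<Inter>n. W n - H) \<le> ennreal (d n)" for n
      by (rule order_trans[OF emeasure_mono Wd[of n]]) (use Wb H in auto)
    then show "\<exists>N. \<forall>n\<ge>N. emeasure lborel (\<Inter>n. W n - H) \<le> ennreal (d n)" by blast
  qed
  then have "(\<Inter>n. W n - H) \<in> null_sets lborel" using Wb H by (auto simp: null_sets_def)
  then have "emeasure \<nu> (\<Inter>n. W n - H) = 0"
  proof -
    assume Z: "(\<Inter>n. W n - H) \<in> null_sets lborel" (is "?Z \<in> _")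
    have "absolutely_continuous lborel \<nu>"
      unfolding \<nu>_def using density_fm(1) by (intro absolutely_continuousI_density) auto
    then have "?Z \<in> null_sets \<nu>" using Z unfolding absolutely_continuous_def by (rule subsetD)
    then show ?thesis by auto
  qed
  ultimately have "(\<lambda>n. emeasure \<nu> (W n - H)) \<longlonglongrightarrow> 0" by simp
  then have "\<forall>\<^sub>F n in sequentially. emeasure \<nu> (W n - H) < ennreal e"
    by (rule order_tendstoD(2)) (use e in auto)
  then obtain n where n: "emeasure \<nu> (W n - H) < ennreal e" by (auto simp: eventually_sequentially)
  have "d n \<le> e * 1" unfolding d_def using e power_le_one[of "1/2::real" n]
    by (intro mult_mono) auto
  then have "emeasure lborel (W n - H) \<le> ennreal e" using Wd[of n] by (simp add: ennreal_leI order_trans)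
  then show thesis using that[of "W n"] W n by auto
qed

text \<open>Replaces a possibly nonmeasurable \<open>S\<close> by a Borel set of the same outer
  measure that still satisfies the pointwise bound on \<open>f\<close> encoded in \<open>A\<close>.
  Boundedness makes its measure finite.\<close>

lemma outer_hull:
  fixes S :: "'a set"
  assumes "bounded S" "S \<subseteq> A" "A \<in> sets borel"
  obtains H where "S \<subseteq> H" "H \<subseteq> A" "H \<in> sets borel" "emeasure lborel H = outer_measure_of lborel S" 
    "emeasure lborel H < \<infinity>"
proof -
  obtain r where r: "S \<subseteq> ball 0 r" using assms(1) bounded_subset_ballD by blast
  obtain H0 where H0: "H0 \<in> sets lborel" "S \<subseteq> H0" "outer_measure_of lborel S = emeasure lborel H0"
    using outer_measure_of_attain[of S lborel] by auto
  define H where "H = H0 \<inter> A \<inter> ball 0 r"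
  have Hb: "H \<in> sets borel" using H0 assms by (auto simp: H_def)
  have "emeasure lborel H \<le> emeasure lborel H0" by (rule emeasure_mono) (use H0 in \<open>auto simp: H_def\<close>)
  moreover have "outer_measure_of lborel S \<le> outer_measure_of lborel H"
    by (rule outer_measure_of_mono) (use H0 r assms in \<open>auto simp: H_def\<close>)
  then have "outer_measure_of lborel S \<le> emeasure lborel H" using Hb by simp
  moreover have "emeasure lborel H \<le> emeasure lborel (ball (0::'a) r)"
    by (rule emeasure_mono) (auto simp: H_def)
  then have "emeasure lborel H < \<infinity>" using emeasure_bounded_finite[of "ball (0::'a) r"] by (auto intro: le_less_trans)
  ultimately show thesis using that[of H] H0 r assms Hb by (auto simp: H_def)
qed

text \<open>Disjoint balls of large \<open>\<nu>\<close>-mass cover almost all of \<open>S\<close>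
  inside an open \<open>U\<close> with \<open>\<nu> (U - H)\<close> small. With \<open>m\<close> the
  measure of the hull \<open>H\<close>, this gives
  \<open>b * m \<le> \<nu> U \<le> a * m + e\<close>, and \<open>a < b\<close> forces
  \<open>m = 0\<close>.\<close>

lemma upper_density_null:
  assumes S: "bounded S" "S \<subseteq> {x. f x \<le> a}" and ab: "0 \<le> a" "a < b"
    and Q: "\<And>x d. x \<in> S \<Longrightarrow> 0 < d \<Longrightarrow>
      \<exists>r. 0 < r \<and> r < d \<and> ennreal b * emeasure lborel (ball x r) \<le> emeasure \<nu> (ball x r)"
  shows "S \<in> null_sets lebesgue"
proof -
  note [measurable] = density_fm(1)
  have "{x. f x \<le> a} \<in> sets borel" by measurable
  then obtain H where H: "S \<subseteq> H" "H \<subseteq> {x. f x \<le> a}" "H \<in> sets borel"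
    "emeasure lborel H = outer_measure_of lborel S" "emeasure lborel H < \<infinity>"
    by (rule outer_hull[OF S])
  define m where "m = emeasure lborel H"
  have "m = 0"
  proof (rule ennreal_mult_le_imp_zero[OF ab])
    show "m < \<infinity>" using H by (simp add: m_def)
    fix e :: real assume e: "0 < e"
    obtain U where U: "open U" "H \<subseteq> U" "emeasure \<nu> (U - H) \<le> ennreal e"
      by (rule absolutely_continuous_density[OF H(3) e])
    obtain C where C: "countable C" 
      "\<And>p. p \<in> C \<Longrightarrow> 0 < snd p \<and> ball (fst p) (snd p) \<subseteq> U \<and> 
         ennreal b * emeasure lborel (ball (fst p) (snd p)) \<le> emeasure \<nu> (ball (fst p) (snd p))"
      "disjoint_family_on (\<lambda>p. ball (fst p) (snd p)) C"
      "S - (\<Union>p\<in>C. ball (fst p) (snd p)) \<in> null_sets lebesgue"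
      by (rule Vitali_balls_in_open[OF U(1) subset_trans[OF H(1) U(2)],
        where Q="\<lambda>x r. ennreal b * emeasure lborel (ball x r) \<le> emeasure \<nu> (ball x r)"]) (rule Q, assumption, assumption, rule that, assumption+)
    define T where "T = (\<Union>p\<in>C. ball (fst p) (snd p))"
    have T: "open T" "T \<subseteq> U" using C(2) by (auto simp: T_def)
    have "m \<le> emeasure lborel (T \<inter> H)" unfolding m_def
      by (rule null_set_subset_lborel[OF C(4)[folded T_def] borel_open[OF T(1)] H(1,3,4)])
    also have "\<dots> \<le> emeasure lborel T" by (rule emeasure_mono) (use T in auto)
    finally have "ennreal b * m \<le> ennreal b * emeasure lborel T" by (rule mult_left_mono) simp
    also have "\<dots> \<le> 1 * emeasure \<nu> T"
      unfolding T_def by (rule emeasure_disjoint_UN_mono[OF C(1,3)]) (use C(2) in \<open>simp_all add: density_fm\<close>)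
    also have "\<dots> \<le> emeasure \<nu> U" using T U by (auto intro!: emeasure_mono simp: density_fm)
    also have "U = H \<union> (U - H)" using U by auto
    also have "emeasure \<nu> \<dots> \<le> emeasure \<nu> H + emeasure \<nu> (U - H)"
      using U H by (intro emeasure_subadditive) (auto simp: density_fm)
    also have "emeasure \<nu> H + emeasure \<nu> (U - H) \<le> ennreal a * m + emeasure \<nu> (U - H)"
    proof (rule add_right_mono)
      have "emeasure \<nu> H = (\<integral>\<^sup>+x. ennreal (f x) * indicator H x \<partial>lborel)"
        unfolding \<nu>_def using H by (subst emeasure_density) auto
      also have "\<dots> \<le> (\<integral>\<^sup>+x. ennreal a * indicator H x \<partial>lborel)"
        by (rule nn_integral_mono) (use H in \<open>auto split: split_indicator intro!: ennreal_leI\<close>)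
      also have "\<dots> = ennreal a * m" using H by (simp add: nn_integral_cmult_indicator m_def)
      finally show "emeasure \<nu> H \<le> ennreal a * m" .
    qed
    finally show "ennreal b * m \<le> ennreal a * m + ennreal e"
      using add_left_mono[OF U(3)] by (rule order_trans)
  qed
  then have "H \<in> null_sets lborel" using H by (auto simp: null_sets_def m_def)
  then show ?thesis unfolding null_sets_completion_iff2 using H(1) by blast
qed

text \<open>The mirror image of the upper estimate. Now the balls have small
  \<open>\<nu>\<close>-mass, so the Lebesgue measure of \<open>U - H\<close> is the excess to be
  made small.\<close>

lemma lower_density_null:
  assumes S: "bounded S" "S \<subseteq> {x. b \<le> f x}" and ab: "0 \<le> a" "a < b"
    and Q: "\<And>x d. x \<in> S \<Longrightarrow> 0 < d \<Longrightarrow>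
      \<exists>r. 0 < r \<and> r < d \<and> emeasure \<nu> (ball x r) \<le> ennreal a * emeasure lborel (ball x r)"
  shows "S \<in> null_sets lebesgue"
proof -
  note [measurable] = density_fm(1)
  have "{x. b \<le> f x} \<in> sets borel"
    using density_fm(1) unfolding borel_measurable_iff_ge by simp
  then obtain H where H: "S \<subseteq> H" "H \<subseteq> {x. b \<le> f x}" "H \<in> sets borel"
    "emeasure lborel H = outer_measure_of lborel S" "emeasure lborel H < \<infinity>"
    by (rule outer_hull[OF S])
  define m where "m = emeasure lborel H"
  have "m = 0"
  proof (rule ennreal_mult_le_imp_zero[OF ab])
    show "m < \<infinity>" using H by (simp add: m_def)
    fix e :: real assume e: "0 < e"
    \<comment> \<open>The excess is multiplied by \<open>a\<close> at the end; the
      \<open>+ 1\<close> allows \<open>a = 0\<close>.\<close>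
    define e' where "e' = e / (a + 1)"
    have e': "0 < e'" "a * e' \<le> e"
    proof -
      show "0 < e'" using e ab(1) by (simp add: e'_def)
      then have "a * e' \<le> (a + 1) * e'" by (intro mult_right_mono) auto
      also have "\<dots> = e" using ab(1) by (simp add: e'_def)
      finally show "a * e' \<le> e" .
    qed
    obtain U where U: "open U" "H \<subseteq> U" "emeasure lborel (U - H) \<le> ennreal e'"
      by (rule absolutely_continuous_density[OF H(3) e'(1)])
    obtain C where C: "countable C" 
      "\<And>p. p \<in> C \<Longrightarrow> 0 < snd p \<and> ball (fst p) (snd p) \<subseteq> U \<and> 
         emeasure \<nu> (ball (fst p) (snd p)) \<le> ennreal a * emeasure lborel (ball (fst p) (snd p))"
      "disjoint_family_on (\<lambda>p. ball (fst p) (snd p)) C"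
      "S - (\<Union>p\<in>C. ball (fst p) (snd p)) \<in> null_sets lebesgue"
      by (rule Vitali_balls_in_open[OF U(1) subset_trans[OF H(1) U(2)],
        where Q="\<lambda>x r. emeasure \<nu> (ball x r) \<le> ennreal a * emeasure lborel (ball x r)"]) (rule Q, assumption, assumption, rule that, assumption+)
    define T where "T = (\<Union>p\<in>C. ball (fst p) (snd p))"
    have T: "open T" "T \<subseteq> U" using C(2) by (auto simp: T_def)
    have "m \<le> emeasure lborel (T \<inter> H)" unfolding m_def
      by (rule null_set_subset_lborel[OF C(4)[folded T_def] borel_open[OF T(1)] H(1,3,4)])
    then have "ennreal b * m \<le> ennreal b * emeasure lborel (T \<inter> H)" by (rule mult_left_mono) simp
    also have "\<dots> = (\<integral>\<^sup>+x. ennreal b * indicator (T \<inter> H) x \<partial>lborel)"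
      using H T by (simp add: nn_integral_cmult_indicator)
    also have "\<dots> \<le> (\<integral>\<^sup>+x. ennreal (f x) * indicator T x \<partial>lborel)"
      by (rule nn_integral_mono) (use H in \<open>auto split: split_indicator intro!: ennreal_leI\<close>)
    also have "\<dots> = 1 * emeasure \<nu> T" unfolding \<nu>_def using T by (subst emeasure_density) auto
    also have "\<dots> \<le> ennreal a * emeasure lborel T"
      unfolding T_def by (rule emeasure_disjoint_UN_mono[OF C(1,3)]) (use C(2) in \<open>simp_all add: density_fm\<close>)
    also have "\<dots> \<le> ennreal a * emeasure lborel U"
      by (intro mult_left_mono emeasure_mono) (use T U in auto)
    also have "U = H \<union> (U - H)" using U by auto
    also have "emeasure lborel \<dots> \<le> emeasure lborel H + emeasure lborel (U - H)"
      using U H by (intro emeasure_subadditive) auto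
    also have "\<dots> \<le> m + ennreal e'" unfolding m_def by (rule add_left_mono[OF U(3)])
    also have "ennreal a * (m + ennreal e') = ennreal a * m + ennreal (a * e')"
      using ab e' by (simp add: distrib_left ennreal_mult)
    also have "\<dots> \<le> ennreal a * m + ennreal e" by (intro add_left_mono ennreal_leI e')
    finally show "ennreal b * m \<le> ennreal a * m + ennreal e" by (simp add: mult_left_mono)
  qed
  then have "H \<in> null_sets lborel" using H by (auto simp: null_sets_def m_def)
  then show ?thesis unfolding null_sets_completion_iff2 using H(1) by blast
qed

text \<open>If the quotients fail to converge to \<open>f x\<close>, they cross a gap between two
  rationals above or below \<open>f x\<close> at arbitrarily small radii. This places
  \<open>x\<close> in one of countably many null sets, indexed by the rationals and by a radius
  \<open>n\<close> that makes the set bounded.\<close>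

lemma lebesgue_differentiation_nonneg:
  "AE x in lebesgue. ((\<lambda>r. measure \<nu> (ball x r) / measure lborel (ball x r)) \<longlongrightarrow> f x) (at_right 0)"
proof -
  interpret finite_measure \<nu> by (rule density_fm)
  define SU where "SU a b n = {x. x \<in> ball 0 (real n) \<and> f x \<le> a \<and> (\<forall>d>0. \<exists>r. 0 < r \<and> r < d \<and>
      ennreal b * emeasure lborel (ball x r) \<le> emeasure \<nu> (ball x r))}" for a b and n :: nat
  define SL where "SL a b n = {x. x \<in> ball 0 (real n) \<and> b \<le> f x \<and> (\<forall>d>0. \<exists>r. 0 < r \<and> r < d \<and>
      emeasure \<nu> (ball x r) \<le> ennreal a * emeasure lborel (ball x r))}" for a b and n :: nat
  define I where "I = {(a,b,n). a \<in> \<rat> \<and> b \<in> \<rat> \<and> 0 \<le> a \<and> a < (b::real)} \<inter> (UNIV :: (real \<times> real \<times> nat) set)"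
  have "countable (\<rat> \<times> \<rat> \<times> (UNIV :: nat set) :: (real \<times> real \<times> nat) set)"
    by (intro countable_SIGMA countable_rat) auto
  then have cI: "countable I" by (rule countable_subset[rotated]) (auto simp: I_def)
  have SUn: "SU a b n \<in> null_sets lebesgue" "SL a b n \<in> null_sets lebesgue" if "0 \<le> a" "a < b" for a b n
  proof -
    have "bounded (SU a b n)" "bounded (SL a b n)"
      by (auto intro!: bounded_subset[OF bounded_ball[of 0 "real n"]] simp: SU_def SL_def)
    note bd = this
    show "SU a b n \<in> null_sets lebesgue"
      by (rule upper_density_null[OF bd(1) _ that]) (auto simp: SU_def)
    show "SL a b n \<in> null_sets lebesgue"
      by (rule lower_density_null[OF bd(2) _ that]) (auto simp: SL_def)
  qed
  define Z where "Z = (\<Union>(a,b,n)\<in>I. SU a b n \<union> SL a b n)"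
  have "Z \<in> null_sets lebesgue"
    unfolding Z_def using SUn by (intro null_sets_UN' cI) (auto simp: I_def)
  then have "AE x in lebesgue. x \<notin> Z" by (rule AE_not_in)
  then show ?thesis
  proof eventually_elim
    fix x assume x: "x \<notin> Z"
    obtain n :: nat where "norm x < real n" using reals_Archimedean2 by blast
    then have n: "x \<in> ball 0 (real n)" by simp
    have eq: "emeasure lborel (ball x r) = ennreal (measure lborel (ball x r))" for r
      using emeasure_bounded_finite[of "ball x r"] by (intro emeasure_eq_ennreal_measure) auto
    have pos: "0 < measure lborel (ball x r)" if "0 < r" for r using that by (simp add: content_ball_pos)
    show "((\<lambda>r. measure \<nu> (ball x r) / measure lborel (ball x r)) \<longlongrightarrow> f x) (at_right 0)"
    proof (rule order_tendstoI)
      fix c assume c: "f x < c"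
      obtain b where b: "b \<in> \<rat>" "f x < b" "b < c" using Rats_dense_in_real[OF c] by blast
      obtain a where a: "a \<in> \<rat>" "f x < a" "a < b" using Rats_dense_in_real[OF b(2)] by blast
      have a0: "0 \<le> a" using f0[of x] a by linarith
      have "x \<notin> SU a b n" using x a b a0 by (auto simp: Z_def I_def)
      then obtain d where d: "0 < d" "\<And>r. 0 < r \<Longrightarrow> r < d \<Longrightarrow>
          \<not> ennreal b * emeasure lborel (ball x r) \<le> emeasure \<nu> (ball x r)"
        using n a by (auto simp: SU_def)
      have "measure \<nu> (ball x r) / measure lborel (ball x r) < c" if "0 < r" "r < d" for r
      proof -
        have "\<not> b * measure lborel (ball x r) \<le> measure \<nu> (ball x r)"
          using d(2)[OF that] a a0 unfolding eq emeasure_eq_measure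
          by (simp add: ennreal_mult[symmetric])
        then have "measure \<nu> (ball x r) / measure lborel (ball x r) < b"
          using pos[OF that(1)] by (simp add: field_simps)
        then show ?thesis using b by simp
      qed
      then show "\<forall>\<^sub>F r in at_right 0. measure \<nu> (ball x r) / measure lborel (ball x r) < c"
        unfolding eventually_at_right_field using d(1) by auto
    next
      fix c assume c: "c < f x"
      show "\<forall>\<^sub>F r in at_right 0. c < measure \<nu> (ball x r) / measure lborel (ball x r)"
      \<comment> \<open>The lower density estimate needs a nonnegative rational \<open>a\<close>;
        for negative \<open>c\<close> the quotient exceeds \<open>c\<close> by its sign.\<close>
      proof (cases "c < 0")
        case True
        then show ?thesis by (auto intro!: always_eventually less_le_trans[OF True] divide_nonneg_nonneg)
      next
        case False
        obtain a where a: "a \<in> \<rat>" "c < a" "a < f x" using Rats_dense_in_real[OF c] by blast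
        obtain b where b: "b \<in> \<rat>" "a < b" "b < f x" using Rats_dense_in_real[OF a(3)] by blast
        have a0: "0 \<le> a" using False a by linarith
        have "x \<notin> SL a b n" using x a b a0 by (auto simp: Z_def I_def)
        then obtain d where d: "0 < d" "\<And>r. 0 < r \<Longrightarrow> r < d \<Longrightarrow>
            \<not> emeasure \<nu> (ball x r) \<le> ennreal a * emeasure lborel (ball x r)"
          using n b by (auto simp: SL_def)
        have "c < measure \<nu> (ball x r) / measure lborel (ball x r)" if "0 < r" "r < d" for r
        proof -
          have "\<not> measure \<nu> (ball x r) \<le> a * measure lborel (ball x r)"
            using d(2)[OF that] a0 unfolding eq emeasure_eq_measure
            by (simp add: ennreal_mult[symmetric])
          then have "a < measure \<nu> (ball x r) / measure lborel (ball x r)"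
            using pos[OF that(1)] by (simp add: field_simps)
          then show ?thesis using a by simp
        qed
        then show ?thesis
          unfolding eventually_at_right_field using d(1) by auto
      qed
    qed
  qed
qed

lemma measure_density_eq_set_integral:
  assumes "A \<in> sets borel" shows "measure \<nu> A = (LINT y:A|lborel. f y)"
proof -
  have i: "integrable lborel (\<lambda>y. indicat_real A y * f y)"
    using integrable_mult_indicator[of A lborel f] f assms by simp
  have "emeasure \<nu> A = (\<integral>\<^sup>+y. ennreal (indicat_real A y * f y) \<partial>lborel)"
    unfolding \<nu>_def using assms density_fm(1)
    by (subst emeasure_density) (auto intro!: nn_integral_cong split: split_indicator)
  also have "\<dots> = ennreal (LINT y:A|lborel. f y)"
    unfolding set_lebesgue_integral_def using i f0 by (subst nn_integral_eq_integral) auto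
  finally show ?thesis
    using f0 by (subst measure_def) (auto simp: set_lebesgue_integral_def intro!: integral_nonneg)
qed

end

lemma lebesgue_differentiation_real:
  fixes f :: "'a::euclidean_space \<Rightarrow> real"
  assumes f: "integrable lborel f"
  shows "AE x in lebesgue. ((\<lambda>r. (LINT y:ball x r|lborel. f y) / measure lborel (ball x r)) \<longlongrightarrow> f x) (at_right 0)"
proof -
  define g h where "g x = max (f x) 0" and "h x = max (- f x) 0" for x
  have gh: "integrable lborel g" "integrable lborel h" "\<And>x. 0 \<le> g x" "\<And>x. 0 \<le> h x"
    using f by (auto simp: g_def[abs_def] h_def[abs_def])
  have si: "set_integrable lborel (ball x r) g" "set_integrable lborel (ball x r) h" for x r
    unfolding set_integrable_def by (rule integrable_mult_indicator[OF _ gh(1)] integrable_mult_indicator[OF _ gh(2)], simp)+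
  have fgh: "f = (\<lambda>x. g x - h x)" by (auto simp: g_def h_def)
  have G: "AE x in lebesgue. ((\<lambda>r. (LINT y:ball x r|lborel. g y) / measure lborel (ball x r)) \<longlongrightarrow> g x) (at_right 0)"
    using lebesgue_differentiation_nonneg[OF gh(1,3)] measure_density_eq_set_integral[OF gh(1,3)] by simp
  have H: "AE x in lebesgue. ((\<lambda>r. (LINT y:ball x r|lborel. h y) / measure lborel (ball x r)) \<longlongrightarrow> h x) (at_right 0)"
    using lebesgue_differentiation_nonneg[OF gh(2,4)] measure_density_eq_set_integral[OF gh(2,4)] by simp
  from G H show ?thesis
  proof eventually_elim
    case (elim x)
    then show ?case using tendsto_diff[OF elim(1) elim(2)]
      unfolding fgh set_integral_diff(2)[OF si] by (simp add: diff_divide_distrib)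
  qed
qed

theorem lebesgue_differentiation:
  fixes f :: "'a::euclidean_space \<Rightarrow> 'b::euclidean_space"
  assumes f: "integrable lborel f"
  shows "AE x in lebesgue. ((\<lambda>r. (LINT y:ball x r|lborel. f y) /\<^sub>R measure lborel (ball x r)) \<longlongrightarrow> f x) (at_right 0)"
proof -
  have si: "integrable lborel (\<lambda>y. indicator (ball x r) y *\<^sub>R f y)" for x r
    by (rule integrable_mult_indicator[OF _ f]) simp
  have "AE x in lebesgue. \<forall>b\<in>Basis. ((\<lambda>r. (LINT y:ball x r|lborel. f y \<bullet> b) / measure lborel (ball x r)) \<longlongrightarrow> f x \<bullet> b) (at_right 0)"
    by (rule AE_finite_allI) (use f in \<open>auto intro!: lebesgue_differentiation_real\<close>)
  then show ?thesis
  proof eventually_elim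
    case (elim x)
    show ?case
    proof (subst tendsto_componentwise_iff, rule ballI)
      fix b :: 'b assume b: "b \<in> Basis"
      have "((LINT y:ball x r|lborel. f y) /\<^sub>R measure lborel (ball x r)) \<bullet> b
          = (LINT y:ball x r|lborel. f y \<bullet> b) / measure lborel (ball x r)" for r
        using integral_inner_left[OF si[of x r], of b]
        by (simp add: set_lebesgue_integral_def divide_inverse mult.commute)
      then show "((\<lambda>r. ((LINT y:ball x r|lborel. f y) /\<^sub>R measure lborel (ball x r)) \<bullet> b) \<longlongrightarrow> f x \<bullet> b) (at_right 0)"
        using elim b by simp
    qed
  qed
qed

section \<open>Mollification\<close>

lemma nn_integral_lborel_shift:
  fixes f :: "'a::euclidean_space \<Rightarrow> ennreal"
  assumes [measurable]: "f \<in> borel_measurable borel"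
  shows "(\<integral>\<^sup>+y. f (a + y) \<partial>lborel) = (\<integral>\<^sup>+y. f y \<partial>lborel)"
proof -
  have "(\<integral>\<^sup>+y. f y \<partial>lborel) = (\<integral>\<^sup>+y. f y \<partial>(distr lborel borel (\<lambda>x. a + 1 *\<^sub>R x)))"
    using lborel_affine[of 1 a] by (simp add: density_1)
  then show ?thesis by (simp add: nn_integral_distr)
qed

lemma nn_integral_lborel_reflect:
  fixes f :: "'a::euclidean_space \<Rightarrow> ennreal"
  assumes [measurable]: "f \<in> borel_measurable borel"
  shows "(\<integral>\<^sup>+y. f (a - y) \<partial>lborel) = (\<integral>\<^sup>+y. f y \<partial>lborel)"
proof -
  have "(\<integral>\<^sup>+y. f y \<partial>lborel) = (\<integral>\<^sup>+y. f y \<partial>(distr lborel borel (\<lambda>x. a + (- 1) *\<^sub>R x)))"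
    using lborel_affine[of "-1" a] by (simp add: density_1)
  then show ?thesis by (simp add: nn_integral_distr)
qed

lemma integral_lborel_reflect:
  fixes f :: "'a::euclidean_space \<Rightarrow> 'b::euclidean_space"
  assumes [measurable]: "f \<in> borel_measurable borel"
  shows "(LINT y|lborel. f (a - y)) = (LINT y|lborel. f y)"
proof -
  have "(LINT y|lborel. f y) = (LINT y|distr lborel borel (\<lambda>x. a + (- 1) *\<^sub>R x). f y)"
    using lborel_affine[of "-1" a] by (simp add: density_1)
  then show ?thesis by (simp add: integral_distr)
qed

lemma norm_integral_le:
  fixes f :: "'a \<Rightarrow> 'b::{banach, second_countable_topology}"
  assumes "integrable M f" "integrable M g" "\<And>x. norm (f x) \<le> g x"
  shows "norm (LINT x|M. f x) \<le> (LINT x|M. g x)"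
proof -
  have "norm (LINT x|M. f x) \<le> (LINT x|M. norm (f x))" by (rule integral_norm_bound)
  also have "\<dots> \<le> (LINT x|M. g x)" by (rule integral_mono) (use assms in auto)
  finally show ?thesis .
qed

section \<open>A smooth bump function\<close>

definition flat_exp :: "nat \<Rightarrow> real \<Rightarrow> real" where
  "flat_exp k t = (if 0 < t then exp (- 1 / t) / t ^ k else 0)"

lemma flat_exp_tendsto_0: "(flat_exp k \<longlongrightarrow> 0) (at 0)"
proof -
  have "((\<lambda>t. (inverse t) ^ k / exp (inverse t)) \<longlongrightarrow> 0) (at_right (0::real))"
    by (rule filterlim_compose[OF tendsto_power_div_exp_0 filterlim_inverse_at_top_right])
  then have "(flat_exp k \<longlongrightarrow> 0) (at_right 0)"
    by (rule tendsto_cong[THEN iffD1, rotated])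
      (auto simp: eventually_at_right_field flat_exp_def exp_minus divide_simps intro!: exI[of _ 1])
  moreover have "(flat_exp k \<longlongrightarrow> 0) (at_left 0)"
    by (rule tendsto_eventually) (auto simp: eventually_at_left_field flat_exp_def intro!: exI[of _ "-1"])
  ultimately show ?thesis by (simp add: filterlim_split_at)
qed

text \<open>The powers of \<open>t\<close> in the denominator are carried along because the family
  is then closed under differentiation, which replaces any induction on the shape of higher
  derivatives.\<close>

lemma flat_exp_deriv:
  "(flat_exp k has_real_derivative flat_exp (k + 2) t - real k * flat_exp (k + 1) t) (at t)"
proof -
  consider "t < 0" | "t = 0" | "0 < t" by linarith
  then show ?thesis
  proof cases
    case 1
    have "((\<lambda>_. 0) has_real_derivative 0) (at t)" by simp
    then have "(flat_exp k has_real_derivative 0) (at t)"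
      by (rule has_field_derivative_transform_within_open[where S="{..<0}"]) (use 1 in \<open>auto simp: flat_exp_def\<close>)
    then show ?thesis using 1 by (simp add: flat_exp_def)
  next
    case 2
    \<comment> \<open>At the origin the difference quotient is the next member of the
      family.\<close>
    have "(\<lambda>h. (flat_exp k (0 + h) - flat_exp k 0) / h) = flat_exp (k + 1)"
      by (auto simp: flat_exp_def fun_eq_iff)
    then show ?thesis
      using flat_exp_tendsto_0[of "k + 1"] 2 unfolding DERIV_def by (simp add: flat_exp_def)
  next
    case 3
    have d1: "((\<lambda>t. exp (- 1 / t)) has_real_derivative exp (- 1 / t) * (inverse t)\<^sup>2) (at t)"
      using 3 by (auto intro!: derivative_eq_intros simp: power2_eq_square field_simps)
    have "(inverse has_real_derivative - ((inverse t)\<^sup>2)) (at t)"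
      using DERIV_inverse[of t UNIV] 3 by (simp add: power2_eq_square)
    from DERIV_mult[OF d1 DERIV_power[OF this, of k]]
    have "((\<lambda>t. exp (- 1 / t) * inverse t ^ k) has_real_derivative
        exp (- 1 / t) * (inverse t)\<^sup>2 * inverse t ^ k
          - exp (- 1 / t) * (real k * inverse t ^ (k - 1) * (inverse t)\<^sup>2)) (at t)"
      by (simp add: mult_ac)
    moreover have "exp (- 1 / t) * (inverse t)\<^sup>2 * inverse t ^ k
          - exp (- 1 / t) * (real k * inverse t ^ (k - 1) * (inverse t)\<^sup>2)
        = exp (- 1 / t) / t ^ (k + 2) - real k * (exp (- 1 / t) / t ^ (k + 1))"
      by (cases k) (simp_all add: divide_inverse power_inverse[symmetric] power2_eq_square del: power_inverse)
    moreover have "(\<lambda>t::real. exp (- 1 / t) * inverse t ^ k) = (\<lambda>t. exp (- 1 / t) / t ^ k)"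
      by (simp add: divide_inverse power_inverse)
    ultimately have "((\<lambda>t. exp (- 1 / t) / t ^ k) has_real_derivative
        exp (- 1 / t) / t ^ (k + 2) - real k * (exp (- 1 / t) / t ^ (k + 1))) (at t)"
      by (simp only:)
    then have "(flat_exp k has_real_derivative
        exp (- 1 / t) / t ^ (k + 2) - real k * (exp (- 1 / t) / t ^ (k + 1))) (at t)"
      by (rule has_field_derivative_transform_within_open[where S="{0<..}"]) (use 3 in \<open>auto simp: flat_exp_def\<close>)
    then show ?thesis using 3 by (simp add: flat_exp_def)
  qed
qed

text \<open>Smoothness by closure: a family of differentiable functions that contains the partial
  derivatives of its members consists of smooth functions. It is applied to the bump, to
  convolutions and to multiples of test functions.\<close>

lemma C_times_coinduct:
  assumes F: "\<And>f. f \<in> F \<Longrightarrow> \<exists>D. (\<forall>x. (f has_derivative D x) (at x)) \<and> (\<forall>b\<in>Basis. (\<lambda>x. D x b) \<in> F)"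
    and f: "f \<in> F"
  shows "C_times k f"
  using f
proof (induction k arbitrary: f)
  case 0
  then obtain D where "\<forall>x. (f has_derivative D x) (at x)" using F by blast
  then have "continuous (at x) f" for x using has_derivative_continuous by blast
  then show ?case by (simp add: continuous_at_imp_continuous_on)
next
  case (Suc k)
  then obtain D where D: "\<And>x. (f has_derivative D x) (at x)" "\<And>b. b \<in> Basis \<Longrightarrow> (\<lambda>x. D x b) \<in> F"
    using F by blast
  have "frechet_derivative f (at x) = D x" for x
    using frechet_derivative_at[OF D(1)] by simp
  moreover have "f differentiable_on UNIV"
    using D(1) unfolding differentiable_on_def differentiable_def by blast
  ultimately show ?case using Suc.IH[OF D(2)] by simp
qed

text \<open>An algebra that contains the bump and its partial derivatives. The rule
  \<open>flat\<close> admits every \<open>k\<close> because differentiation raises it, and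
  \<open>inner\<close> supplies the coordinate factors of the chain rule.\<close>

inductive_set smooth_family :: "('a::euclidean_space \<Rightarrow> real) set" where
  const: "(\<lambda>x. c) \<in> smooth_family"
| inner: "(\<lambda>x. x \<bullet> b) \<in> smooth_family"
| flat: "(\<lambda>x. flat_exp k (s - x \<bullet> x)) \<in> smooth_family"
| add: "f \<in> smooth_family \<Longrightarrow> g \<in> smooth_family \<Longrightarrow> (\<lambda>x. f x + g x) \<in> smooth_family"
| mult: "f \<in> smooth_family \<Longrightarrow> g \<in> smooth_family \<Longrightarrow> (\<lambda>x. f x * g x) \<in> smooth_family"

lemma smooth_family_derivative:
  assumes "f \<in> smooth_family"
  shows "\<exists>D. (\<forall>x. (f has_derivative D x) (at x)) \<and> (\<forall>b. (\<lambda>x. D x b) \<in> smooth_family)"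
  using assms
proof induction
  case (const c)
  show ?case by (rule exI[of _ "\<lambda>x h. 0"]) (auto intro: smooth_family.const)
next
  case (inner b)
  show ?case by (rule exI[of _ "\<lambda>x h. h \<bullet> b"])
    (auto intro: smooth_family.const intro!: bounded_linear_imp_has_derivative bounded_linear_inner_left)
next
  case (flat k s)
  define D where "D x h = (flat_exp (k + 2) (s - x \<bullet> x) + (- real k) * flat_exp (k + 1) (s - x \<bullet> x)) * ((-2) * (x \<bullet> h))"
    for x h :: 'a
  have "((\<lambda>x. flat_exp k (s - x \<bullet> x)) has_derivative D x) (at x)" for x
  proof -
    have 1: "(flat_exp k has_derivative (*) (flat_exp (k + 2) (s - x \<bullet> x) - real k * flat_exp (k + 1) (s - x \<bullet> x)))
        (at (s - x \<bullet> x))"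
      using flat_exp_deriv[of k "s - x \<bullet> x"] by (simp add: has_field_derivative_def)
    have 2: "((\<lambda>x. s - x \<bullet> x) has_derivative (\<lambda>h. - (x \<bullet> h + h \<bullet> x))) (at x)"
      by (auto intro!: derivative_eq_intros)
    show ?thesis
      using has_derivative_compose[OF 2 1] unfolding D_def[abs_def]
      by (simp add: inner_commute algebra_simps)
  qed
  moreover have "(\<lambda>x. D x b) \<in> smooth_family" for b
    unfolding D_def by (intro smooth_family.intros)
  ultimately show ?case by blast
next
  case (add f g)
  then obtain D1 D2 where D: "\<And>x. (f has_derivative D1 x) (at x)" "\<And>b. (\<lambda>x. D1 x b) \<in> smooth_family"
      "\<And>x. (g has_derivative D2 x) (at x)" "\<And>b. (\<lambda>x. D2 x b) \<in> smooth_family" by blast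
  show ?case
    by (rule exI[of _ "\<lambda>x h. D1 x h + D2 x h"])
      (intro conjI allI has_derivative_add D smooth_family.intros)
next
  case (mult f g)
  then obtain D1 D2 where D: "\<And>x. (f has_derivative D1 x) (at x)" "\<And>b. (\<lambda>x. D1 x b) \<in> smooth_family"
      "\<And>x. (g has_derivative D2 x) (at x)" "\<And>b. (\<lambda>x. D2 x b) \<in> smooth_family" by blast
  show ?case
    by (rule exI[of _ "\<lambda>x h. f x * D2 x h + D1 x h * g x"])
      (intro conjI allI has_derivative_mult D smooth_family.intros mult)
qed

lemma smooth_family_C_times: "f \<in> smooth_family \<Longrightarrow> C_times k f"
  by (rule C_times_coinduct[of smooth_family]) (use smooth_family_derivative in blast)+

section \<open>Test functions and convolution with them\<close>

lemma test_functions_iff: "\<xi> \<in> test_functions \<longleftrightarrow> (\<forall>k. C_times k \<xi>) \<and> bounded {x. \<xi> x \<noteq> 0}"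
  by (simp add: test_functions_def compact_closure)

lemma test_functions_derivative:
  assumes "s \<in> test_functions"
  shows "(s has_derivative frechet_derivative s (at x)) (at x)"
    and "b \<in> Basis \<Longrightarrow> (\<lambda>x. frechet_derivative s (at x) b) \<in> test_functions"
proof -
  have C: "C_times (Suc k) s" for k using assms by (auto simp: test_functions_iff)
  have diff: "s differentiable at x" for x
    using C[of 0] by (auto simp: differentiable_on_def)
  show "(s has_derivative frechet_derivative s (at x)) (at x)"
    using diff by (simp add: frechet_derivative_works)
  assume b: "b \<in> Basis"
  have z: "frechet_derivative s (at x) b = 0" if x: "x \<notin> closure {x. s x \<noteq> 0}" for x
  proof -
    have "((\<lambda>_. 0) has_derivative (\<lambda>_. 0)) (at x)" by simp
    then have "(s has_derivative (\<lambda>_. 0)) (at x)"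
      by (rule has_derivative_transform_within_open[where s="- closure {x. s x \<noteq> 0}"])
        (use x closure_subset[of "{x. s x \<noteq> 0}"] in auto)
    then show ?thesis using frechet_derivative_at by metis
  qed
  have "bounded (closure {x. s x \<noteq> 0})" using assms by (auto simp: test_functions_iff)
  then have "bounded {x. frechet_derivative s (at x) b \<noteq> 0}"
    by (rule bounded_subset) (use z in blast)
  moreover have "C_times k (\<lambda>x. frechet_derivative s (at x) b)" for k
    using C[of k] b by simp
  ultimately show "(\<lambda>x. frechet_derivative s (at x) b) \<in> test_functions"
    by (simp add: test_functions_iff)
qed

lemma linear_le_sum_Basis:
  fixes D :: "'a::euclidean_space \<Rightarrow> real"
  assumes "linear D" "\<And>b. b \<in> Basis \<Longrightarrow> \<bar>D b\<bar> \<le> M b"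
  shows "\<bar>D h\<bar> \<le> (\<Sum>b\<in>Basis. M b) * norm h"
proof -
  have "D h = D (\<Sum>b\<in>Basis. (h \<bullet> b) *\<^sub>R b)" by (simp add: euclidean_representation)
  also have "\<dots> = (\<Sum>b\<in>Basis. (h \<bullet> b) * D b)"
    using assms(1) by (simp add: linear_sum linear_scale)
  finally have "\<bar>D h\<bar> = \<bar>\<Sum>b\<in>Basis. (h \<bullet> b) * D b\<bar>" by simp
  also have "\<dots> \<le> (\<Sum>b\<in>Basis. \<bar>(h \<bullet> b) * D b\<bar>)" by (rule sum_abs)
  also have "\<dots> \<le> (\<Sum>b\<in>Basis. norm h * M b)"
    unfolding abs_mult using assms(2) by (intro sum_mono mult_mono) (auto intro: Basis_le_norm)
  also have "\<dots> = (\<Sum>b\<in>Basis. M b) * norm h"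
    by (simp add: sum_distrib_left mult.commute)
  finally show ?thesis .
qed

lemma test_functions_lipc:
  assumes s: "s \<in> test_functions"
  shows "s \<in> lipc"
proof -
  define d where "d b x = frechet_derivative s (at x) b" for b x
  have cont: "continuous_on UNIV (d b)" "bounded {x. d b x \<noteq> 0}" if "b \<in> Basis" for b
  proof -
    have "d b \<in> test_functions" unfolding d_def by (rule test_functions_derivative(2)[OF s that])
    then have "C_times 0 (d b)" "bounded {x. d b x \<noteq> 0}" unfolding test_functions_iff by blast+
    then show "continuous_on UNIV (d b)" "bounded {x. d b x \<noteq> 0}" by simp_all
  qed
  have "\<forall>b\<in>Basis. \<exists>M\<ge>0. \<forall>x. \<bar>d b x\<bar> \<le> M"
    using continuous_bounded_support_bounded cont by blast
  then obtain M where M: "\<And>b. b \<in> Basis \<Longrightarrow> 0 \<le> M b" "\<And>b x. b \<in> Basis \<Longrightarrow> \<bar>d b x\<bar> \<le> M b"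
    by metis
  have D: "(s has_derivative frechet_derivative s (at x)) (at x)" for x
    by (rule test_functions_derivative(1)[OF s])
  have on: "onorm (frechet_derivative s (at x)) \<le> (\<Sum>b\<in>Basis. M b)" for x
  proof (rule onorm_bound)
    show "0 \<le> sum M Basis" by (intro sum_nonneg M)
    fix h show "norm (frechet_derivative s (at x) h) \<le> sum M Basis * norm h"
      using linear_le_sum_Basis[of "frechet_derivative s (at x)" M h] M(2) has_derivative_linear[OF D[of x]]
      by (simp add: d_def)
  qed
  have "(\<Sum>b\<in>Basis. M b)-lipschitz_on UNIV s"
  proof (rule lipschitz_onI)
    fix x y
    have "norm (s x - s y) \<le> (\<Sum>b\<in>Basis. M b) * norm (x - y)"
      by (rule differentiable_bound[of UNIV s "\<lambda>x. frechet_derivative s (at x)"]) (use D on in auto)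
    then show "dist (s x) (s y) \<le> (\<Sum>b\<in>Basis. M b) * dist x y" by (simp add: dist_norm)
  qed (use M in \<open>auto intro: sum_nonneg\<close>)
  then show ?thesis using s by (intro lipc_I) (auto simp: test_functions_iff)
qed

lemma lipc_lborel_integrable:
  assumes "f \<in> lipc" shows "integrable lborel (f :: 'a::euclidean_space \<Rightarrow> real)"
proof -
  obtain M where M: "\<And>x. \<bar>f x\<bar> \<le> M" using lipc_bounded[OF assms] by blast
  define K where "K = closure {x. f x \<noteq> 0}"
  have K: "compact K" using assms by (auto simp: lipc_def K_def)
  have "integrable lborel (\<lambda>x. indicator K x *\<^sub>R f x)"
    by (rule borel_integrable_compact[OF K lipc_continuous[OF assms], unfolded set_integrable_def])
  moreover have "(\<lambda>x. indicator K x *\<^sub>R f x) = f"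
    using closure_subset[of "{x. f x \<noteq> 0}"] by (auto simp: K_def fun_eq_iff indicator_def)
  ultimately show ?thesis by simp
qed

text \<open>All derivatives fall on \<open>s\<close>, and partial derivatives of test functions are
  test functions, so the convolutions of the fixed \<open>v\<close> with test functions form a
  family closed under partial differentiation.\<close>

lemma convolution_C_times:
  fixes v :: "'a::euclidean_space \<Rightarrow> real"
  assumes v: "integrable lborel v" and s: "s \<in> test_functions"
  shows "C_times k (\<lambda>x. LINT y|lborel. v y * s (x - y))"
proof (rule C_times_coinduct[where F="(\<lambda>s x. LINT y|lborel. v y * s (x - y)) ` test_functions"])
  show "(\<lambda>x. LINT y|lborel. v y * s (x - y)) \<in> (\<lambda>s x. LINT y|lborel. v y * s (x - y)) ` test_functions"
    using s by blast
  have [measurable]: "v \<in> borel_measurable borel" using v by auto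
  have int: "integrable lborel (\<lambda>y. v y * s (x - y))" if s: "s \<in> test_functions" for s x
  proof -
    have l: "s \<in> lipc" by (rule test_functions_lipc[OF s])
    note [measurable] = lipc_measurable[OF l]
    obtain M where M: "0 \<le> M" "\<And>x. \<bar>s x\<bar> \<le> M" using lipc_bounded[OF l] by blast
    show ?thesis
    proof (rule Bochner_Integration.integrable_bound[of lborel "\<lambda>y. M * v y"])
      have "\<bar>v y\<bar> * \<bar>s (x - y)\<bar> \<le> \<bar>v y\<bar> * M" for y by (intro mult_left_mono M) auto
      then show "AE y in lborel. norm (v y * s (x - y)) \<le> norm (M * v y)"
        using M(1) by (simp add: abs_mult mult.commute)
    qed (use v in auto)
  qed
  fix w assume "w \<in> (\<lambda>s x. LINT y|lborel. v y * s (x - y)) ` (test_functions :: ('a \<Rightarrow> real) set)"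
  then obtain s where s: "s \<in> test_functions" and w: "w = (\<lambda>x. LINT y|lborel. v y * s (x - y))" by auto
  define d where "d b x = frechet_derivative s (at x) b" for b x
  have d: "d b \<in> test_functions" if "b \<in> Basis" for b
    unfolding d_def by (rule test_functions_derivative(2)[OF s that])
  have "\<forall>b\<in>Basis. \<exists>L. L-lipschitz_on UNIV (d b)"
    using test_functions_lipc[OF d] by (auto simp: lipc_def)
  then obtain L where L: "\<And>b. b \<in> Basis \<Longrightarrow> (L b)-lipschitz_on UNIV (d b)" by metis
  define K where "K = (\<Sum>b\<in>Basis. L b)"
  have K0: "0 \<le> K" unfolding K_def by (intro sum_nonneg lipschitz_on_nonneg[OF L])
  have D: "(s has_derivative frechet_derivative s (at x)) (at x)" for x
    by (rule test_functions_derivative(1)[OF s])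
  have lin: "linear (frechet_derivative s (at x))" for x by (rule has_derivative_linear[OF D])
  \<comment> \<open>The partial derivatives of \<open>s\<close> are Lipschitz on the whole space, so
    the first order remainder is quadratic uniformly in \<open>z\<close>. It can therefore be
    integrated against \<open>v\<close> without a limit theorem.\<close>
  have taylor: "\<bar>s (z + h) - s z - frechet_derivative s (at z) h\<bar> \<le> K * norm h ^ 2" for z h
  proof -
    have "norm (s (z + h) - s z - frechet_derivative s (at z) (z + h - z)) \<le> norm (z + h - z) * (K * norm h)"
    proof (rule differentiable_bound_linearization[where S="closed_segment z (z + h)" and f'="\<lambda>x. frechet_derivative s (at x)"])
      fix t :: real assume "t \<in> {0..1}"
      then show "z + t *\<^sub>R (z + h - z) \<in> closed_segment z (z + h)"
        by (auto simp: closed_segment_def algebra_simps intro!: exI[of _ t])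
    next
      fix x assume "x \<in> closed_segment z (z + h)"
      then show "(s has_derivative frechet_derivative s (at x)) (at x within closed_segment z (z + h))"
        using D has_derivative_at_withinI by blast
    next
      show "onorm (frechet_derivative s (at x) - frechet_derivative s (at z)) \<le> K * norm h"
        if x: "x \<in> closed_segment z (z + h)" for x
        unfolding fun_diff_def
      proof (rule onorm_bound)
        show "0 \<le> K * norm h" using K0 by simp
        fix i
        have xz: "norm (x - z) \<le> norm h"
          using segment_bound(1)[OF x] by (simp add: norm_minus_commute)
        have "\<bar>frechet_derivative s (at x) i - frechet_derivative s (at z) i\<bar> \<le> (\<Sum>b\<in>Basis. L b * norm h) * norm i"
        proof (rule linear_le_sum_Basis)
          show "linear (\<lambda>i. frechet_derivative s (at x) i - frechet_derivative s (at z) i)"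
            by (intro linear_compose_sub lin)
          fix b :: 'a assume b: "b \<in> Basis"
          have "\<bar>d b x - d b z\<bar> \<le> L b * dist x z" by (rule lipschitz_on_realD[OF L[OF b]])
          also have "\<dots> \<le> L b * norm h"
            using xz lipschitz_on_nonneg[OF L[OF b]] by (intro mult_left_mono) (auto simp: dist_norm)
          finally show "\<bar>frechet_derivative s (at x) b - frechet_derivative s (at z) b\<bar> \<le> L b * norm h"
            by (simp add: d_def)
        qed
        then show "norm (frechet_derivative s (at x) i - frechet_derivative s (at z) i) \<le> K * norm h * norm i"
          by (simp add: K_def sum_distrib_right)
      qed
    qed auto
    then show ?thesis by (simp add: power2_eq_square mult_ac)
  qed
  define W where "W x h = (\<Sum>b\<in>Basis. (h \<bullet> b) * (LINT y|lborel. v y * d b (x - y)))" for x h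
  have Weq: "W x h = (LINT y|lborel. v y * frechet_derivative s (at (x - y)) h)"
    "integrable lborel (\<lambda>y. v y * frechet_derivative s (at (x - y)) h)" for x h
  proof -
    have e: "v y * frechet_derivative s (at (x - y)) h = (\<Sum>b\<in>Basis. (h \<bullet> b) * (v y * d b (x - y)))" for y
    proof -
      have "frechet_derivative s (at (x - y)) h = frechet_derivative s (at (x - y)) (\<Sum>b\<in>Basis. (h \<bullet> b) *\<^sub>R b)"
        by (simp add: euclidean_representation)
      also have "\<dots> = (\<Sum>b\<in>Basis. (h \<bullet> b) * d b (x - y))"
        using lin by (simp add: linear_sum linear_scale d_def)
      finally show ?thesis by (simp add: sum_distrib_left mult_ac)
    qed
    show "W x h = (LINT y|lborel. v y * frechet_derivative s (at (x - y)) h)"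
      unfolding e W_def using int[OF d] by (subst Bochner_Integration.integral_sum) auto
    show "integrable lborel (\<lambda>y. v y * frechet_derivative s (at (x - y)) h)"
      unfolding e using int[OF d] by auto
  qed
  have "(w has_derivative W x) (at x)" for x
  proof (rule has_derivativeI_sandwich[of 1])
    show "bounded_linear (W x)" unfolding W_def
      by (intro bounded_linear_sum bounded_linear_mult_const bounded_linear_inner_left)
    define C where "C = K * (LINT y|lborel. \<bar>v y\<bar>)"
    show "((\<lambda>z. C * norm (z - x)) \<longlongrightarrow> 0) (at x)"
    proof -
      have "((\<lambda>z. C * norm (z - x)) \<longlongrightarrow> C * norm (x - x)) (at x)" by (intro tendsto_intros)
      then show ?thesis by simp
    qed
    fix z assume z: "z \<noteq> x" "dist z x < 1"
    define h where "h = z - x"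
    have "w z - w x - W x (z - x) = (LINT y|lborel. v y * (s (x - y + h) - s (x - y) - frechet_derivative s (at (x - y)) h))"
      unfolding w Weq(1) using int[OF s, of z] int[OF s, of x] Weq(2)[of x h]
      by (simp add: h_def algebra_simps)
    also have "norm \<dots> \<le> (LINT y|lborel. K * norm h ^ 2 * \<bar>v y\<bar>)"
    proof (rule norm_integral_le)
      have "integrable lborel (\<lambda>y. v y * s (z - y) - v y * s (x - y) - v y * frechet_derivative s (at (x - y)) h)"
        using int[OF s, of z] int[OF s, of x] Weq(2)[of x h] by auto
      then show "integrable lborel (\<lambda>y. v y * (s (x - y + h) - s (x - y) - frechet_derivative s (at (x - y)) h))"
        by (simp add: h_def algebra_simps)
      show "integrable lborel (\<lambda>y. K * norm h ^ 2 * \<bar>v y\<bar>)" using v by auto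
      fix y
      have "\<bar>v y\<bar> * \<bar>s (x - y + h) - s (x - y) - frechet_derivative s (at (x - y)) h\<bar> \<le> \<bar>v y\<bar> * (K * norm h ^ 2)"
        by (intro mult_left_mono taylor) auto
      then show "norm (v y * (s (x - y + h) - s (x - y) - frechet_derivative s (at (x - y)) h)) \<le> K * norm h ^ 2 * \<bar>v y\<bar>"
        by (simp add: abs_mult mult_ac)
    qed
    also have "\<dots> = C * norm h * norm h" by (simp add: C_def power2_eq_square)
    finally show "norm (w z - w x - W x (z - x)) / norm (z - x) \<le> C * norm (z - x)"
      using z by (simp add: h_def divide_le_eq)
  qed simp
  moreover have "(\<lambda>x. W x b) \<in> (\<lambda>s x. LINT y|lborel. v y * s (x - y)) ` test_functions" if "b \<in> Basis" for b
  proof -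
    have "(\<lambda>x. W x b) = (\<lambda>x. LINT y|lborel. v y * d b (x - y))"
      unfolding Weq(1) by (simp add: d_def)
    then show ?thesis using d[OF that] by (simp only:) (rule imageI)
  qed
  ultimately show "\<exists>D. (\<forall>x. (w has_derivative D x) (at x)) \<and>
      (\<forall>b\<in>Basis. (\<lambda>x. D x b) \<in> (\<lambda>s x. LINT y|lborel. v y * s (x - y)) ` test_functions)" by blast
qed

lemma mollifier_exists:
  assumes "0 < e"
  obtains m :: "'a::euclidean_space \<Rightarrow> real" where "m \<in> test_functions" "\<And>x. 0 \<le> m x" "\<And>x. e \<le> norm x \<Longrightarrow> m x = 0"
    "(LINT x|lborel. m x) = 1"
proof -
  define g where "g x = flat_exp 0 (e\<^sup>2 - x \<bullet> x)" for x :: 'a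
  have g0: "0 \<le> g x" for x by (simp add: g_def flat_exp_def)
  have gz: "g x = 0" if "e \<le> norm x" for x
  proof -
    have "e\<^sup>2 \<le> (norm x)\<^sup>2" using that assms by (intro power_mono) auto
    then show ?thesis by (simp add: g_def flat_exp_def power2_norm_eq_inner)
  qed
  have gpos: "0 < g x" if "norm x < e" for x
  proof -
    have "(norm x)\<^sup>2 < e\<^sup>2" using that by (intro power_strict_mono) auto
    then show ?thesis by (simp add: g_def flat_exp_def power2_norm_eq_inner)
  qed
  have fam: "g \<in> smooth_family" unfolding g_def[abs_def] by (rule smooth_family.flat)
  have bs: "bounded {x. g x \<noteq> 0}"
    by (rule bounded_subset[OF bounded_ball[of 0 e]]) (use gz in \<open>auto simp: not_le[symmetric]\<close>)
  have gt: "g \<in> test_functions" using smooth_family_C_times[OF fam] bs by (simp add: test_functions_iff)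
  have gi: "integrable lborel g" by (rule lipc_lborel_integrable[OF test_functions_lipc[OF gt]])
  define c where "c = (LINT x|lborel. g x)"
  have "c \<noteq> 0"
  proof
    assume "c = 0"
    then have "AE x in lborel. g x = 0"
      using integral_nonneg_eq_0_iff_AE[OF gi] g0 by (simp add: c_def)
    then have "AE x in lborel. x \<notin> ball (0::'a) e"
      by (rule eventually_mono) (use gpos in force)
    then have "ball (0::'a) e \<in> null_sets lborel" by (simp add: AE_iff_null_sets)
    then have "emeasure lborel (ball (0::'a) e) = 0" by auto
    then show False using content_ball_pos[OF assms, of "0::'a"] by (simp add: measure_def)
  qed
  then have c: "0 < c" using Bochner_Integration.integral_nonneg[of lborel g] g0 by (simp add: c_def order_less_le)
  define m where "m x = (1 / c) * g x" for x
  have mf: "m \<in> smooth_family" unfolding m_def[abs_def] by (intro smooth_family.mult smooth_family.const fam)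
  have "bounded {x. m x \<noteq> 0}" by (rule bounded_subset[OF bs]) (auto simp: m_def)
  then have "m \<in> test_functions" using smooth_family_C_times[OF mf] by (simp add: test_functions_iff)
  moreover have "(LINT x|lborel. m x) = 1" unfolding m_def using c by (simp add: c_def)
  ultimately show thesis using that[of m] g0 gz c by (simp add: m_def)
qed

text \<open>Averaging over translates preserves the sup bound and the Lipschitz constant exactly.
  This is what makes the approximation controllable in the Gagliardo seminorm and keeps the bound on
  the functional.\<close>

theorem lipc_mollify:
  fixes v :: "'a::euclidean_space \<Rightarrow> real"
  assumes v: "L-lipschitz_on UNIV v" "\<And>x. \<bar>v x\<bar> \<le> M" "\<And>x. R \<le> norm x \<Longrightarrow> v x = 0" and e: "0 < e"
  obtains \<xi> where "\<xi> \<in> test_functions" "\<And>x. \<bar>\<xi> x - v x\<bar> \<le> L * e" "\<And>x. \<bar>\<xi> x\<bar> \<le> M"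
    "L-lipschitz_on UNIV \<xi>" "\<And>x. R + e \<le> norm x \<Longrightarrow> \<xi> x = 0"
proof -
  obtain m :: "'a \<Rightarrow> real" where m: "m \<in> test_functions" "\<And>x. 0 \<le> m x" "\<And>x. e \<le> norm x \<Longrightarrow> m x = 0"
    "(LINT x|lborel. m x) = 1" using mollifier_exists[OF e] by metis
  have L0: "0 \<le> L" by (rule lipschitz_on_nonneg[OF v(1)])
  have M0: "0 \<le> M" using v(2)[of 0] by linarith
  have vl: "v \<in> lipc"
    by (rule lipc_I[OF v(1)], rule bounded_subset[OF bounded_ball[of 0 R]])
      (use v(3) in \<open>auto simp: not_le[symmetric]\<close>)
  have ml: "m \<in> lipc" by (rule test_functions_lipc[OF m(1)])
  note [measurable] = lipc_measurable[OF vl] lipc_measurable[OF ml]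
  have mi: "integrable lborel m" by (rule lipc_lborel_integrable[OF ml])
  define \<xi> where "\<xi> x = (LINT y|lborel. v y * m (x - y))" for x
  have alt: "\<xi> x = (LINT y|lborel. v (x - y) * m y)" for x
    using integral_lborel_reflect[of "\<lambda>y. v (x - y) * m y" x] by (simp add: \<xi>_def)
  have int: "integrable lborel (\<lambda>y. v (x - y) * m y)" for x
    by (rule Bochner_Integration.integrable_bound[of lborel "\<lambda>y. M * m y"])
      (use mi m(2) M0 v(2) in \<open>auto simp: abs_mult intro!: AE_I2 mult_right_mono\<close>)
  \<comment> \<open>An average with weights of total mass one, supported in radius \<open>e\<close>,
    stays within \<open>B\<close> of \<open>c\<close> if all averaged values do. The choices
    \<open>c = v x\<close> and \<open>c = 0\<close> give closeness, the sup bound and the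
    support.\<close>
  have key: "\<bar>\<xi> x - c\<bar> \<le> B" if "\<And>y. norm y < e \<Longrightarrow> \<bar>v (x - y) - c\<bar> \<le> B" for x c B
  proof -
    have "\<xi> x - c = (LINT y|lborel. v (x - y) * m y) - (LINT y|lborel. c * m y)"
      using m(4) by (simp add: alt)
    also have "\<dots> = (LINT y|lborel. (v (x - y) - c) * m y)"
      using int mi by (simp add: left_diff_distrib)
    finally have "\<bar>\<xi> x - c\<bar> = norm (LINT y|lborel. (v (x - y) - c) * m y)" by simp
    also have "\<dots> \<le> (LINT y|lborel. B * m y)"
    proof (rule norm_integral_le)
      show "integrable lborel (\<lambda>y. (v (x - y) - c) * m y)" using int mi by (simp add: left_diff_distrib)
      show "integrable lborel (\<lambda>y. B * m y)" using mi by simp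
      show "norm ((v (x - y) - c) * m y) \<le> B * m y" for y
        using that[of y] m(2)[of y] m(3)[of y] by (cases "norm y < e") (auto simp: abs_mult intro: mult_right_mono)
    qed
    also have "\<dots> = B" using m(4) by simp
    finally show ?thesis .
  qed
  have b1: "\<bar>\<xi> x - v x\<bar> \<le> L * e" for x
  proof (rule key)
    fix y :: 'a assume "norm y < e"
    then have "L * dist (x - y) x \<le> L * e" using L0 by (intro mult_left_mono) (auto simp: dist_norm)
    then show "\<bar>v (x - y) - v x\<bar> \<le> L * e" using lipschitz_on_realD(2)[OF v(1), of "x - y" x] by linarith
  qed
  have b2: "\<bar>\<xi> x\<bar> \<le> M" for x using key[of x 0 M] v(2) by simp
  have b3: "\<xi> x = 0" if "R + e \<le> norm x" for x
  proof -
    have "\<bar>\<xi> x - 0\<bar> \<le> 0"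
    proof (rule key)
      fix y :: 'a assume "norm y < e"
      then have "R \<le> norm (x - y)" using that norm_triangle_ineq2[of x y] by linarith
      then show "\<bar>v (x - y) - 0\<bar> \<le> 0" using v(3) by simp
    qed
    then show ?thesis by simp
  qed
  have b4: "L-lipschitz_on UNIV \<xi>"
  proof (rule lipschitz_onI[OF _ L0])
    fix x z
    have "\<xi> x - \<xi> z = (LINT y|lborel. (v (x - y) - v (z - y)) * m y)"
      using int by (simp add: alt left_diff_distrib)
    also have "norm \<dots> \<le> (LINT y|lborel. L * dist x z * m y)"
    proof (rule norm_integral_le)
      show "integrable lborel (\<lambda>y. (v (x - y) - v (z - y)) * m y)" using int by (simp add: left_diff_distrib)
      show "integrable lborel (\<lambda>y. L * dist x z * m y)" using mi by simp
      show "norm ((v (x - y) - v (z - y)) * m y) \<le> L * dist x z * m y" for y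
        using lipschitz_on_realD(2)[OF v(1), of "x - y" "z - y"] m(2)[of y]
        by (auto simp: abs_mult dist_norm intro!: mult_right_mono)
    qed
    also have "\<dots> = L * dist x z" using m(4) by simp
    finally show "dist (\<xi> x) (\<xi> z) \<le> L * dist x z" by (simp add: dist_norm)
  qed
  have "bounded {x. \<xi> x \<noteq> 0}"
    by (rule bounded_subset[OF bounded_ball[of 0 "R + e"]]) (use b3 in \<open>auto simp: not_le[symmetric]\<close>)
  moreover have "C_times k \<xi>" for k
    unfolding \<xi>_def[abs_def] by (rule convolution_C_times[OF lipc_lborel_integrable[OF vl] m(1)])
  ultimately have "\<xi> \<in> test_functions" by (simp add: test_functions_iff)
  then show thesis using that b1 b2 b3 b4 by blast
qed

section \<open>The Gagliardo seminorm\<close>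

text \<open>Division by zero gives the value 0 at the origin, so the diagonal contributes
  nothing.\<close>

definition frac_kernel :: "real \<Rightarrow> 'a::euclidean_space \<Rightarrow> real" where
  "frac_kernel \<alpha> h = 1 / norm h powr (real DIM('a) + \<alpha>)"

definition frac_osc :: "real \<Rightarrow> ('a::euclidean_space \<Rightarrow> real) \<Rightarrow> 'a \<Rightarrow> ennreal" where
  "frac_osc \<alpha> v x = (\<integral>\<^sup>+y. ennreal (\<bar>v x - v y\<bar> * frac_kernel \<alpha> (x - y)) \<partial>lborel)"

definition gagliardo :: "real \<Rightarrow> ('a::euclidean_space \<Rightarrow> real) \<Rightarrow> ennreal" where
  "gagliardo \<alpha> v = (\<integral>\<^sup>+x. frac_osc \<alpha> v x \<partial>lborel)"

text \<open>The L1 modulus of continuity under translation by \<open>h\<close>.\<close>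

definition shift_diff :: "('a::euclidean_space \<Rightarrow> real) \<Rightarrow> 'a \<Rightarrow> ennreal" where
  "shift_diff v h = (\<integral>\<^sup>+x. ennreal \<bar>v (x + h) - v x\<bar> \<partial>lborel)"

lemma frac_kernel_nonneg [simp]: "0 \<le> frac_kernel \<alpha> h"
  by (simp add: frac_kernel_def)

lemma frac_kernel_minus [simp]: "frac_kernel \<alpha> (- h) = frac_kernel \<alpha> h"
  by (simp add: frac_kernel_def)

lemma frac_kernel_measurable [measurable]: "frac_kernel \<alpha> \<in> borel_measurable borel"
  unfolding frac_kernel_def by measurable

lemma shift_diff_measurable [measurable (raw)]:
  assumes [measurable]: "v \<in> borel_measurable borel"
  shows "shift_diff v \<in> borel_measurable borel"
proof -
  have "shift_diff v \<in> borel_measurable lborel" unfolding shift_diff_def by measurable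
  then show ?thesis by simp
qed

lemma frac_osc_measurable [measurable (raw)]:
  assumes [measurable]: "v \<in> borel_measurable borel"
  shows "frac_osc \<alpha> v \<in> borel_measurable borel"
proof -
  have "frac_osc \<alpha> v \<in> borel_measurable lborel" unfolding frac_osc_def by measurable
  then show ?thesis by simp
qed

lemma frac_osc_eq_shift:
  assumes [measurable]: "v \<in> borel_measurable borel"
  shows "frac_osc \<alpha> v x = (\<integral>\<^sup>+h. ennreal (frac_kernel \<alpha> h) * ennreal \<bar>v (x + h) - v x\<bar> \<partial>lborel)"
proof -
  have "frac_osc \<alpha> v x = (\<integral>\<^sup>+h. ennreal (\<bar>v x - v (x + h)\<bar> * frac_kernel \<alpha> (x - (x + h))) \<partial>lborel)"
    unfolding frac_osc_def by (rule nn_integral_lborel_shift[symmetric]) measurable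
  also have "\<dots> = (\<integral>\<^sup>+h. ennreal (frac_kernel \<alpha> h) * ennreal \<bar>v (x + h) - v x\<bar> \<partial>lborel)"
    by (intro nn_integral_cong) (simp add: ennreal_mult[symmetric] mult.commute abs_minus_commute)
  finally show ?thesis .
qed

text \<open>Substitution of \<open>x + h\<close> for \<open>y\<close>, then Tonelli. The weight
  \<open>w\<close> is there to carry the cutoff factor in \<open>gagliardo_product\<close>.\<close>

lemma gagliardo_weighted_eq_shift:
  fixes v :: "'a::euclidean_space \<Rightarrow> real"
  assumes [measurable]: "v \<in> borel_measurable borel" "w \<in> borel_measurable borel"
  shows "(\<integral>\<^sup>+x. w x * frac_osc \<alpha> v x \<partial>lborel)
    = (\<integral>\<^sup>+h. ennreal (frac_kernel \<alpha> h) * (\<integral>\<^sup>+x. w x * ennreal \<bar>v (x + h) - v x\<bar> \<partial>lborel) \<partial>lborel)"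
proof -
  have "(\<integral>\<^sup>+x. w x * frac_osc \<alpha> v x \<partial>lborel) =
    (\<integral>\<^sup>+x. (\<integral>\<^sup>+h. ennreal (frac_kernel \<alpha> h) * (w x * ennreal \<bar>v (x + h) - v x\<bar>) \<partial>lborel) \<partial>lborel)"
  proof (rule nn_integral_cong)
    fix x
    show "w x * frac_osc \<alpha> v x = (\<integral>\<^sup>+h. ennreal (frac_kernel \<alpha> h) * (w x * ennreal \<bar>v (x + h) - v x\<bar>) \<partial>lborel)"
      unfolding frac_osc_eq_shift[OF assms(1)]
      by (subst nn_integral_cmult[symmetric]) (auto simp: mult_ac)
  qed
  also have "\<dots> = (\<integral>\<^sup>+h. (\<integral>\<^sup>+x. ennreal (frac_kernel \<alpha> h) * (w x * ennreal \<bar>v (x + h) - v x\<bar>) \<partial>lborel) \<partial>lborel)"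
    by (rule lborel_pair.Fubini') measurable
  also have "\<dots> = (\<integral>\<^sup>+h. ennreal (frac_kernel \<alpha> h) * (\<integral>\<^sup>+x. w x * ennreal \<bar>v (x + h) - v x\<bar> \<partial>lborel) \<partial>lborel)"
    by (intro nn_integral_cong nn_integral_cmult) measurable
  finally show ?thesis .
qed

lemma gagliardo_eq_shift:
  fixes v :: "'a::euclidean_space \<Rightarrow> real"
  assumes "v \<in> borel_measurable borel"
  shows "gagliardo \<alpha> v = (\<integral>\<^sup>+h. ennreal (frac_kernel \<alpha> h) * shift_diff v h \<partial>lborel)"
  using gagliardo_weighted_eq_shift[OF assms, of "\<lambda>_. 1" \<alpha>] by (simp add: gagliardo_def shift_diff_def)

lemma frac_osc_mono:
  assumes [measurable]: "v \<in> borel_measurable borel"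
    and "\<And>x y. \<bar>u x - u y\<bar> \<le> c * \<bar>v x - v y\<bar>" "0 \<le> c"
  shows "frac_osc \<alpha> u x \<le> ennreal c * frac_osc \<alpha> v x"
proof -
  have "frac_osc \<alpha> u x \<le> (\<integral>\<^sup>+y. ennreal c * ennreal (\<bar>v x - v y\<bar> * frac_kernel \<alpha> (x - y)) \<partial>lborel)"
    unfolding frac_osc_def
  proof (rule nn_integral_mono)
    fix y
    have "\<bar>u x - u y\<bar> * frac_kernel \<alpha> (x - y) \<le> (c * \<bar>v x - v y\<bar>) * frac_kernel \<alpha> (x - y)"
      by (rule mult_right_mono[OF assms(2)]) simp
    then show "ennreal (\<bar>u x - u y\<bar> * frac_kernel \<alpha> (x - y)) \<le> ennreal c * ennreal (\<bar>v x - v y\<bar> * frac_kernel \<alpha> (x - y))"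
      using assms(3) by (simp add: ennreal_mult[symmetric] mult.assoc)
  qed
  also have "\<dots> = ennreal c * frac_osc \<alpha> v x" unfolding frac_osc_def by (rule nn_integral_cmult) measurable
  finally show ?thesis .
qed

lemma gagliardo_mono:
  assumes [measurable]: "v \<in> borel_measurable borel"
    and "\<And>x y. \<bar>u x - u y\<bar> \<le> c * \<bar>v x - v y\<bar>" "0 \<le> c"
  shows "gagliardo \<alpha> u \<le> ennreal c * gagliardo \<alpha> v"
proof -
  have "gagliardo \<alpha> u \<le> (\<integral>\<^sup>+x. ennreal c * frac_osc \<alpha> v x \<partial>lborel)"
    unfolding gagliardo_def by (intro nn_integral_mono frac_osc_mono assms)
  also have "\<dots> = ennreal c * gagliardo \<alpha> v" unfolding gagliardo_def by (rule nn_integral_cmult) measurable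
  finally show ?thesis .
qed

lemma frac_osc_add:
  assumes [measurable]: "u \<in> borel_measurable borel" "v \<in> borel_measurable borel"
    and "\<And>x y. \<bar>w x - w y\<bar> \<le> \<bar>u x - u y\<bar> + \<bar>v x - v y\<bar>"
  shows "frac_osc \<alpha> w x \<le> frac_osc \<alpha> u x + frac_osc \<alpha> v x"
proof -
  have "frac_osc \<alpha> w x \<le> (\<integral>\<^sup>+y. ennreal (\<bar>u x - u y\<bar> * frac_kernel \<alpha> (x - y)) + ennreal (\<bar>v x - v y\<bar> * frac_kernel \<alpha> (x - y)) \<partial>lborel)"
    unfolding frac_osc_def
  proof (rule nn_integral_mono)
    fix y
    have "\<bar>w x - w y\<bar> * frac_kernel \<alpha> (x - y) \<le> (\<bar>u x - u y\<bar> + \<bar>v x - v y\<bar>) * frac_kernel \<alpha> (x - y)"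
      by (rule mult_right_mono[OF assms(3)]) simp
    then show "ennreal (\<bar>w x - w y\<bar> * frac_kernel \<alpha> (x - y)) \<le>
        ennreal (\<bar>u x - u y\<bar> * frac_kernel \<alpha> (x - y)) + ennreal (\<bar>v x - v y\<bar> * frac_kernel \<alpha> (x - y))"
      by (simp add: ennreal_plus[symmetric] distrib_right del: ennreal_plus)
  qed
  also have "\<dots> = frac_osc \<alpha> u x + frac_osc \<alpha> v x" unfolding frac_osc_def by (rule nn_integral_add) measurable
  finally show ?thesis .
qed

lemma gagliardo_add:
  assumes [measurable]: "u \<in> borel_measurable borel" "v \<in> borel_measurable borel"
    and "\<And>x y. \<bar>w x - w y\<bar> \<le> \<bar>u x - u y\<bar> + \<bar>v x - v y\<bar>"
  shows "gagliardo \<alpha> w \<le> gagliardo \<alpha> u + gagliardo \<alpha> v"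
proof -
  have "gagliardo \<alpha> w \<le> (\<integral>\<^sup>+x. frac_osc \<alpha> u x + frac_osc \<alpha> v x \<partial>lborel)"
    unfolding gagliardo_def by (intro nn_integral_mono frac_osc_add assms)
  also have "\<dots> = gagliardo \<alpha> u + gagliardo \<alpha> v" unfolding gagliardo_def by (rule nn_integral_add) measurable
  finally show ?thesis .
qed

lemma gagliardo_zero [simp]: "gagliardo \<alpha> (\<lambda>x. 0) = 0"
  by (simp add: gagliardo_def frac_osc_def)

lemma gagliardo_sum:
  assumes "\<And>i. i \<in> I \<Longrightarrow> v i \<in> borel_measurable borel"
  shows "gagliardo \<alpha> (\<lambda>x. \<Sum>i\<in>I. v i x) \<le> (\<Sum>i\<in>I. gagliardo \<alpha> (v i))"
  using assms
proof (induction I rule: infinite_finite_induct)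
  case (insert i I)
  have "gagliardo \<alpha> (\<lambda>x. v i x + (\<Sum>i\<in>I. v i x)) \<le> gagliardo \<alpha> (v i) + gagliardo \<alpha> (\<lambda>x. \<Sum>i\<in>I. v i x)"
    by (rule gagliardo_add) (use insert.prems in auto)
  also have "\<dots> \<le> gagliardo \<alpha> (v i) + (\<Sum>i\<in>I. gagliardo \<alpha> (v i))"
    by (rule add_left_mono) (use insert in auto)
  finally show ?case using insert.hyps by simp
qed auto

text \<open>The kernel tested against the largest increment that oscillation at most
  \<open>a\<close> and Lipschitz constant \<open>L\<close> allow. The Lipschitz bound tames the
  singularity at the origin, where \<alpha> < 1 is needed, and the oscillation bound the tail at
  infinity, where 0 < \<alpha> is needed. The second argument selects the space.\<close>

definition kernel_mass :: "real \<Rightarrow> 'a::euclidean_space itself \<Rightarrow> real \<Rightarrow> real \<Rightarrow> ennreal" where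
  "kernel_mass \<alpha> _ a L = (\<integral>\<^sup>+h. ennreal (frac_kernel \<alpha> (h::'a)) * ennreal (min a (L * norm h)) \<partial>lborel)"

lemma dyadic_bracket:
  fixes x :: real assumes "1 \<le> x"
  obtains k :: nat where "2 ^ k \<le> x" "x < 2 ^ (k + 1)"
proof -
  obtain m where "x < 2 ^ m" using real_arch_pow[of 2 x] by auto
  define m where "m = (LEAST m. x < 2 ^ m)"
  have m: "x < 2 ^ m" unfolding m_def by (rule LeastI) fact
  have "m \<noteq> 0" using m assms by (cases m) auto
  then obtain k where k: "m = Suc k" by (cases m) auto
  have "\<not> x < 2 ^ k" using not_less_Least[of k "\<lambda>m. x < 2 ^ m"] k by (simp add: m_def)
  then show thesis using that[of k] m k by simp
qed

lemma suminf_geometric_ennreal_finite: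
  assumes "0 \<le> q" "q < 1" "0 \<le> c"
  shows "(\<Sum>k. ennreal (c * q ^ k)) < \<infinity>"
proof -
  have "summable (\<lambda>k. c * q ^ k)" using assms by (intro summable_mult summable_geometric) auto
  then have "(\<Sum>k. ennreal (c * q ^ k)) = ennreal (\<Sum>k. c * q ^ k)"
    using assms by (intro suminf_ennreal2) auto
  then show ?thesis by simp
qed

lemma term_le_suminf_ennreal: "(f k :: ennreal) \<le> (\<Sum>k. f k)"
  using sum_le_suminf[of f "{k}"] by simp

text \<open>Dyadic shells take the place of polar coordinates. Up to constants, the shell of radius
  2^k contributes 2^(-\<alpha> k), and the shell of radius 2^-k contributes 2^((\<alpha>-1) k); both
  series are geometric.\<close>

lemma kernel_mass_unit_finite:
  assumes "0 < \<alpha>" "\<alpha> < 1"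
  shows "kernel_mass \<alpha> TYPE('a::euclidean_space) 1 1 < \<infinity>"
proof -
  define n where "n = DIM('a)"
  define s where "s = real n + \<alpha>"
  define V where "V = unit_ball_vol (real n)"
  have V0: "0 \<le> V" by (simp add: V_def)
  have s0: "0 < s" using assms by (simp add: s_def)
  \<comment> \<open>On shell \<open>k\<close>, \<open>c1 k\<close> bounds the kernel outside the
    unit ball and \<open>c2 k\<close> bounds the kernel times the norm inside it. The open balls
    \<open>B1 k\<close> and \<open>B2 k\<close> contain the shells; the factor 2 in
    \<open>B2 k\<close> admits the boundary points of norm 2^-k.\<close>
  define c1 where "c1 k = 2 powr (- s * real k)" for k :: nat
  define c2 where "c2 k = 2 powr (s * (real k + 1)) * 2 powr (- real k)" for k :: nat
  define B1 where "B1 k = (ball 0 (2 powr (real k + 1)) :: 'a set)" for k :: nat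
  define B2 where "B2 k = (ball 0 (2 * 2 powr (- real k)) :: 'a set)" for k :: nat
  have ptw: "ennreal (frac_kernel \<alpha> h) * ennreal (min 1 (1 * norm h))
      \<le> (\<Sum>k. ennreal (c1 k) * indicator (B1 k) h) + (\<Sum>k. ennreal (c2 k) * indicator (B2 k) h)" for h :: 'a
  proof -
    consider "h = 0" | "1 \<le> norm h" | "h \<noteq> 0" "norm h \<le> 1" by linarith
    then show ?thesis
    proof cases
      case 1 then show ?thesis by simp
    next
      case 2
      obtain k where k: "2 ^ k \<le> norm h" "norm h < 2 ^ (k + 1)" using dyadic_bracket[OF 2] by blast
      have "2 powr (s * real k) \<le> norm h powr s"
      proof -
        have "2 powr (s * real k) = (2 powr real k) powr s" by (simp only: powr_powr mult.commute)
        also have "\<dots> \<le> norm h powr s" using k(1) s0 by (intro powr_mono2) (auto simp: powr_realpow)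
        finally show ?thesis .
      qed
      then have "frac_kernel \<alpha> h \<le> c1 k"
        unfolding frac_kernel_def c1_def n_def[symmetric] s_def[symmetric]
        by (simp add: powr_minus divide_simps)
      moreover have "h \<in> B1 k" using k(2) by (simp add: B1_def powr_add powr_realpow)
      ultimately have "ennreal (frac_kernel \<alpha> h) * ennreal (min 1 (1 * norm h)) \<le> ennreal (c1 k) * indicator (B1 k) h"
        using 2 by (simp add: ennreal_leI)
      also have "\<dots> \<le> (\<Sum>k. ennreal (c1 k) * indicator (B1 k) h)"
        by (rule term_le_suminf_ennreal)
      finally show ?thesis by (simp add: add_increasing2)
    next
      case 3
      have "1 \<le> 1 / norm h" using 3 by simp
      then obtain k where k: "2 ^ k \<le> 1 / norm h" "1 / norm h < 2 ^ (k + 1)" using dyadic_bracket by blast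
      have h1: "norm h \<le> 2 powr (- real k)" using k(1) 3
        by (simp add: powr_minus powr_realpow field_simps)
      have h2: "2 powr (- (real k + 1)) \<le> norm h"
      proof -
        have "1 < 2 ^ (k + 1) * norm h" using k(2) 3 by (simp add: divide_less_eq)
        then have "1 / 2 ^ (k + 1) < norm h" by (simp add: divide_less_eq mult.commute)
        moreover have "2 powr (- (real k + 1)) = 1 / 2 ^ (k + 1)"
          using powr_realpow[of 2 "k + 1"] by (simp only: powr_minus_divide) (simp add: add.commute)
        ultimately show ?thesis by linarith
      qed
      have "2 powr (- (s * (real k + 1))) \<le> norm h powr s"
        using powr_mono2[OF _ _ h2, of s] s0 by (simp add: powr_powr mult.commute algebra_simps)
      then have "frac_kernel \<alpha> h \<le> 2 powr (s * (real k + 1))"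
        unfolding frac_kernel_def n_def[symmetric] s_def[symmetric] powr_minus using 3
        by (simp add: divide_simps mult.commute)
      then have "frac_kernel \<alpha> h * norm h \<le> c2 k"
        unfolding c2_def using h1 by (intro mult_mono) auto
      moreover have "h \<in> B2 k" using h1 by (simp add: B2_def) (smt (verit) powr_gt_zero)
      ultimately have "ennreal (frac_kernel \<alpha> h) * ennreal (min 1 (1 * norm h)) \<le> ennreal (c2 k) * indicator (B2 k) h"
        using 3 by (simp add: ennreal_mult[symmetric] ennreal_leI)
      also have "\<dots> \<le> (\<Sum>k. ennreal (c2 k) * indicator (B2 k) h)"
        by (rule term_le_suminf_ennreal)
      finally show ?thesis by (simp add: add_increasing)
    qed
  qed
  have i1: "ennreal (c1 k) * emeasure lborel (B1 k) = ennreal (V * 2 ^ n * (2 powr (- \<alpha>)) ^ k)" for k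
  proof -
    have "emeasure lborel (B1 k) = ennreal (V * (2 powr (real k + 1)) ^ n)"
      unfolding B1_def V_def n_def by (rule emeasure_ball) simp
    moreover have "c1 k * (V * (2 powr (real k + 1)) ^ n) = V * 2 ^ n * (2 powr (- \<alpha>)) ^ k"
    proof -
      have p: "(2 powr u) ^ m = 2 powr (real m * u)" for u :: real and m
        by (rule powr_power) simp
      have "c1 k * (2 powr (real k + 1)) ^ n = 2 powr (- s * real k + real n * (real k + 1))"
        unfolding c1_def p powr_add[symmetric] ..
      also have "- s * real k + real n * (real k + 1) = real n + real k * (- \<alpha>)" by (simp add: s_def algebra_simps)
      also have "2 powr \<dots> = 2 powr real n * (2 powr (- \<alpha>)) ^ k" unfolding p powr_add ..
      also have "2 powr real n = 2 ^ n" by (rule powr_realpow) simp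
      finally show ?thesis by (simp add: mult_ac)
    qed
    ultimately show ?thesis using V0 by (simp add: ennreal_mult[symmetric] c1_def)
  qed
  have i2: "ennreal (c2 k) * emeasure lborel (B2 k) = ennreal (V * 2 ^ n * 2 powr s * (2 powr (\<alpha> - 1)) ^ k)" for k
  proof -
    have "emeasure lborel (B2 k) = ennreal (V * (2 * 2 powr (- real k)) ^ n)"
      unfolding B2_def V_def n_def by (rule emeasure_ball) simp
    moreover have "c2 k * (V * (2 * 2 powr (- real k)) ^ n) = V * 2 ^ n * 2 powr s * (2 powr (\<alpha> - 1)) ^ k"
    proof -
      have p: "(2 powr u) ^ m = 2 powr (real m * u)" for u :: real and m
        by (rule powr_power) simp
      have "c2 k * (2 powr (- real k)) ^ n = 2 powr (s * (real k + 1) + - real k + real n * - real k)"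
        unfolding c2_def p powr_add[symmetric] ..
      also have "s * (real k + 1) + - real k + real n * - real k = s + real k * (\<alpha> - 1)"
        by (simp add: s_def algebra_simps)
      also have "2 powr \<dots> = 2 powr s * (2 powr (\<alpha> - 1)) ^ k" unfolding p powr_add ..
      finally show ?thesis by (simp add: power_mult_distrib mult_ac)
    qed
    ultimately show ?thesis using V0 by (simp add: ennreal_mult[symmetric] c2_def)
  qed
  have "kernel_mass \<alpha> TYPE('a) 1 1
      \<le> (\<integral>\<^sup>+h. (\<Sum>k. ennreal (c1 k) * indicator (B1 k) h) + (\<Sum>k. ennreal (c2 k) * indicator (B2 k) h) \<partial>lborel)"
    unfolding kernel_mass_def by (rule nn_integral_mono) (rule ptw)
  also have "\<dots> = (\<Sum>k. ennreal (c1 k) * emeasure lborel (B1 k)) + (\<Sum>k. ennreal (c2 k) * emeasure lborel (B2 k))"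
  proof -
    have [measurable]: "B1 k \<in> sets borel" "B2 k \<in> sets borel" for k by (auto simp: B1_def B2_def)
    show ?thesis
      by (subst nn_integral_add) (simp_all add: nn_integral_suminf nn_integral_cmult_indicator)
  qed
  also have "\<dots> < \<infinity>"
  proof -
    have "2 powr (- \<alpha>) < 1" "2 powr (\<alpha> - 1) < (1::real)" using assms by (simp_all add: powr_less_one)
    then have "(\<Sum>k. ennreal (V * 2 ^ n * (2 powr (- \<alpha>)) ^ k)) < \<infinity>"
      "(\<Sum>k. ennreal (V * 2 ^ n * 2 powr s * (2 powr (\<alpha> - 1)) ^ k)) < \<infinity>"
      by (intro suminf_geometric_ennreal_finite powr_ge_zero mult_nonneg_nonneg V0 zero_le_power; simp)+
    then show ?thesis
      unfolding i1 i2 infinity_ennreal_def ennreal_add_less_top by (rule conjI)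
  qed
  finally show ?thesis .
qed

lemma nn_integral_lborel_scale:
  fixes f :: "'a::euclidean_space \<Rightarrow> ennreal"
  assumes [measurable]: "f \<in> borel_measurable borel" and c: "0 < c"
  shows "(\<integral>\<^sup>+y. f y \<partial>lborel) = ennreal (c ^ DIM('a)) * (\<integral>\<^sup>+y. f (c *\<^sub>R y) \<partial>lborel)"
proof -
  have "(\<integral>\<^sup>+y. f y \<partial>lborel) = (\<integral>\<^sup>+y. f y \<partial>(density (distr lborel borel (\<lambda>x. 0 + c *\<^sub>R x)) (\<lambda>_. \<bar>c\<bar>^DIM('a))))"
    using lborel_affine[of c "0::'a"] c by simp
  also have "\<dots> = (\<integral>\<^sup>+y. ennreal (c ^ DIM('a)) * f (c *\<^sub>R y) \<partial>lborel)"
    using c by (simp add: nn_integral_density nn_integral_distr)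
  also have "\<dots> = ennreal (c ^ DIM('a)) * (\<integral>\<^sup>+y. f (c *\<^sub>R y) \<partial>lborel)"
    by (rule nn_integral_cmult) measurable
  finally show ?thesis .
qed

text \<open>Rescaling by \<open>a / L\<close>, the length at which the two terms of the minimum
  cross. The resulting interpolation between sup bound and Lipschitz bound drives every later limit
  of seminorms of cutoffs and mollifications.\<close>

lemma kernel_mass_scale:
  fixes a L :: real
  assumes a: "0 < a" and L: "0 < L"
  shows "kernel_mass \<alpha> TYPE('a::euclidean_space) a L = ennreal (a powr (1 - \<alpha>) * L powr \<alpha>) * kernel_mass \<alpha> TYPE('a) 1 1"
proof -
  define c where "c = a / L"
  have c: "0 < c" using a L by (simp add: c_def)
  have "kernel_mass \<alpha> TYPE('a) a L = ennreal (c ^ DIM('a)) *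
      (\<integral>\<^sup>+h. ennreal (frac_kernel \<alpha> (c *\<^sub>R (h::'a))) * ennreal (min a (L * norm (c *\<^sub>R h))) \<partial>lborel)"
    unfolding kernel_mass_def by (rule nn_integral_lborel_scale[OF _ c]) measurable
  also have "\<dots> = ennreal (c ^ DIM('a)) * (\<integral>\<^sup>+h. ennreal (c powr (- (real DIM('a) + \<alpha>)) * a) *
      (ennreal (frac_kernel \<alpha> (h::'a)) * ennreal (min 1 (1 * norm h))) \<partial>lborel)"
  proof (rule arg_cong[where f="\<lambda>t. ennreal (c ^ DIM('a)) * t"], rule nn_integral_cong)
    fix h :: 'a
    have "frac_kernel \<alpha> (c *\<^sub>R h) = c powr (- (real DIM('a) + \<alpha>)) * frac_kernel \<alpha> h"
      unfolding frac_kernel_def powr_minus using c by (simp add: powr_mult divide_simps)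
    moreover have "L * norm (c *\<^sub>R h) = a * norm h" using a L by (simp add: c_def)
    then have "min a (L * norm (c *\<^sub>R h)) = a * min 1 (1 * norm h)"
      using a by (simp only: min_mult_distrib_left) simp
    ultimately show "ennreal (frac_kernel \<alpha> (c *\<^sub>R h)) * ennreal (min a (L * norm (c *\<^sub>R h)))
        = ennreal (c powr (- (real DIM('a) + \<alpha>)) * a) * (ennreal (frac_kernel \<alpha> h) * ennreal (min 1 (1 * norm h)))"
      using a by (simp add: ennreal_mult[symmetric] mult_ac)
  qed
  also have "\<dots> = ennreal (c ^ DIM('a)) * (ennreal (c powr (- (real DIM('a) + \<alpha>)) * a) * kernel_mass \<alpha> TYPE('a) 1 1)"
    unfolding kernel_mass_def by (subst nn_integral_cmult) auto
  also have "\<dots> = ennreal (a powr (1 - \<alpha>) * L powr \<alpha>) * kernel_mass \<alpha> TYPE('a) 1 1"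
  proof -
    have "c ^ DIM('a) * (c powr (- (real DIM('a) + \<alpha>)) * a) = c powr (real DIM('a)) * c powr (- (real DIM('a) + \<alpha>)) * a"
      using c by (simp add: powr_realpow)
    also have "\<dots> = c powr (- \<alpha>) * a" using c by (simp add: powr_add[symmetric])
    also have "\<dots> = a powr (1 - \<alpha>) * L powr \<alpha>"
      using a L by (simp add: c_def powr_divide powr_minus powr_diff field_simps)
    finally show ?thesis using c a by (simp add: ennreal_mult[symmetric] mult.assoc[symmetric])
  qed
  finally show ?thesis .
qed

lemma kernel_mass_mono:
  assumes "a \<le> a'" "L \<le> L'"
  shows "kernel_mass \<alpha> TYPE('a::euclidean_space) a L \<le> kernel_mass \<alpha> TYPE('a) a' L'"
  unfolding kernel_mass_def using assms
  by (intro nn_integral_mono mult_left_mono ennreal_leI min.mono mult_right_mono) auto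

lemma kernel_mass_finite:
  assumes "0 < \<alpha>" "\<alpha> < 1"
  shows "kernel_mass \<alpha> TYPE('a::euclidean_space) a L < \<infinity>"
proof -
  have "kernel_mass \<alpha> TYPE('a) a L \<le> kernel_mass \<alpha> TYPE('a) (max a 1) (max L 1)"
    by (rule kernel_mass_mono) auto
  also have "\<dots> < \<infinity>"
    using kernel_mass_unit_finite[OF assms, where 'a='a]
    by (subst kernel_mass_scale) (auto simp: ennreal_mult_less_top less_top)
  finally show ?thesis .
qed

lemma kernel_mass_tendsto_0:
  assumes \<alpha>: "0 < \<alpha>" "\<alpha> < 1" and a: "\<And>k::nat. 0 < a k" and L: "\<And>k. 0 < L k"
    and lim: "(\<lambda>k. a k powr (1 - \<alpha>) * L k powr \<alpha>) \<longlonglongrightarrow> 0"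
  shows "(\<lambda>k. kernel_mass \<alpha> TYPE('a::euclidean_space) (a k) (L k)) \<longlonglongrightarrow> 0"
proof -
  obtain m where m: "kernel_mass \<alpha> TYPE('a) 1 1 = ennreal m" "0 \<le> m"
    using kernel_mass_unit_finite[OF \<alpha>, where 'a='a] by (cases "kernel_mass \<alpha> TYPE('a) 1 1") auto
  have "(\<lambda>k. ennreal ((a k powr (1 - \<alpha>) * L k powr \<alpha>) * m)) \<longlonglongrightarrow> ennreal (0 * m)"
    by (intro tendsto_ennrealI tendsto_mult_right lim)
  then show ?thesis
    unfolding kernel_mass_scale[OF a L] m using m(2) by (simp add: ennreal_mult)
qed

section \<open>Seminorm bounds for Lipschitz functions and for products\<close>

lemma shift_diff_le:
  assumes [measurable]: "v \<in> borel_measurable borel"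
  shows "shift_diff v h \<le> 2 * (\<integral>\<^sup>+x. ennreal \<bar>v x\<bar> \<partial>lborel)"
proof -
  have "shift_diff v h \<le> (\<integral>\<^sup>+x. ennreal \<bar>v (h + x)\<bar> + ennreal \<bar>v x\<bar> \<partial>lborel)"
    unfolding shift_diff_def
  proof (rule nn_integral_mono)
    fix x
    have "\<bar>v (x + h) - v x\<bar> \<le> \<bar>v (h + x)\<bar> + \<bar>v x\<bar>" by (simp add: add.commute)
    then show "ennreal \<bar>v (x + h) - v x\<bar> \<le> ennreal \<bar>v (h + x)\<bar> + ennreal \<bar>v x\<bar>"
      by (simp add: ennreal_plus[symmetric] ennreal_leI del: ennreal_plus)
  qed
  also have "\<dots> = (\<integral>\<^sup>+x. ennreal \<bar>v (h + x)\<bar> \<partial>lborel) + (\<integral>\<^sup>+x. ennreal \<bar>v x\<bar> \<partial>lborel)"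
    by (rule nn_integral_add) measurable
  also have "(\<integral>\<^sup>+x. ennreal \<bar>v (h + x)\<bar> \<partial>lborel) = (\<integral>\<^sup>+x. ennreal \<bar>v x\<bar> \<partial>lborel)"
    by (rule nn_integral_lborel_shift[of "\<lambda>x. ennreal \<bar>v x\<bar>"]) measurable
  finally show ?thesis by (simp add: mult_2)
qed

text \<open>An increment by \<open>h\<close> vanishes unless one of the two points lies in the ball,
  hence the factor 2 times its volume; elsewhere the increment is at most the minimum of
  \<open>2 * a\<close> and \<open>L * norm h\<close>.\<close>

lemma gagliardo_Lipschitz_bound:
  fixes v :: "'a::euclidean_space \<Rightarrow> real"
  assumes v: "L-lipschitz_on UNIV v" "\<And>x. \<bar>v x\<bar> \<le> a" "\<And>x. R \<le> norm x \<Longrightarrow> v x = 0"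
  shows "gagliardo \<alpha> v \<le> 2 * emeasure lborel (ball (0::'a) R) * kernel_mass \<alpha> TYPE('a) (2 * a) L"
proof -
  have [measurable]: "v \<in> borel_measurable borel"
    by (intro borel_measurable_continuous_onI lipschitz_on_continuous_on[OF v(1)])
  define B where "B = ball (0::'a) R"
  have [measurable]: "B \<in> sets borel" by (simp add: B_def)
  have L0: "0 \<le> L" by (rule lipschitz_on_nonneg[OF v(1)])
  have a0: "0 \<le> a" using v(2)[of 0] by linarith
  have sd: "shift_diff v h \<le> ennreal (min (2 * a) (L * norm h)) * (2 * emeasure lborel B)" for h
  proof -
    define m where "m = min (2 * a) (L * norm h)"
    have m0: "0 \<le> m" using L0 a0 by (simp add: m_def)
    have "shift_diff v h \<le> (\<integral>\<^sup>+x. ennreal m * indicator B (h + x) + ennreal m * indicator B x \<partial>lborel)"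
      unfolding shift_diff_def
    proof (rule nn_integral_mono)
      fix x
      have 1: "\<bar>v (x + h) - v x\<bar> \<le> m"
        using lipschitz_on_realD(2)[OF v(1), of "x + h" x] v(2)[of "x + h"] v(2)[of x]
        by (auto simp: m_def dist_norm)
      show "ennreal \<bar>v (x + h) - v x\<bar> \<le> ennreal m * indicator B (h + x) + ennreal m * indicator B x"
      proof (cases "x \<in> B \<or> h + x \<in> B")
        case True
        then show ?thesis using 1
          by (auto simp: indicator_def add_increasing add_increasing2 intro: ennreal_leI)
      next
        case False
        then have "v x = 0" "v (x + h) = 0" using v(3) by (auto simp: B_def add.commute)
        then show ?thesis by simp
      qed
    qed
    also have "\<dots> = ennreal m * (\<integral>\<^sup>+x. indicator B (h + x) \<partial>lborel) + ennreal m * emeasure lborel B"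
      by (subst nn_integral_add) (simp_all add: nn_integral_cmult nn_integral_cmult_indicator)
    also have "(\<integral>\<^sup>+x. indicator B (h + x) \<partial>lborel) = emeasure lborel B"
      by (subst nn_integral_lborel_shift) simp_all
    also have "ennreal m * emeasure lborel B + ennreal m * emeasure lborel B = ennreal m * (2 * emeasure lborel B)"
      by (simp only: mult_2 distrib_left)
    finally show ?thesis unfolding m_def .
  qed
  have "gagliardo \<alpha> v \<le> (\<integral>\<^sup>+h. (2 * emeasure lborel B) * (ennreal (frac_kernel \<alpha> (h::'a)) * ennreal (min (2 * a) (L * norm h))) \<partial>lborel)"
    unfolding gagliardo_eq_shift[OF \<open>v \<in> borel_measurable borel\<close>]
  proof (rule nn_integral_mono)
    fix h :: 'a
    show "ennreal (frac_kernel \<alpha> h) * shift_diff v h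
        \<le> 2 * emeasure lborel B * (ennreal (frac_kernel \<alpha> h) * ennreal (min (2 * a) (L * norm h)))"
      using mult_left_mono[OF sd[of h], of "ennreal (frac_kernel \<alpha> h)"] by (simp add: mult_ac)
  qed
  also have "\<dots> = (2 * emeasure lborel B) * kernel_mass \<alpha> TYPE('a) (2 * a) L"
    unfolding kernel_mass_def by (rule nn_integral_cmult) measurable
  finally show ?thesis by (simp add: B_def)
qed

lemma lipc_gagliardo_finite:
  assumes "0 < \<alpha>" "\<alpha> < 1" "v \<in> lipc"
  shows "gagliardo \<alpha> (v :: 'a::euclidean_space \<Rightarrow> real) < \<infinity>"
proof -
  obtain L where L: "L-lipschitz_on UNIV v" using assms(3) by (auto simp: lipc_def)
  obtain a where a: "\<And>x. \<bar>v x\<bar> \<le> a" using lipc_bounded[OF assms(3)] by blast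
  have "bounded {x. v x \<noteq> 0}" using assms(3) by (simp add: lipc_def)
  then obtain R where R: "{x. v x \<noteq> 0} \<subseteq> ball 0 R" using bounded_subset_ballD by blast
  have "gagliardo \<alpha> v \<le> 2 * emeasure lborel (ball (0::'a) R) * kernel_mass \<alpha> TYPE('a) (2 * a) L"
    by (rule gagliardo_Lipschitz_bound[OF L a]) (use R in force)
  also have "\<dots> < \<infinity>"
    using kernel_mass_finite[OF assms(1,2), where 'a='a] emeasure_bounded_finite[of "ball (0::'a) R"]
    by (auto simp: ennreal_mult_less_top less_top)
  finally show ?thesis .
qed

text \<open>The increment of a product is \<open>\<eta> x * (v (x + h) - v x) + (\<eta> (x + h) -
  \<eta> x) * v (x + h)\<close>. The factor \<open>\<eta>\<close> is retained in the first term so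
  that dominated convergence can act on it when \<open>\<eta>\<close> tends to 0 pointwise.\<close>

lemma gagliardo_product:
  fixes v \<eta> :: "'a::euclidean_space \<Rightarrow> real"
  assumes [measurable]: "v \<in> borel_measurable borel"
    and \<eta>: "L-lipschitz_on UNIV \<eta>" "\<And>x. \<bar>\<eta> x\<bar> \<le> b"
  shows "gagliardo \<alpha> (\<lambda>x. v x * \<eta> x) \<le> (\<integral>\<^sup>+x. ennreal \<bar>\<eta> x\<bar> * frac_osc \<alpha> v x \<partial>lborel)
      + (\<integral>\<^sup>+x. ennreal \<bar>v x\<bar> \<partial>lborel) * kernel_mass \<alpha> TYPE('a) (2 * b) L"
proof -
  have [measurable]: "\<eta> \<in> borel_measurable borel"
    by (intro borel_measurable_continuous_onI lipschitz_on_continuous_on[OF \<eta>(1)])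
  have sd: "shift_diff (\<lambda>x. v x * \<eta> x) h \<le> (\<integral>\<^sup>+x. ennreal \<bar>\<eta> x\<bar> * ennreal \<bar>v (x + h) - v x\<bar> \<partial>lborel)
      + ennreal (min (2 * b) (L * norm h)) * (\<integral>\<^sup>+x. ennreal \<bar>v x\<bar> \<partial>lborel)" for h
  proof -
    define m where "m = min (2 * b) (L * norm h)"
    have "shift_diff (\<lambda>x. v x * \<eta> x) h \<le>
        (\<integral>\<^sup>+x. ennreal \<bar>\<eta> x\<bar> * ennreal \<bar>v (x + h) - v x\<bar> + ennreal m * ennreal \<bar>v (h + x)\<bar> \<partial>lborel)"
      unfolding shift_diff_def
    proof (rule nn_integral_mono)
      fix x
      have 1: "\<bar>\<eta> (x + h) - \<eta> x\<bar> \<le> m"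
        using lipschitz_on_realD(2)[OF \<eta>(1), of "x + h" x] \<eta>(2)[of "x + h"] \<eta>(2)[of x]
        by (auto simp: m_def dist_norm)
      then have m0: "0 \<le> m" by linarith
      have "v (x + h) * \<eta> (x + h) - v x * \<eta> x = \<eta> x * (v (x + h) - v x) + (\<eta> (x + h) - \<eta> x) * v (x + h)"
        by (simp add: algebra_simps)
      also have "\<bar>\<dots>\<bar> \<le> \<bar>\<eta> x\<bar> * \<bar>v (x + h) - v x\<bar> + \<bar>\<eta> (x + h) - \<eta> x\<bar> * \<bar>v (x + h)\<bar>"
        using abs_triangle_ineq by (simp add: abs_mult[symmetric])
      also have "\<dots> \<le> \<bar>\<eta> x\<bar> * \<bar>v (x + h) - v x\<bar> + m * \<bar>v (h + x)\<bar>"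
        using mult_right_mono[OF 1, of "\<bar>v (x + h)\<bar>"] by (simp add: add.commute)
      finally show "ennreal \<bar>v (x + h) * \<eta> (x + h) - v x * \<eta> x\<bar> \<le> ennreal \<bar>\<eta> x\<bar> * ennreal \<bar>v (x + h) - v x\<bar> + ennreal m * ennreal \<bar>v (h + x)\<bar>"
        using m0 by (simp add: ennreal_mult[symmetric] ennreal_plus[symmetric] ennreal_leI del: ennreal_plus)
    qed
    also have "\<dots> = (\<integral>\<^sup>+x. ennreal \<bar>\<eta> x\<bar> * ennreal \<bar>v (x + h) - v x\<bar> \<partial>lborel) + ennreal m * (\<integral>\<^sup>+x. ennreal \<bar>v (h + x)\<bar> \<partial>lborel)"
      by (subst nn_integral_add) (simp_all add: nn_integral_cmult)
    also have "(\<integral>\<^sup>+x. ennreal \<bar>v (h + x)\<bar> \<partial>lborel) = (\<integral>\<^sup>+x. ennreal \<bar>v x\<bar> \<partial>lborel)"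
      by (rule nn_integral_lborel_shift[of "\<lambda>x. ennreal \<bar>v x\<bar>"]) measurable
    finally show ?thesis by (simp add: m_def)
  qed
  have "gagliardo \<alpha> (\<lambda>x. v x * \<eta> x) = (\<integral>\<^sup>+h. ennreal (frac_kernel \<alpha> h) * shift_diff (\<lambda>x. v x * \<eta> x) h \<partial>lborel)"
    by (rule gagliardo_eq_shift) measurable
  also have "\<dots> \<le> (\<integral>\<^sup>+h. ennreal (frac_kernel \<alpha> h) * (\<integral>\<^sup>+x. ennreal \<bar>\<eta> x\<bar> * ennreal \<bar>v (x + h) - v x\<bar> \<partial>lborel)
      + (\<integral>\<^sup>+x. ennreal \<bar>v x\<bar> \<partial>lborel) * (ennreal (frac_kernel \<alpha> h) * ennreal (min (2 * b) (L * norm h))) \<partial>lborel)"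
  proof (rule nn_integral_mono)
    fix h
    show "ennreal (frac_kernel \<alpha> h) * shift_diff (\<lambda>x. v x * \<eta> x) h \<le>
      ennreal (frac_kernel \<alpha> h) * (\<integral>\<^sup>+x. ennreal \<bar>\<eta> x\<bar> * ennreal \<bar>v (x + h) - v x\<bar> \<partial>lborel)
      + (\<integral>\<^sup>+x. ennreal \<bar>v x\<bar> \<partial>lborel) * (ennreal (frac_kernel \<alpha> h) * ennreal (min (2 * b) (L * norm h)))"
      using mult_left_mono[OF sd[of h], of "ennreal (frac_kernel \<alpha> h)"] by (simp add: distrib_left mult_ac)
  qed
  also have "\<dots> = (\<integral>\<^sup>+h. ennreal (frac_kernel \<alpha> h) * (\<integral>\<^sup>+x. ennreal \<bar>\<eta> x\<bar> * ennreal \<bar>v (x + h) - v x\<bar> \<partial>lborel) \<partial>lborel)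
      + (\<integral>\<^sup>+x. ennreal \<bar>v x\<bar> \<partial>lborel) * kernel_mass \<alpha> TYPE('a) (2 * b) L"
    unfolding kernel_mass_def by (subst nn_integral_add) (auto simp: nn_integral_cmult)
  finally show ?thesis
    by (subst gagliardo_weighted_eq_shift) auto
qed

section \<open>Ball densities of sets of finite fractional perimeter\<close>

lemma integral_lborel_shift:
  fixes f :: "'a::euclidean_space \<Rightarrow> 'b::euclidean_space"
  assumes [measurable]: "f \<in> borel_measurable borel"
  shows "(LINT y|lborel. f (a + y)) = (LINT y|lborel. f y)"
proof -
  have "(LINT y|lborel. f y) = (LINT y|distr lborel borel (\<lambda>x. a + 1 *\<^sub>R x). f y)"
    using lborel_affine[of 1 a] by (simp add: density_1)
  then show ?thesis by (simp add: integral_distr)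
qed

lemma ball_in_borel [measurable]: "ball (c::'a::metric_space) r \<in> sets borel"
  by simp

text \<open>Convexity: on the unit interval the power lies below its chord.\<close>

lemma one_plus_power_le:
  fixes t :: real assumes "0 \<le> t" "t \<le> 1"
  shows "(1 + t) ^ n \<le> 1 + (2 ^ n - 1) * t"
proof (induction n)
  case (Suc n)
  have "(1 + t) ^ Suc n \<le> (1 + t) * (1 + (2 ^ n - 1) * t)"
    using Suc assms by (simp add: mult_left_mono)
  also have "\<dots> = 1 + 2 ^ n * t + (2 ^ n - 1) * (t * t)" by (simp add: algebra_simps)
  also have "\<dots> \<le> 1 + 2 ^ n * t + (2 ^ n - 1) * (t * 1)"
    using assms by (intro add_left_mono mult_left_mono) auto
  also have "\<dots> = 1 + (2 ^ Suc n - 1) * t" by (simp add: algebra_simps)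
  finally show ?case .
qed simp

definition ball_density :: "'a::euclidean_space set \<Rightarrow> real \<Rightarrow> 'a \<Rightarrow> real" where
  "ball_density E r x = measure lborel (E \<inter> ball x r) / measure lborel (ball x r)"

text \<open>Up to the factor 3^n this is the mean of the L1 modulus of \<open>E\<close> over
  translations shorter than 3r. The radius 3r arises as the largest length of \<open>y - z\<close>
  with \<open>y\<close> in the ball of radius 2r and \<open>z\<close> in the ball of radius
  r.\<close>

definition mean_shift :: "'a::euclidean_space set \<Rightarrow> real \<Rightarrow> ennreal" where
  "mean_shift E r = (\<integral>\<^sup>+w. ennreal (indicat_real (ball 0 (3 * r)) w / measure lborel (ball (0::'a) r))
     * shift_diff (indicat_real E) w \<partial>lborel)"

text \<open>For an indicator function this is half the mean oscillation over the ball, which makes the sum over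
  dyadic radii of its Gagliardo seminorms comparable to the Gagliardo seminorm of \<open>E\<close> itself.\<close>

definition mixing :: "'a::euclidean_space set \<Rightarrow> real \<Rightarrow> 'a \<Rightarrow> real" where
  "mixing E r x = ball_density E r x * (1 - ball_density E r x)"

context
  fixes \<alpha> :: real and E :: "'a::euclidean_space set"
  assumes \<alpha>: "0 < \<alpha>" "\<alpha> < 1"
    and E [measurable]: "E \<in> sets borel" and Efin: "emeasure lborel E < \<infinity>"
    and gE: "gagliardo \<alpha> (indicat_real E) < \<infinity>"
begin

section \<open>Densities as averages of the indicator\<close>

definition ball_weight :: "real \<Rightarrow> 'a \<Rightarrow> real" where
  "ball_weight r y = indicat_real (ball 0 r) y / measure lborel (ball (0::'a) r)"

lemma vol: "0 < r \<Longrightarrow> measure lborel (ball (x::'a) r) = unit_ball_vol DIM('a) * r ^ DIM('a)"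
  by (rule content_ball) simp

lemma vol_pos: "0 < r \<Longrightarrow> 0 < measure lborel (ball (x::'a) r)"
  by (rule content_ball_pos)

lemma weight [measurable, simp]:
  "ball_weight r \<in> borel_measurable borel" "0 \<le> ball_weight r y"
proof -
  show "ball_weight r \<in> borel_measurable borel"
    unfolding ball_weight_def by (intro borel_measurable_divide borel_measurable_indicator borel_measurable_const) simp
  show "0 \<le> ball_weight r y" by (simp add: ball_weight_def)
qed

lemma weight_integral:
  assumes r: "0 < r"
  shows "integrable lborel (ball_weight r)" "(LINT y|lborel. ball_weight r y) = 1"
    "(\<integral>\<^sup>+y. ennreal (ball_weight r y) \<partial>lborel) = 1"
proof -
  have fin: "emeasure lborel (ball (0::'a) r) < \<infinity>" by (rule emeasure_bounded_finite) simp
  show i: "integrable lborel (ball_weight r)"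
    unfolding ball_weight_def using fin by simp
  show e: "(LINT y|lborel. ball_weight r y) = 1"
    unfolding ball_weight_def using vol_pos[OF r, of 0] by simp
  show "(\<integral>\<^sup>+y. ennreal (ball_weight r y) \<partial>lborel) = 1"
    using i e by (simp add: nn_integral_eq_integral)
qed

lemma weight_bounded_integrable:
  fixes f :: "'a \<Rightarrow> real"
  assumes [measurable]: "f \<in> borel_measurable borel" and "\<And>y. \<bar>f y\<bar> \<le> c" and r: "0 < r"
  shows "integrable lborel (\<lambda>y. ball_weight r y * f y)" "integrable lborel (\<lambda>y. ball_weight r (y - h) * f y)"
proof -
  have *: "integrable lborel (\<lambda>y. ball_weight r (y - h) * f y)" for h
  proof (rule Bochner_Integration.integrable_bound[of lborel "\<lambda>y. c * ball_weight r (y - h)"])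
    have "integrable lborel (\<lambda>y. ball_weight r (y - h))"
    proof (rule integrableI_nonneg)
      have "(\<integral>\<^sup>+y. ennreal (ball_weight r (y - h)) \<partial>lborel) = (\<integral>\<^sup>+y. ennreal (ball_weight r y) \<partial>lborel)"
        using nn_integral_lborel_shift[of "\<lambda>y. ennreal (ball_weight r y)" "- h"] by simp
      then show "(\<integral>\<^sup>+y. ennreal (ball_weight r (y - h)) \<partial>lborel) < \<infinity>" using weight_integral(3)[OF r] by simp
    qed auto
    then show "integrable lborel (\<lambda>y. c * ball_weight r (y - h))" by simp
    have "\<bar>ball_weight r (y - h)\<bar> * \<bar>f y\<bar> \<le> \<bar>c * ball_weight r (y - h)\<bar>" for y
      using mult_right_mono[OF assms(2)[of y], of "ball_weight r (y - h)"]
      by (simp add: abs_mult mult.commute) (meson abs_ge_self mult_right_mono order_trans weight(2))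
    then show "AE y in lborel. norm (ball_weight r (y - h) * f y) \<le> norm (c * ball_weight r (y - h))"
      by (simp add: abs_mult)
  qed measurable
  show "integrable lborel (\<lambda>y. ball_weight r (y - h) * f y)" by (rule *)
  show "integrable lborel (\<lambda>y. ball_weight r y * f y)" using *[of 0] by simp
qed

lemma density_eq:
  assumes r: "0 < r"
  shows "ball_density E r x = (LINT y|lborel. ball_weight r y * indicat_real E (x + y))"
proof -
  have "(LINT y|lborel. ball_weight r y * indicat_real E (x + y)) = (LINT y|lborel. ball_weight r ((x + y) - x) * indicat_real E (x + y))"
    by simp
  also have "\<dots> = (LINT y|lborel. ball_weight r (y - x) * indicat_real E y)"
    by (rule integral_lborel_shift) measurable
  also have "\<dots> = (LINT y|lborel. indicat_real (E \<inter> ball x r) y / measure lborel (ball (0::'a) r))"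
    by (intro Bochner_Integration.integral_cong)
      (auto simp: ball_weight_def indicator_def dist_norm norm_minus_commute)
  also have "\<dots> = measure lborel (E \<inter> ball x r) / measure lborel (ball (0::'a) r)" by simp
  also have "measure lborel (ball (0::'a) r) = measure lborel (ball x r)" using vol[OF r] by simp
  finally show ?thesis by (simp add: ball_density_def)
qed

lemma density_bounds:
  assumes r: "0 < r" shows "0 \<le> ball_density E r x" "ball_density E r x \<le> 1"
proof -
  show "0 \<le> ball_density E r x" by (simp add: ball_density_def)
  have "measure lborel (E \<inter> ball x r) \<le> measure lborel (ball x r)"
    using emeasure_bounded_finite[of "ball x r"]
    by (intro measure_mono_fmeasurable) (auto simp: fmeasurable_def)
  then show "ball_density E r x \<le> 1" using vol_pos[OF r, of x] by (simp add: ball_density_def)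
qed

text \<open>For \<open>norm h \<le> r\<close> the symmetric difference of the balls about 0 and
  \<open>h\<close> lies in two shells of inner radius \<open>r\<close> and thickness
  \<open>norm h\<close>. With \<open>t = norm h / r\<close>, each has relative volume (1+t)^n - 1,
  at most 2^n t. For larger \<open>h\<close> the trivial bound 2 is below the right side.\<close>

lemma nn_integral_ball_symmetric_difference:
  fixes h :: 'a
  assumes r: "0 < r"
  shows "(\<integral>\<^sup>+y. ennreal \<bar>ball_weight r (y - h) - ball_weight r y\<bar> \<partial>lborel) \<le> ennreal (2 ^ (DIM('a) + 1) * norm h / r)"
proof (cases "norm h \<le> r")
  case True
  define n where "n = DIM('a)"
  define V where "V = unit_ball_vol (real n)"
  have V: "0 < V" by (simp add: V_def unit_ball_vol_pos)
  define R where "R = r + norm h"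
  define t where "t = norm h / r"
  have t: "0 \<le> t" "t \<le> 1" using True r by (auto simp: t_def)
  have R0: "0 < R" using r by (simp add: R_def add_pos_nonneg)
  have sub: "ball h r \<subseteq> ball 0 R" "ball 0 r \<subseteq> ball h R" "ball 0 r \<subseteq> ball (0::'a) R" "ball h r \<subseteq> ball h R"
    by (auto simp: R_def dist_norm) (smt (verit) norm_triangle_ineq4 norm_minus_commute norm_triangle_ineq2 norm_ge_zero)+
  have em: "emeasure lborel (ball c R - ball c r) = ennreal (V * R ^ n - V * r ^ n)" for c :: 'a
  proof -
    have "emeasure lborel (ball c R - ball c r) = emeasure lborel (ball c R) - emeasure lborel (ball c r)"
    proof (rule emeasure_Diff)
      show "emeasure lborel (ball c r) \<noteq> \<infinity>" using emeasure_bounded_finite[of "ball c r"] by simp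
      show "ball c r \<subseteq> ball c R" by (rule subset_ball) (simp add: R_def)
    qed auto
    also have "\<dots> = ennreal (V * R ^ n) - ennreal (V * r ^ n)"
      using r R0 by (simp add: emeasure_ball V_def n_def)
    also have "\<dots> = ennreal (V * R ^ n - V * r ^ n)"
      using V r by (intro ennreal_minus) auto
    finally show ?thesis .
  qed
  define v where "v = measure lborel (ball (0::'a) r)"
  have v: "v = V * r ^ n" "0 < v" using vol[OF r, of 0] V r by (auto simp: v_def V_def n_def)
  have "(\<integral>\<^sup>+y. ennreal \<bar>ball_weight r (y - h) - ball_weight r y\<bar> \<partial>lborel)
      \<le> (\<integral>\<^sup>+y. ennreal (1 / v) * indicator (ball 0 R - ball 0 r) y + ennreal (1 / v) * indicator (ball h R - ball h r) y \<partial>lborel)"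
  proof (rule nn_integral_mono)
    fix y
    have e: "y - h \<in> ball 0 r \<longleftrightarrow> y \<in> ball h r" by (simp add: dist_norm norm_minus_commute)
    show "ennreal \<bar>ball_weight r (y - h) - ball_weight r y\<bar> \<le>
      ennreal (1 / v) * indicator (ball 0 R - ball 0 r) y + ennreal (1 / v) * indicator (ball h R - ball h r) y"
    proof (cases "y \<in> ball h r")
      case True
      then have "y \<in> ball 0 R" using sub(1) by blast
      then show ?thesis using True e v(2)
        by (cases "y \<in> ball 0 r") (auto simp: ball_weight_def v_def[symmetric] indicator_def)
    next
      case False
      show ?thesis
      proof (cases "y \<in> ball 0 r")
        case True
        then have "y \<in> ball h R" using sub(2) by blast
        then show ?thesis using True False e v(2)
          by (auto simp: ball_weight_def v_def[symmetric] indicator_def)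
      next
        case False2: False
        then show ?thesis using False e by (simp add: ball_weight_def)
      qed
    qed
  qed
  also have "\<dots> = ennreal (1 / v) * ennreal (V * R ^ n - V * r ^ n) + ennreal (1 / v) * ennreal (V * R ^ n - V * r ^ n)"
    by (subst nn_integral_add) (simp_all add: nn_integral_cmult_indicator em)
  also have "\<dots> = ennreal (2 * ((V * R ^ n - V * r ^ n) / v))"
  proof -
    have "r ^ n \<le> R ^ n" using r by (intro power_mono) (auto simp: R_def)
    then have "0 \<le> V * R ^ n - V * r ^ n" using V by simp
    then show ?thesis using v(2) by (simp add: ennreal_mult[symmetric] ennreal_plus[symmetric] del: ennreal_plus)
  qed
  also have "\<dots> \<le> ennreal (2 ^ (n + 1) * norm h / r)"
  proof (rule ennreal_leI)
    have "R = r * (1 + t)" using r by (simp add: R_def t_def distrib_left)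
    then have "R ^ n = r ^ n * (1 + t) ^ n" by (simp only: power_mult_distrib)
    then have "V * R ^ n - V * r ^ n = v * ((1 + t) ^ n - 1)" by (simp add: v(1) algebra_simps)
    then have "(V * R ^ n - V * r ^ n) / v = (1 + t) ^ n - 1" using v(2) by simp
    also have "\<dots> \<le> (2 ^ n - 1) * t" using one_plus_power_le[OF t, of n] by simp
    also have "\<dots> \<le> 2 ^ n * t" using t by (intro mult_right_mono) auto
    finally have "2 * ((V * R ^ n - V * r ^ n) / v) \<le> 2 * (2 ^ n * t)" by (rule mult_left_mono) simp
    also have "\<dots> = 2 ^ (n + 1) * norm h / r" by (simp add: t_def)
    finally show "2 * ((V * R ^ n - V * r ^ n) / v) \<le> 2 ^ (n + 1) * norm h / r" .
  qed
  finally show ?thesis by (simp add: n_def)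
next
  case False
  have "(\<integral>\<^sup>+y. ennreal \<bar>ball_weight r (y - h) - ball_weight r y\<bar> \<partial>lborel)
     \<le> (\<integral>\<^sup>+y. ennreal (ball_weight r (y - h)) + ennreal (ball_weight r y) \<partial>lborel)"
  proof (rule nn_integral_mono)
    fix y
    have "\<bar>ball_weight r (y - h) - ball_weight r y\<bar> \<le> ball_weight r (y - h) + ball_weight r y"
      using weight(2)[of r "y - h"] weight(2)[of r y] by linarith
    then show "ennreal \<bar>ball_weight r (y - h) - ball_weight r y\<bar> \<le> ennreal (ball_weight r (y - h)) + ennreal (ball_weight r y)"
      by (simp add: ennreal_plus[symmetric] ennreal_leI del: ennreal_plus)
  qed
  also have "\<dots> = (\<integral>\<^sup>+y. ennreal (ball_weight r (- h + y)) \<partial>lborel) + (\<integral>\<^sup>+y. ennreal (ball_weight r y) \<partial>lborel)"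
    by (subst nn_integral_add) simp_all
  also have "\<dots> = 1 + 1"
    using nn_integral_lborel_shift[of "\<lambda>y. ennreal (ball_weight r y)" "- h"] weight_integral(3)[OF r] by simp
  also have "\<dots> = ennreal (2 * 1)" by simp
  also have "\<dots> \<le> ennreal (2 ^ (DIM('a) + 1) * norm h / r)"
  proof (rule ennreal_leI)
    have "(1::real) \<le> 2 ^ DIM('a)" by simp
    moreover have "1 \<le> norm h / r" using False r by simp
    ultimately have "1 * 1 \<le> 2 ^ DIM('a) * (norm h / r)" by (intro mult_mono) auto
    then show "2 * 1 \<le> 2 ^ (DIM('a) + 1) * norm h / r" by simp
  qed
  finally show ?thesis .
qed

text \<open>Both weights have integral one, so a constant \<open>c\<close> may be subtracted from
  the indicator. Taking for \<open>c\<close> a value of the indicator at another point turns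
  increments of the density into oscillations of \<open>E\<close>.\<close>

lemma density_increment:
  assumes r: "0 < r"
  shows "ball_density E r (x + h) - ball_density E r x
    = (LINT y|lborel. (ball_weight r (y - h) - ball_weight r y) * (indicat_real E (x + y) - c))"
    "integrable lborel (\<lambda>y. (ball_weight r (y - h) - ball_weight r y) * (indicat_real E (x + y) - c))"
proof -
  have iw: "integrable lborel (\<lambda>y. ball_weight r (y - h) * (indicat_real E (x + y) - c))"
    "integrable lborel (\<lambda>y. ball_weight r y * (indicat_real E (x + y) - c))"
  proof -
    have m: "(\<lambda>y. indicat_real E (x + y) - c) \<in> borel_measurable borel" by measurable
    have b: "\<bar>indicat_real E (x + y) - c\<bar> \<le> 1 + \<bar>c\<bar>" for y
      using abs_triangle_ineq4[of "indicat_real E (x + y)" c] by (auto simp: indicator_def)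
    show "integrable lborel (\<lambda>y. ball_weight r (y - h) * (indicat_real E (x + y) - c))"
      by (rule weight_bounded_integrable(2)[OF m b r])
    show "integrable lborel (\<lambda>y. ball_weight r y * (indicat_real E (x + y) - c))"
      by (rule weight_bounded_integrable(1)[OF m b r])
  qed
  then show i: "integrable lborel (\<lambda>y. (ball_weight r (y - h) - ball_weight r y) * (indicat_real E (x + y) - c))"
    by (simp add: left_diff_distrib)
  have c1: "integrable lborel (\<lambda>y. ball_weight r y * indicat_real E (x + h + y))" "integrable lborel (\<lambda>y. ball_weight r y * indicat_real E (x + y))"
    by (rule weight_bounded_integrable[where c="1"]; simp add: r indicator_def; measurable)+
  have w: "integrable lborel (\<lambda>y. ball_weight r y * c)" using weight_integral(1)[OF r] by simp
  have "(LINT y|lborel. (ball_weight r (y - h) - ball_weight r y) * (indicat_real E (x + y) - c))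
    = (LINT y|lborel. ball_weight r (y - h) * (indicat_real E (x + y) - c)) - (LINT y|lborel. ball_weight r y * (indicat_real E (x + y) - c))"
    using iw by (simp add: left_diff_distrib)
  also have "(LINT y|lborel. ball_weight r (y - h) * (indicat_real E (x + y) - c)) =
      (LINT y|lborel. ball_weight r ((h + y) - h) * (indicat_real E (x + (h + y)) - c))"
    by (rule integral_lborel_shift[symmetric]) measurable
  also have "\<dots> = (LINT y|lborel. ball_weight r y * indicat_real E (x + h + y) - ball_weight r y * c)"
    by (simp add: add.assoc right_diff_distrib)
  also have "\<dots> = ball_density E r (x + h) - c"
    using c1(1) w weight_integral(2)[OF r] by (simp add: density_eq[OF r])
  also have "(LINT y|lborel. ball_weight r y * (indicat_real E (x + y) - c)) = ball_density E r x - c"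
    using c1(2) w weight_integral(2)[OF r] by (simp add: density_eq[OF r] right_diff_distrib)
  finally show "ball_density E r (x + h) - ball_density E r x
    = (LINT y|lborel. (ball_weight r (y - h) - ball_weight r y) * (indicat_real E (x + y) - c))" by simp
qed

lemma density_increment_le:
  assumes r: "0 < r"
  shows "ennreal \<bar>ball_density E r (x + h) - ball_density E r x\<bar>
    \<le> (\<integral>\<^sup>+y. ennreal \<bar>ball_weight r (y - h) - ball_weight r y\<bar> * ennreal \<bar>indicat_real E (x + y) - c\<bar> \<partial>lborel)"
  using integral_norm_bound_ennreal[OF density_increment(2)[OF r, of h x c]]
  by (simp add: density_increment(1)[OF r, of x h c] abs_mult ennreal_mult)

lemma density_Lipschitz:
  assumes r: "0 < r" shows "(2 ^ (DIM('a) + 1) / r)-lipschitz_on UNIV (ball_density E r)"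
proof (rule lipschitz_onI)
  fix x y :: 'a
  have "ennreal \<bar>ball_density E r (y + (x - y)) - ball_density E r y\<bar>
    \<le> (\<integral>\<^sup>+z. ennreal \<bar>ball_weight r (z - (x - y)) - ball_weight r z\<bar> * ennreal \<bar>indicat_real E (y + z) - 0\<bar> \<partial>lborel)"
    by (rule density_increment_le[OF r])
  also have "\<dots> \<le> (\<integral>\<^sup>+z. ennreal \<bar>ball_weight r (z - (x - y)) - ball_weight r z\<bar> \<partial>lborel)"
    by (rule nn_integral_mono) (simp add: indicator_def)
  also have "\<dots> \<le> ennreal (2 ^ (DIM('a) + 1) * norm (x - y) / r)"
    by (rule nn_integral_ball_symmetric_difference[OF r])
  finally show "dist (ball_density E r x) (ball_density E r y) \<le> 2 ^ (DIM('a) + 1) / r * dist x y"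
    using r by (simp add: dist_norm ennreal_le_iff)
qed (use r in simp)

lemma density_measurable [measurable]:
  assumes "0 < r" shows "ball_density E r \<in> borel_measurable borel"
  by (intro borel_measurable_continuous_onI lipschitz_on_continuous_on[OF density_Lipschitz[OF assms]])

text \<open>Integrating in \<open>x\<close> first turns each pair \<open>y\<close>, \<open>z\<close>
  into the L1 modulus at \<open>y - z\<close>, a vector shorter than 3r. The weight \<open>a\<close>
  is the ball weight itself in the L1 estimate and the difference of two translated ball weights in
  the estimate of increments; both live in radius 2r.\<close>

lemma mean_oscillation_bound:
  fixes a :: "'a \<Rightarrow> ennreal"
  assumes r: "0 < r" and [measurable]: "a \<in> borel_measurable borel"
    and supp: "\<And>y. a y \<noteq> 0 \<Longrightarrow> norm y < 2 * r"
  shows "(\<integral>\<^sup>+x. (\<integral>\<^sup>+z. (\<integral>\<^sup>+y. ennreal (ball_weight r z) * (a y * ennreal \<bar>indicat_real E (x + y) - indicat_real E (x + z)\<bar>) \<partial>lborel) \<partial>lborel) \<partial>lborel)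
    \<le> (\<integral>\<^sup>+y. a y \<partial>lborel) * mean_shift E r"
proof -
  have "(\<integral>\<^sup>+x. (\<integral>\<^sup>+z. (\<integral>\<^sup>+y. ennreal (ball_weight r z) * (a y * ennreal \<bar>indicat_real E (x + y) - indicat_real E (x + z)\<bar>) \<partial>lborel) \<partial>lborel) \<partial>lborel)
    = (\<integral>\<^sup>+z. (\<integral>\<^sup>+x. (\<integral>\<^sup>+y. ennreal (ball_weight r z) * (a y * ennreal \<bar>indicat_real E (x + y) - indicat_real E (x + z)\<bar>) \<partial>lborel) \<partial>lborel) \<partial>lborel)"
    by (rule lborel_pair.Fubini') measurable
  also have "\<dots> = (\<integral>\<^sup>+z. (\<integral>\<^sup>+y. (\<integral>\<^sup>+x. ennreal (ball_weight r z) * (a y * ennreal \<bar>indicat_real E (x + y) - indicat_real E (x + z)\<bar>) \<partial>lborel) \<partial>lborel) \<partial>lborel)"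
    by (intro nn_integral_cong lborel_pair.Fubini') measurable
  also have "\<dots> = (\<integral>\<^sup>+y. (\<integral>\<^sup>+z. (\<integral>\<^sup>+x. ennreal (ball_weight r z) * (a y * ennreal \<bar>indicat_real E (x + y) - indicat_real E (x + z)\<bar>) \<partial>lborel) \<partial>lborel) \<partial>lborel)"
    by (rule lborel_pair.Fubini') measurable
  also have "\<dots> = (\<integral>\<^sup>+y. a y * (\<integral>\<^sup>+z. ennreal (ball_weight r z) * shift_diff (indicat_real E) (y - z) \<partial>lborel) \<partial>lborel)"
  proof (rule nn_integral_cong)
    fix y
    have *: "(\<integral>\<^sup>+x. ennreal (ball_weight r z) * (a y * ennreal \<bar>indicat_real E (x + y) - indicat_real E (x + z)\<bar>) \<partial>lborel)
      = a y * (ennreal (ball_weight r z) * shift_diff (indicat_real E) (y - z))" for z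
    proof -
      have "(\<integral>\<^sup>+x. ennreal (ball_weight r z) * (a y * ennreal \<bar>indicat_real E (x + y) - indicat_real E (x + z)\<bar>) \<partial>lborel)
        = (ennreal (ball_weight r z) * a y) * (\<integral>\<^sup>+x. ennreal \<bar>indicat_real E (x + y) - indicat_real E (x + z)\<bar> \<partial>lborel)"
        by (subst nn_integral_cmult[symmetric]) (auto simp: mult_ac)
      also have "(\<integral>\<^sup>+x. ennreal \<bar>indicat_real E (x + y) - indicat_real E (x + z)\<bar> \<partial>lborel)
        = (\<integral>\<^sup>+x. ennreal \<bar>indicat_real E ((z + x) + (y - z)) - indicat_real E (z + x)\<bar> \<partial>lborel)"
        by (simp add: add.commute)
      also have "\<dots> = shift_diff (indicat_real E) (y - z)"
        unfolding shift_diff_def by (rule nn_integral_lborel_shift) measurable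
      finally show ?thesis by (simp add: mult_ac)
    qed
    show "(\<integral>\<^sup>+z. (\<integral>\<^sup>+x. ennreal (ball_weight r z) * (a y * ennreal \<bar>indicat_real E (x + y) - indicat_real E (x + z)\<bar>) \<partial>lborel) \<partial>lborel)
      = a y * (\<integral>\<^sup>+z. ennreal (ball_weight r z) * shift_diff (indicat_real E) (y - z) \<partial>lborel)"
    proof -
      have [measurable]: "shift_diff (indicat_real E) \<in> borel_measurable borel"
        by (rule shift_diff_measurable) measurable
      show ?thesis unfolding * by (rule nn_integral_cmult) measurable
    qed
  qed
  also have "\<dots> \<le> (\<integral>\<^sup>+y. a y * mean_shift E r \<partial>lborel)"
  proof (rule nn_integral_mono)
    fix y
    show "a y * (\<integral>\<^sup>+z. ennreal (ball_weight r z) * shift_diff (indicat_real E) (y - z) \<partial>lborel) \<le> a y * mean_shift E r"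
    proof (cases "a y = 0")
      case False
      then have y: "norm y < 2 * r" by (rule supp)
      have "(\<integral>\<^sup>+z. ennreal (ball_weight r z) * shift_diff (indicat_real E) (y - z) \<partial>lborel)
        \<le> (\<integral>\<^sup>+z. ennreal (indicat_real (ball 0 (3 * r)) (y - z) / measure lborel (ball (0::'a) r)) * shift_diff (indicat_real E) (y - z) \<partial>lborel)"
      proof (intro nn_integral_mono mult_right_mono ennreal_leI)
        fix z
        show "ball_weight r z \<le> indicat_real (ball 0 (3 * r)) (y - z) / measure lborel (ball (0::'a) r)"
          unfolding ball_weight_def
        proof (rule divide_right_mono)
          show "indicat_real (ball 0 r) z \<le> indicat_real (ball 0 (3 * r)) (y - z)"
            using y norm_triangle_ineq4[of y z] by (auto simp: indicator_def)
        qed simp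
      qed simp
      also have "\<dots> = mean_shift E r"
        unfolding mean_shift_def by (rule nn_integral_lborel_reflect) measurable
      finally show ?thesis by (rule mult_left_mono) simp
    qed simp
  qed
  also have "\<dots> = (\<integral>\<^sup>+y. a y \<partial>lborel) * mean_shift E r"
    by (rule nn_integral_multc) measurable
  finally show ?thesis .
qed

section \<open>Size and regularity of the mixing at a fixed scale\<close>

lemma mixing_bounds: "0 < r \<Longrightarrow> 0 \<le> mixing E r x" "0 < r \<Longrightarrow> mixing E r x \<le> 1"
  using density_bounds[of r x] by (auto simp: mixing_def mult_le_one)

lemma mixing_increment: "0 < r \<Longrightarrow> \<bar>mixing E r x - mixing E r y\<bar> \<le> \<bar>ball_density E r x - ball_density E r y\<bar>"
proof -
  assume r: "0 < r"
  have "mixing E r x - mixing E r y = (ball_density E r x - ball_density E r y) * (1 - ball_density E r x - ball_density E r y)"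
    by (simp add: mixing_def algebra_simps)
  moreover have "\<bar>1 - ball_density E r x - ball_density E r y\<bar> \<le> 1"
    using density_bounds[OF r, of x] density_bounds[OF r, of y] by (simp add: abs_le_iff)
  ultimately show ?thesis by (simp add: abs_mult mult_left_le)
qed

lemma mixing_Lipschitz:
  assumes r: "0 < r" shows "(2 ^ (DIM('a) + 1) / r)-lipschitz_on UNIV (mixing E r)"
proof (rule lipschitz_onI)
  fix x y :: 'a
  show "dist (mixing E r x) (mixing E r y) \<le> 2 ^ (DIM('a) + 1) / r * dist x y"
    using mixing_increment[OF r, of x y] lipschitz_on_realD(2)[OF density_Lipschitz[OF r], of x y]
    by (simp add: dist_real_def)
qed (use r in simp)

lemma mixing_measurable [measurable]:
  assumes "0 < r" shows "mixing E r \<in> borel_measurable borel"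
  by (intro borel_measurable_continuous_onI lipschitz_on_continuous_on[OF mixing_Lipschitz[OF assms]])

text \<open>The product is a double average over pairs with \<open>x + y\<close> in \<open>E\<close>
  and \<open>x + z\<close> outside \<open>E\<close>, and for such pairs the two indicators differ by
  1.\<close>

lemma mixing_L1:
  assumes r: "0 < r"
  shows "(\<integral>\<^sup>+x. ennreal (mixing E r x) \<partial>lborel) \<le> mean_shift E r"
proof -
  have "(\<integral>\<^sup>+x. ennreal (mixing E r x) \<partial>lborel) \<le>
    (\<integral>\<^sup>+x. (\<integral>\<^sup>+z. (\<integral>\<^sup>+y. ennreal (ball_weight r z) * (ennreal (ball_weight r y) * ennreal \<bar>indicat_real E (x + y) - indicat_real E (x + z)\<bar>) \<partial>lborel) \<partial>lborel) \<partial>lborel)"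
  proof (rule nn_integral_mono)
    fix x
    have i: "integrable lborel (\<lambda>y. ball_weight r y * indicat_real E (x + y))"
      by (rule weight_bounded_integrable[where c="1"]; simp add: r indicator_def; measurable)
    have i2: "integrable lborel (\<lambda>y. ball_weight r y * (1 - indicat_real E (x + y)))"
      using i weight_integral(1)[OF r] by (simp add: right_diff_distrib)
    have 1: "ennreal (ball_density E r x) = (\<integral>\<^sup>+y. ennreal (ball_weight r y * indicat_real E (x + y)) \<partial>lborel)"
      unfolding density_eq[OF r] by (rule nn_integral_eq_integral[OF i, symmetric]) simp
    have 2: "ennreal (1 - ball_density E r x) = (\<integral>\<^sup>+z. ennreal (ball_weight r z * (1 - indicat_real E (x + z))) \<partial>lborel)"
    proof -
      have "1 - ball_density E r x = (LINT y|lborel. ball_weight r y * (1 - indicat_real E (x + y)))"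
        using i weight_integral(1,2)[OF r] by (simp add: density_eq[OF r] right_diff_distrib)
      then show ?thesis
        using nn_integral_eq_integral[OF i2] by (simp add: indicator_le_1)
    qed
    have "ennreal (mixing E r x) = ennreal (1 - ball_density E r x) * ennreal (ball_density E r x)"
      using density_bounds[OF r, of x] by (simp add: mixing_def ennreal_mult[symmetric] mult.commute)
    also have "\<dots> = (\<integral>\<^sup>+z. ennreal (ball_weight r z * (1 - indicat_real E (x + z))) * (\<integral>\<^sup>+y. ennreal (ball_weight r y * indicat_real E (x + y)) \<partial>lborel) \<partial>lborel)"
      unfolding 1 2 by (rule nn_integral_multc[symmetric]) measurable
    also have "\<dots> = (\<integral>\<^sup>+z. (\<integral>\<^sup>+y. ennreal (ball_weight r z * (1 - indicat_real E (x + z))) * ennreal (ball_weight r y * indicat_real E (x + y)) \<partial>lborel) \<partial>lborel)"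
      by (intro nn_integral_cong nn_integral_cmult[symmetric]) measurable
    also have "\<dots> \<le> (\<integral>\<^sup>+z. (\<integral>\<^sup>+y. ennreal (ball_weight r z) * (ennreal (ball_weight r y) * ennreal \<bar>indicat_real E (x + y) - indicat_real E (x + z)\<bar>) \<partial>lborel) \<partial>lborel)"
      by (intro nn_integral_mono) (auto simp: indicator_def)
    finally show "ennreal (mixing E r x) \<le>
      (\<integral>\<^sup>+z. (\<integral>\<^sup>+y. ennreal (ball_weight r z) * (ennreal (ball_weight r y) * ennreal \<bar>indicat_real E (x + y) - indicat_real E (x + z)\<bar>) \<partial>lborel) \<partial>lborel)" .
  qed
  also have "\<dots> \<le> (\<integral>\<^sup>+y. ennreal (ball_weight r y) \<partial>lborel) * mean_shift E r"
    by (rule mean_oscillation_bound[OF r]) (use r in \<open>auto simp: ball_weight_def indicator_def split: if_splits\<close>)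
  finally show ?thesis using weight_integral(3)[OF r] by simp
qed

text \<open>The density increment is averaged over the subtracted constant, which gives the factor
  \<open>norm h / r\<close> times the mean oscillation. For \<open>norm h > r\<close> the L1 bound
  on the two translates is enough, since 2 is at most 2^(n+1).\<close>

lemma mixing_shift:
  fixes h :: 'a
  assumes r: "0 < r"
  shows "shift_diff (mixing E r) h \<le> ennreal (2 ^ (DIM('a) + 1)) * (ennreal (min 1 (1 / r * norm h)) * mean_shift E r)"
proof (cases "norm h \<le> r")
  case True
  define a where "a y = ennreal \<bar>ball_weight r (y - h) - ball_weight r y\<bar>" for y
  have [measurable]: "a \<in> borel_measurable borel" unfolding a_def by measurable
  have "shift_diff (mixing E r) h \<le>
    (\<integral>\<^sup>+x. (\<integral>\<^sup>+z. (\<integral>\<^sup>+y. ennreal (ball_weight r z) * (a y * ennreal \<bar>indicat_real E (x + y) - indicat_real E (x + z)\<bar>) \<partial>lborel) \<partial>lborel) \<partial>lborel)"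
    unfolding shift_diff_def
  proof (rule nn_integral_mono)
    fix x
    define e where "e = ennreal \<bar>ball_density E r (x + h) - ball_density E r x\<bar>"
    have "ennreal \<bar>mixing E r (x + h) - mixing E r x\<bar> \<le> e"
      unfolding e_def by (intro ennreal_leI mixing_increment r)
    \<comment> \<open>Averaging the constant \<open>e\<close> over \<open>z\<close> costs nothing
      and lets the constant \<open>c\<close> of \<open>density_increment_le\<close> be the indicator
      at \<open>x + z\<close>.\<close>
    also have "e = (\<integral>\<^sup>+z. ennreal (ball_weight r z) * e \<partial>lborel)"
      by (subst nn_integral_multc) (simp_all add: weight_integral(3)[OF r])
    also have "\<dots> \<le> (\<integral>\<^sup>+z. ennreal (ball_weight r z) * (\<integral>\<^sup>+y. a y * ennreal \<bar>indicat_real E (x + y) - indicat_real E (x + z)\<bar> \<partial>lborel) \<partial>lborel)"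
      unfolding e_def a_def by (intro nn_integral_mono mult_left_mono density_increment_le r) simp
    also have "\<dots> = (\<integral>\<^sup>+z. (\<integral>\<^sup>+y. ennreal (ball_weight r z) * (a y * ennreal \<bar>indicat_real E (x + y) - indicat_real E (x + z)\<bar>) \<partial>lborel) \<partial>lborel)"
      by (intro nn_integral_cong nn_integral_cmult[symmetric]) measurable
    finally show "ennreal \<bar>mixing E r (x + h) - mixing E r x\<bar> \<le>
      (\<integral>\<^sup>+z. (\<integral>\<^sup>+y. ennreal (ball_weight r z) * (a y * ennreal \<bar>indicat_real E (x + y) - indicat_real E (x + z)\<bar>) \<partial>lborel) \<partial>lborel)" .
  qed
  also have "\<dots> \<le> (\<integral>\<^sup>+y. a y \<partial>lborel) * mean_shift E r"
  proof (rule mean_oscillation_bound[OF r])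
    fix y assume "a y \<noteq> 0"
    then have "ball_weight r (y - h) \<noteq> 0 \<or> ball_weight r y \<noteq> 0" by (auto simp: a_def)
    then have "norm (y - h) < r \<or> norm y < r" by (auto simp: ball_weight_def indicator_def split: if_splits)
    then show "norm y < 2 * r" using True r norm_triangle_ineq2[of y h] by linarith
  qed measurable
  also have "\<dots> \<le> ennreal (2 ^ (DIM('a) + 1) * norm h / r) * mean_shift E r"
    unfolding a_def by (rule mult_right_mono[OF nn_integral_ball_symmetric_difference[OF r]]) simp
  also have "2 ^ (DIM('a) + 1) * norm h / r = 2 ^ (DIM('a) + 1) * min 1 (1 / r * norm h)"
    using True r by (simp add: min_def)
  also have "ennreal \<dots> = ennreal (2 ^ (DIM('a) + 1)) * ennreal (min 1 (1 / r * norm h))"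
    using r by (intro ennreal_mult) auto
  finally show ?thesis by (simp only: mult.assoc)
next
  case False
  have "shift_diff (mixing E r) h \<le> 2 * (\<integral>\<^sup>+x. ennreal \<bar>mixing E r x\<bar> \<partial>lborel)"
    by (rule shift_diff_le) (use r in measurable)
  also have "\<dots> \<le> 2 * mean_shift E r"
    using mixing_L1[OF r] mixing_bounds[OF r] by (intro mult_left_mono) auto
  also have "\<dots> \<le> ennreal (2 ^ (DIM('a) + 1)) * mean_shift E r"
  proof (rule mult_right_mono)
    have "(2::real) * 1 \<le> 2 * 2 ^ DIM('a)" by (intro mult_left_mono) auto
    then have "ennreal 2 \<le> ennreal (2 ^ (DIM('a) + 1))" by (intro ennreal_leI) simp
    then show "2 \<le> ennreal (2 ^ (DIM('a) + 1))" by simp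
  qed simp
  also have "mean_shift E r = ennreal (min 1 (1 / r * norm h)) * mean_shift E r"
    using False r by (simp add: min_def)
  finally show ?thesis .
qed

text \<open>The factor r^-\<alpha> is the scaling of \<open>kernel_mass\<close> for oscillation 1
  and Lipschitz constant 1/r.\<close>

lemma mixing_gagliardo:
  assumes r: "0 < r"
  shows "gagliardo \<alpha> (mixing E r) \<le> ennreal (2 ^ (DIM('a) + 1) * r powr (- \<alpha>)) * kernel_mass \<alpha> TYPE('a) 1 1 * mean_shift E r"
proof -
  have [measurable]: "mixing E r \<in> borel_measurable borel" using r by measurable
  have "gagliardo \<alpha> (mixing E r) = (\<integral>\<^sup>+h. ennreal (frac_kernel \<alpha> h) * shift_diff (mixing E r) h \<partial>lborel)"
    by (rule gagliardo_eq_shift) measurable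
  also have "\<dots> \<le> (\<integral>\<^sup>+h. (ennreal (2 ^ (DIM('a) + 1)) * mean_shift E r) *
      (ennreal (frac_kernel \<alpha> (h::'a)) * ennreal (min 1 (1 / r * norm h))) \<partial>lborel)"
  proof (rule nn_integral_mono)
    fix h :: 'a
    show "ennreal (frac_kernel \<alpha> h) * shift_diff (mixing E r) h \<le> (ennreal (2 ^ (DIM('a) + 1)) * mean_shift E r) *
      (ennreal (frac_kernel \<alpha> h) * ennreal (min 1 (1 / r * norm h)))"
      using mult_left_mono[OF mixing_shift[OF r, of h], of "ennreal (frac_kernel \<alpha> h)"] by (simp add: mult_ac)
  qed
  also have "\<dots> = (ennreal (2 ^ (DIM('a) + 1)) * mean_shift E r) * kernel_mass \<alpha> TYPE('a) 1 (1 / r)"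
    unfolding kernel_mass_def by (rule nn_integral_cmult) measurable
  also have "kernel_mass \<alpha> TYPE('a) 1 (1 / r) = ennreal (r powr (- \<alpha>)) * kernel_mass \<alpha> TYPE('a) 1 1"
  proof -
    have "(1 / r) powr \<alpha> = r powr (- \<alpha>)" using r by (simp add: powr_divide powr_minus_divide)
    then show ?thesis using r by (subst kernel_mass_scale) simp_all
  qed
  finally show ?thesis by (simp add: ennreal_mult mult_ac)
qed

section \<open>Summation over dyadic radii\<close>

lemma geometric_indicator_sum:
  fixes q X :: real
  assumes q: "1 < q" and s: "0 < s" "q = 2 powr s"
  shows "(\<Sum>k<N. (if 2 ^ k < X then q ^ k else 0)) \<le> q / (q - 1) * X powr s"
proof (induction N)
  case 0
  then show ?case using q by simp
next
  case (Suc N)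
  show ?case
  \<comment> \<open>If the last index contributes, the full geometric sum is at most
    \<open>q / (q - 1)\<close> times its last term \<open>q ^ N\<close>, which is at most
    \<open>X powr s\<close>; otherwise nothing is added.\<close>
  proof (cases "2 ^ N < X")
    case True
    have "(\<Sum>k<Suc N. (if 2 ^ k < X then q ^ k else 0)) \<le> (\<Sum>k<Suc N. q ^ k)"
      using q by (intro sum_mono) auto
    also have "\<dots> = (q ^ Suc N - 1) / (q - 1)" by (rule geometric_sum) (use q in simp)
    also have "\<dots> \<le> q / (q - 1) * q ^ N" using q by (simp add: field_simps)
    finally have A: "(\<Sum>k<Suc N. (if 2 ^ k < X then q ^ k else 0)) \<le> q / (q - 1) * q ^ N" .
    have "q ^ N = (2 ^ N) powr s"
      unfolding s(2) by (simp add: powr_power powr_realpow[symmetric] powr_powr mult.commute)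
    also have "\<dots> \<le> X powr s" using True s by (intro powr_mono2) auto
    finally have B: "q ^ N \<le> X powr s" .
    have "q / (q - 1) * q ^ N \<le> q / (q - 1) * X powr s" by (rule mult_left_mono[OF B]) (use q in simp)
    with A show ?thesis by (rule order_trans)
  next
    case False
    then show ?thesis using Suc by simp
  qed
qed

lemma shift_diff_0 [simp]: "shift_diff v 0 = 0"
  by (simp add: shift_diff_def)

text \<open>After exchanging sum and integral, the radii that see a given \<open>w\<close> are those
  with \<open>norm w < 3 / 2 ^ k\<close>. The factors \<open>q ^ k\<close>, with \<open>q\<close>
  equal to 2 to the power n + \<alpha>, sum over them to at most a multiple of the kernel at
  \<open>w\<close>. This is where the finite seminorm of \<open>E\<close> enters the capacity
  estimate.\<close>

lemma mean_shift_sum: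
  "(\<Sum>k. ennreal ((1 / 2 ^ k) powr (- \<alpha>)) * mean_shift E (1 / 2 ^ k)) < \<infinity>"
proof -
  define n where "n = DIM('a)"
  define s where "s = real n + \<alpha>"
  define V where "V = unit_ball_vol (real n)"
  define q where "q = 2 powr s"
  have V: "0 < V" by (simp add: V_def unit_ball_vol_pos)
  have s0: "0 < s" using \<alpha> by (simp add: s_def)
  have q1: "1 < q" unfolding q_def using s0 by simp
  \<comment> \<open>The geometric series gives \<open>q / (q - 1)\<close>, the radius 3 in
    \<open>mean_shift\<close> gives \<open>3 powr s\<close>, and \<open>V\<close> is the volume of
    the unit ball.\<close>
  define C where "C = q / (q - 1) * 3 powr s / V"
  have C0: "0 \<le> C" using q1 V by (simp add: C_def)
  have eq: "ennreal ((1 / 2 ^ k) powr (- \<alpha>)) * mean_shift E (1 / 2 ^ k)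
      = (\<integral>\<^sup>+w. ennreal (q ^ k / V * indicat_real (ball (0::'a) (3 / 2 ^ k)) w) * shift_diff (indicat_real E) w \<partial>lborel)" for k
  proof -
    have c: "(1 / 2 ^ k) powr (- \<alpha>) / (V * (1 / 2 ^ k) ^ n) = q ^ k / V"
    proof -
      have "(1 / 2 ^ k) powr (- \<alpha>) / (1 / 2 ^ k) ^ n = (2 powr real k) powr \<alpha> * (2 powr real k) ^ n"
        by (simp add: powr_minus powr_divide powr_realpow power_divide field_simps)
      also have "\<dots> = 2 powr (real k * \<alpha> + real n * real k)"
        unfolding powr_powr by (subst powr_power) (simp_all add: powr_add)
      also have "real k * \<alpha> + real n * real k = real k * s" by (simp add: s_def algebra_simps)
      also have "2 powr (real k * s) = q ^ k" unfolding q_def by (rule powr_power[symmetric]) simp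
      finally show ?thesis using V by (simp add: field_simps)
    qed
    have v: "measure lborel (ball (0::'a) (1 / 2 ^ k)) = V * (1 / 2 ^ k) ^ n"
      unfolding V_def n_def by (rule vol) simp
    show ?thesis unfolding mean_shift_def
    proof (subst nn_integral_cmult[symmetric], measurable, rule nn_integral_cong)
      fix w :: 'a
      have "(1 / 2 ^ k) powr (- \<alpha>) * (indicat_real (ball 0 (3 * (1 / 2 ^ k))) w / (V * (1 / 2 ^ k) ^ n))
        = ((1 / 2 ^ k) powr (- \<alpha>) / (V * (1 / 2 ^ k) ^ n)) * indicat_real (ball 0 (3 / 2 ^ k)) w" by simp
      then show "ennreal ((1 / 2 ^ k) powr - \<alpha>) *
         (ennreal (indicat_real (ball 0 (3 * (1 / 2 ^ k))) w / Sigma_Algebra.measure lborel (ball (0::'a) (1 / 2 ^ k))) * shift_diff (indicat_real E) w) =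
         ennreal (q ^ k / V * indicat_real (ball 0 (3 / 2 ^ k)) w) * shift_diff (indicat_real E) w"
        unfolding v c mult.assoc[symmetric]
        using V by (subst ennreal_mult[symmetric]) (auto intro!: divide_nonneg_nonneg)
    qed
  qed
  have "(\<Sum>k. ennreal ((1 / 2 ^ k) powr (- \<alpha>)) * mean_shift E (1 / 2 ^ k))
      = (\<integral>\<^sup>+w. (\<Sum>k. ennreal (q ^ k / V * indicat_real (ball 0 (3 / 2 ^ k)) w) * shift_diff (indicat_real E) w) \<partial>lborel)"
    unfolding eq by (rule nn_integral_suminf[symmetric]) measurable
  also have "\<dots> \<le> (\<integral>\<^sup>+w. ennreal C * (ennreal (frac_kernel \<alpha> w) * shift_diff (indicat_real E) w) \<partial>lborel)"
  proof (rule nn_integral_mono)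
    fix w :: 'a
    show "(\<Sum>k. ennreal (q ^ k / V * indicat_real (ball 0 (3 / 2 ^ k)) w) * shift_diff (indicat_real E) w)
        \<le> ennreal C * (ennreal (frac_kernel \<alpha> w) * shift_diff (indicat_real E) w)"
    proof (cases "w = 0")
      case False
      have "(\<Sum>k<N. ennreal (q ^ k / V * indicat_real (ball 0 (3 / 2 ^ k)) w)) \<le> ennreal (C * frac_kernel \<alpha> w)" for N
      proof -
        have "(\<Sum>k<N. ennreal (q ^ k / V * indicat_real (ball 0 (3 / 2 ^ k)) w))
            = ennreal (\<Sum>k<N. q ^ k / V * indicat_real (ball 0 (3 / 2 ^ k)) w)"
          using q1 V by (intro sum_ennreal) auto
        also have "(\<Sum>k<N. q ^ k / V * indicat_real (ball 0 (3 / 2 ^ k)) w)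
            = (\<Sum>k<N. (if 2 ^ k < 3 / norm w then q ^ k else 0)) / V"
          unfolding sum_divide_distrib
          by (rule sum.cong) (use False in \<open>auto simp: indicator_def field_simps\<close>)
        also have "\<dots> \<le> (q / (q - 1) * (3 / norm w) powr s) / V"
          using geometric_indicator_sum[OF q1 s0 q_def, of "3 / norm w" N] V by (intro divide_right_mono) auto
        also have "\<dots> = C * frac_kernel \<alpha> w"
          using False by (simp add: C_def frac_kernel_def powr_divide s_def n_def)
        finally show ?thesis by (simp add: ennreal_leI)
      qed
      then have "(\<Sum>k. ennreal (q ^ k / V * indicat_real (ball 0 (3 / 2 ^ k)) w)) \<le> ennreal (C * frac_kernel \<alpha> w)"
        by (intro suminf_le_const summableI) auto
      then have "(\<Sum>k. ennreal (q ^ k / V * indicat_real (ball 0 (3 / 2 ^ k)) w)) * shift_diff (indicat_real E) w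
          \<le> ennreal (C * frac_kernel \<alpha> w) * shift_diff (indicat_real E) w" by (rule mult_right_mono) simp
      then show ?thesis using C0 by (simp add: ennreal_mult mult.assoc)
    qed simp
  qed
  also have "\<dots> = ennreal C * gagliardo \<alpha> (indicat_real E)"
    by (subst gagliardo_eq_shift) (auto intro!: nn_integral_cmult)
  also have "\<dots> < \<infinity>" using gE by (simp add: ennreal_mult_less_top less_top)
  finally show ?thesis .
qed

lemma mixing_gagliardo_summable: "(\<Sum>k. gagliardo \<alpha> (mixing E (1 / 2 ^ k))) < \<infinity>"
proof -
  define m where "m = kernel_mass \<alpha> TYPE('a) 1 1"
  have "(\<Sum>k. gagliardo \<alpha> (mixing E (1 / 2 ^ k)))
      \<le> (\<Sum>k. (ennreal (2 ^ (DIM('a) + 1)) * m) * (ennreal ((1 / 2 ^ k) powr (- \<alpha>)) * mean_shift E (1 / 2 ^ k)))"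
  proof (intro suminf_le summableI)
    fix k :: nat
    show "gagliardo \<alpha> (mixing E (1 / 2 ^ k)) \<le> (ennreal (2 ^ (DIM('a) + 1)) * m) * (ennreal ((1 / 2 ^ k) powr (- \<alpha>)) * mean_shift E (1 / 2 ^ k))"
      using mixing_gagliardo[of "1 / 2 ^ k"] by (simp add: ennreal_mult m_def mult_ac)
  qed
  also have "\<dots> = (ennreal (2 ^ (DIM('a) + 1)) * m) * (\<Sum>k. ennreal ((1 / 2 ^ k) powr (- \<alpha>)) * mean_shift E (1 / 2 ^ k))"
    by (rule ennreal_suminf_cmult)
  also have "\<dots> < \<infinity>"
    using mean_shift_sum kernel_mass_unit_finite[OF \<alpha>, where 'a='a]
    by (auto simp: ennreal_mult_less_top m_def less_top)
  finally show ?thesis .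
qed

lemma mixing_L1_summable: "(\<Sum>k. \<integral>\<^sup>+x. ennreal (mixing E (1 / 2 ^ k) x) \<partial>lborel) < \<infinity>"
proof -
  have "(\<Sum>k. \<integral>\<^sup>+x. ennreal (mixing E (1 / 2 ^ k) x) \<partial>lborel)
      \<le> (\<Sum>k. ennreal ((1 / 2 ^ k) powr (- \<alpha>)) * mean_shift E (1 / 2 ^ k))"
  proof (intro suminf_le summableI)
    fix k :: nat
    \<comment> \<open>The radii are at most 1, so the weights in \<open>mean_shift_sum\<close> are
      at least 1 and that series also dominates the one without weights.\<close>
    have "1 \<le> (2 ^ k) powr \<alpha>" using \<alpha> by (intro ge_one_powr_ge_zero) auto
    then have "1 \<le> (1 / 2 ^ k) powr (- \<alpha>)" by (simp add: powr_minus powr_divide)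
    then have "1 * mean_shift E (1 / 2 ^ k) \<le> ennreal ((1 / 2 ^ k) powr (- \<alpha>)) * mean_shift E (1 / 2 ^ k)"
      by (intro mult_right_mono) (auto simp: ennreal_leI ennreal_1[symmetric] simp del: ennreal_1)
    then show "(\<integral>\<^sup>+x. ennreal (mixing E (1 / 2 ^ k) x) \<partial>lborel) \<le> ennreal ((1 / 2 ^ k) powr (- \<alpha>)) * mean_shift E (1 / 2 ^ k)"
      using mixing_L1[of "1 / 2 ^ k"] by (auto intro: order_trans)
  qed
  also have "\<dots> < \<infinity>" by (rule mean_shift_sum)
  finally show ?thesis .
qed

section \<open>Convergence of the densities to the indicator\<close>

lemma density_L1_distance:
  assumes r: "0 < r"
  shows "(\<integral>\<^sup>+x. ennreal \<bar>ball_density E r x - indicat_real E x\<bar> \<partial>lborel)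
    \<le> ennreal (r powr \<alpha> / unit_ball_vol DIM('a)) * gagliardo \<alpha> (indicat_real E)"
proof -
  define n where "n = DIM('a)"
  define V where "V = unit_ball_vol (real n)"
  have V: "0 < V" by (simp add: V_def unit_ball_vol_pos)
  have "(\<integral>\<^sup>+x. ennreal \<bar>ball_density E r x - indicat_real E x\<bar> \<partial>lborel)
    \<le> (\<integral>\<^sup>+x. (\<integral>\<^sup>+y. ennreal (ball_weight r y) * ennreal \<bar>indicat_real E (x + y) - indicat_real E x\<bar> \<partial>lborel) \<partial>lborel)"
  proof (rule nn_integral_mono)
    fix x
    have i: "integrable lborel (\<lambda>y. ball_weight r y * (indicat_real E (x + y) - indicat_real E x))" "integrable lborel (\<lambda>y. ball_weight r y * indicat_real E (x + y))"
      by (rule weight_bounded_integrable[where c="1"]; simp add: r indicator_def; measurable)+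
    have "ball_density E r x - indicat_real E x = (LINT y|lborel. ball_weight r y * (indicat_real E (x + y) - indicat_real E x))"
      using i(2) weight_integral(1,2)[OF r] by (simp add: density_eq[OF r] right_diff_distrib)
    then show "ennreal \<bar>ball_density E r x - indicat_real E x\<bar> \<le> (\<integral>\<^sup>+y. ennreal (ball_weight r y) * ennreal \<bar>indicat_real E (x + y) - indicat_real E x\<bar> \<partial>lborel)"
      using integral_norm_bound_ennreal[OF i(1)] by (simp add: abs_mult ennreal_mult)
  qed
  also have "\<dots> = (\<integral>\<^sup>+y. (\<integral>\<^sup>+x. ennreal (ball_weight r y) * ennreal \<bar>indicat_real E (x + y) - indicat_real E x\<bar> \<partial>lborel) \<partial>lborel)"
    by (rule lborel_pair.Fubini') measurable
  also have "\<dots> = (\<integral>\<^sup>+y. ennreal (ball_weight r y) * shift_diff (indicat_real E) y \<partial>lborel)"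
    unfolding shift_diff_def by (intro nn_integral_cong nn_integral_cmult) measurable
  also have "\<dots> \<le> (\<integral>\<^sup>+y. ennreal (r powr \<alpha> / V) * (ennreal (frac_kernel \<alpha> y) * shift_diff (indicat_real E) y) \<partial>lborel)"
  proof (rule nn_integral_mono)
    fix y :: 'a
    show "ennreal (ball_weight r y) * shift_diff (indicat_real E) y \<le> ennreal (r powr \<alpha> / V) * (ennreal (frac_kernel \<alpha> y) * shift_diff (indicat_real E) y)"
    proof (cases "y = 0")
      case False
      \<comment> \<open>Within radius \<open>r\<close> the norm is below \<open>r\<close>, so the
        constant weight is dominated by the kernel times \<open>r powr \<alpha>\<close> over the
        unit ball volume.\<close>
      have "ball_weight r y \<le> r powr \<alpha> / V * frac_kernel \<alpha> y"
      proof (cases "norm y < r")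
        case True
        have "norm y powr (real n + \<alpha>) \<le> r powr (real n + \<alpha>)"
          using True \<alpha> by (intro powr_mono2) auto
        also have "\<dots> = r ^ n * r powr \<alpha>" using r by (simp add: powr_add powr_realpow)
        finally have "1 / (V * r ^ n) \<le> r powr \<alpha> / (V * norm y powr (real n + \<alpha>))"
          using V r False by (simp add: divide_simps mult.commute)
        moreover have "ball_weight r y = 1 / (V * r ^ n)"
          using True r by (simp add: ball_weight_def vol V_def n_def)
        ultimately show ?thesis by (simp add: frac_kernel_def n_def)
      next
        case False
        then show ?thesis using V r by (simp add: ball_weight_def)
      qed
      then have "ennreal (ball_weight r y) \<le> ennreal (r powr \<alpha> / V) * ennreal (frac_kernel \<alpha> y)"
        using V by (simp add: ennreal_mult[symmetric] ennreal_leI)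
      then show ?thesis unfolding mult.assoc[symmetric] by (rule mult_right_mono) simp
    qed simp
  qed
  also have "\<dots> = ennreal (r powr \<alpha> / V) * gagliardo \<alpha> (indicat_real E)"
    by (subst gagliardo_eq_shift) (auto intro!: nn_integral_cmult)
  finally show ?thesis by (simp add: V_def n_def)
qed

text \<open>The density is a convolution of the indicator with a probability density, and such a
  convolution does not increase the L1 modulus.\<close>

lemma density_shift_diff:
  assumes r: "0 < r"
  shows "shift_diff (ball_density E r) h \<le> shift_diff (indicat_real E) h"
proof -
  have "shift_diff (ball_density E r) h \<le>
    (\<integral>\<^sup>+x. (\<integral>\<^sup>+y. ennreal (ball_weight r y) * ennreal \<bar>indicat_real E (x + y + h) - indicat_real E (x + y)\<bar> \<partial>lborel) \<partial>lborel)"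
    unfolding shift_diff_def
  proof (rule nn_integral_mono)
    fix x
    have i: "integrable lborel (\<lambda>y. ball_weight r y * (indicat_real E (x + y + h) - indicat_real E (x + y)))"
      "integrable lborel (\<lambda>y. ball_weight r y * indicat_real E (x + y))" "integrable lborel (\<lambda>y. ball_weight r y * indicat_real E (x + h + y))"
      by (rule weight_bounded_integrable[where c="1"]; simp add: r indicator_def; measurable)+
    have "ball_density E r (x + h) - ball_density E r x = (LINT y|lborel. ball_weight r y * (indicat_real E (x + y + h) - indicat_real E (x + y)))"
      using i(2,3) by (simp add: density_eq[OF r] right_diff_distrib add_ac)
    then show "ennreal \<bar>ball_density E r (x + h) - ball_density E r x\<bar> \<le>
        (\<integral>\<^sup>+y. ennreal (ball_weight r y) * ennreal \<bar>indicat_real E (x + y + h) - indicat_real E (x + y)\<bar> \<partial>lborel)"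
      using integral_norm_bound_ennreal[OF i(1)] by (simp add: abs_mult ennreal_mult)
  qed
  also have "\<dots> = (\<integral>\<^sup>+y. (\<integral>\<^sup>+x. ennreal (ball_weight r y) * ennreal \<bar>indicat_real E (x + y + h) - indicat_real E (x + y)\<bar> \<partial>lborel) \<partial>lborel)"
    by (rule lborel_pair.Fubini') measurable
  also have "\<dots> = (\<integral>\<^sup>+y. ennreal (ball_weight r y) * shift_diff (indicat_real E) h \<partial>lborel)"
  proof (rule nn_integral_cong)
    fix y
    have "(\<integral>\<^sup>+x. ennreal (ball_weight r y) * ennreal \<bar>indicat_real E (x + y + h) - indicat_real E (x + y)\<bar> \<partial>lborel)
      = ennreal (ball_weight r y) * (\<integral>\<^sup>+x. ennreal \<bar>indicat_real E (y + x + h) - indicat_real E (y + x)\<bar> \<partial>lborel)"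
      by (subst nn_integral_cmult[symmetric]) (auto simp: add_ac)
    also have "(\<integral>\<^sup>+x. ennreal \<bar>indicat_real E (y + x + h) - indicat_real E (y + x)\<bar> \<partial>lborel) = shift_diff (indicat_real E) h"
      unfolding shift_diff_def by (rule nn_integral_lborel_shift[of "\<lambda>x. ennreal \<bar>indicat_real E (x + h) - indicat_real E x\<bar>"]) measurable
    finally show "(\<integral>\<^sup>+x. ennreal (ball_weight r y) * ennreal \<bar>indicat_real E (x + y + h) - indicat_real E (x + y)\<bar> \<partial>lborel)
      = ennreal (ball_weight r y) * shift_diff (indicat_real E) h" .
  qed
  also have "\<dots> = shift_diff (indicat_real E) h"
    by (subst nn_integral_multc) (simp_all add: weight_integral(3)[OF r])
  finally show ?thesis .
qed

lemma density_L1_tendsto: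
  "(\<lambda>k. \<integral>\<^sup>+x. ennreal \<bar>ball_density E (1 / 2 ^ k) x - indicat_real E x\<bar> \<partial>lborel) \<longlonglongrightarrow> 0"
proof -
  obtain g where g: "gagliardo \<alpha> (indicat_real E) = ennreal g" "0 \<le> g" using gE by (cases "gagliardo \<alpha> (indicat_real E)") auto
  define V where "V = unit_ball_vol (real DIM('a))"
  have V: "0 < V" by (simp add: V_def unit_ball_vol_pos)
  have "(\<lambda>k. 1 / 2 ^ k :: real) \<longlonglongrightarrow> 0" by (rule LIMSEQ_divide_realpow_zero) simp
  then have "(\<lambda>k. (1 / 2 ^ k) powr \<alpha>) \<longlonglongrightarrow> 0 powr \<alpha>"
    by (rule tendsto_powr2) (use \<alpha> in auto)
  then have "(\<lambda>k. (1 / 2 ^ k) powr \<alpha> / V * g) \<longlonglongrightarrow> 0 powr \<alpha> / V * g"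
    by (rule tendsto_mult_right[OF tendsto_divide[OF _ tendsto_const]]) (use V in simp)
  then have lim: "(\<lambda>k. ennreal ((1 / 2 ^ k) powr \<alpha> / V * g)) \<longlonglongrightarrow> 0"
    using tendsto_ennrealI[of _ 0] by simp
  show ?thesis
  proof (rule tendsto_sandwich[OF _ _ tendsto_const lim])
    show "\<forall>\<^sub>F k in sequentially. (\<integral>\<^sup>+x. ennreal \<bar>ball_density E (1 / 2 ^ k) x - indicat_real E x\<bar> \<partial>lborel) \<le> ennreal ((1 / 2 ^ k) powr \<alpha> / V * g)"
    proof (intro always_eventually allI)
      fix k :: nat
      have "ennreal ((1 / 2 ^ k) powr \<alpha> / V * g) = ennreal ((1 / 2 ^ k) powr \<alpha> / V) * ennreal g"
        by (rule ennreal_mult) (use V g in auto)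
      then show "(\<integral>\<^sup>+x. ennreal \<bar>ball_density E (1 / 2 ^ k) x - indicat_real E x\<bar> \<partial>lborel) \<le> ennreal ((1 / 2 ^ k) powr \<alpha> / V * g)"
        using density_L1_distance[of "1 / 2 ^ k"] unfolding g(1) V_def by simp
    qed
  qed auto
qed

text \<open>Dominated convergence in the translation \<open>h\<close>: the modulus of the difference
  is at most twice that of \<open>E\<close>, uniformly in the scale, and tends to 0 for each
  \<open>h\<close> by the convergence in L1.\<close>

lemma density_gagliardo_tendsto:
  "(\<lambda>k. gagliardo \<alpha> (\<lambda>x. ball_density E (1 / 2 ^ k) x - indicat_real E x)) \<longlonglongrightarrow> 0"
proof -
  have [measurable]: "ball_density E (1 / 2 ^ k) \<in> borel_measurable borel" for k by (rule density_measurable) simp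
  define w where "w k x = ball_density E (1 / 2 ^ k) x - indicat_real E x" for k x
  have [measurable]: "w k \<in> borel_measurable borel" for k unfolding w_def by measurable
  have eq: "gagliardo \<alpha> (w k) = (\<integral>\<^sup>+h. ennreal (frac_kernel \<alpha> h) * shift_diff (w k) h \<partial>lborel)" for k
    by (rule gagliardo_eq_shift) measurable
  have sd: "shift_diff (w k) h \<le> 2 * shift_diff (indicat_real E) h" for k h
  proof -
    have "shift_diff (w k) h \<le> (\<integral>\<^sup>+x. ennreal \<bar>ball_density E (1 / 2 ^ k) (x + h) - ball_density E (1 / 2 ^ k) x\<bar> + ennreal \<bar>indicat_real E (x + h) - indicat_real E x\<bar> \<partial>lborel)"
      unfolding shift_diff_def
    proof (rule nn_integral_mono)
      fix x
      have "\<bar>w k (x + h) - w k x\<bar> \<le> \<bar>ball_density E (1 / 2 ^ k) (x + h) - ball_density E (1 / 2 ^ k) x\<bar> + \<bar>indicat_real E (x + h) - indicat_real E x\<bar>"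
        unfolding w_def by linarith
      then show "ennreal \<bar>w k (x + h) - w k x\<bar> \<le> ennreal \<bar>ball_density E (1 / 2 ^ k) (x + h) - ball_density E (1 / 2 ^ k) x\<bar> + ennreal \<bar>indicat_real E (x + h) - indicat_real E x\<bar>"
        by (simp add: ennreal_plus[symmetric] ennreal_leI del: ennreal_plus)
    qed
    also have "\<dots> = shift_diff (ball_density E (1 / 2 ^ k)) h + shift_diff (indicat_real E) h"
      unfolding shift_diff_def by (rule nn_integral_add) measurable
    also have "\<dots> \<le> shift_diff (indicat_real E) h + shift_diff (indicat_real E) h"
      by (intro add_right_mono density_shift_diff) simp
    finally show ?thesis by (simp add: mult_2)
  qed
  have "(\<lambda>k. \<integral>\<^sup>+h. ennreal (frac_kernel \<alpha> h) * shift_diff (w k) h \<partial>lborel) \<longlonglongrightarrow> (\<integral>\<^sup>+h. 0 \<partial>(lborel :: 'a measure))"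
  proof (rule nn_integral_dominated_convergence[where w="\<lambda>h. 2 * (ennreal (frac_kernel \<alpha> h) * shift_diff (indicat_real E) h)"])
    show "AE h in lborel. ennreal (frac_kernel \<alpha> h) * shift_diff (w k) h \<le> 2 * (ennreal (frac_kernel \<alpha> h) * shift_diff (indicat_real E) h)" for k
    proof (rule AE_I2)
      fix h :: 'a
      show "ennreal (frac_kernel \<alpha> h) * shift_diff (w k) h \<le> 2 * (ennreal (frac_kernel \<alpha> h) * shift_diff (indicat_real E) h)"
        using mult_left_mono[OF sd[of k h], of "ennreal (frac_kernel \<alpha> h)"] by (simp add: mult_ac)
    qed
    have "(\<integral>\<^sup>+h. 2 * (ennreal (frac_kernel \<alpha> (h::'a)) * shift_diff (indicat_real E) h) \<partial>lborel) = 2 * gagliardo \<alpha> (indicat_real E)"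
      by (subst gagliardo_eq_shift) (auto intro!: nn_integral_cmult)
    then show "(\<integral>\<^sup>+h. 2 * (ennreal (frac_kernel \<alpha> h) * shift_diff (indicat_real E) h) \<partial>lborel) < \<infinity>"
      using gE by (simp add: ennreal_mult_less_top less_top)
    show "AE h in lborel. (\<lambda>k. ennreal (frac_kernel \<alpha> h) * shift_diff (w k) h) \<longlonglongrightarrow> 0"
    proof (rule AE_I2)
      fix h :: 'a
      have l: "(\<lambda>k. ennreal (frac_kernel \<alpha> h) * (2 * (\<integral>\<^sup>+x. ennreal \<bar>w k x\<bar> \<partial>lborel))) \<longlonglongrightarrow> ennreal (frac_kernel \<alpha> h) * (2 * 0)"
        by (intro ennreal_tendsto_cmult) (use density_L1_tendsto in \<open>auto simp: w_def less_top[symmetric]\<close>)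
      show "(\<lambda>k. ennreal (frac_kernel \<alpha> h) * shift_diff (w k) h) \<longlonglongrightarrow> 0"
      proof (rule tendsto_sandwich[OF _ _ tendsto_const])
        show "(\<lambda>k. ennreal (frac_kernel \<alpha> h) * (2 * (\<integral>\<^sup>+x. ennreal \<bar>w k x\<bar> \<partial>lborel))) \<longlonglongrightarrow> 0" using l by simp
        show "\<forall>\<^sub>F k in sequentially. ennreal (frac_kernel \<alpha> h) * shift_diff (w k) h \<le> ennreal (frac_kernel \<alpha> h) * (2 * (\<integral>\<^sup>+x. ennreal \<bar>w k x\<bar> \<partial>lborel))"
          by (intro always_eventually allI mult_left_mono shift_diff_le) auto
      qed simp
    qed
  qed measurable
  then show ?thesis unfolding eq[symmetric] w_def by simp
qed

end

section \<open>Fractional gradient and fractional divergence\<close>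

lemma frac_grad_integrand_norm:
  fixes x y :: "'a::euclidean_space"
  shows "norm (((v y - v x) / norm (y - x) powr (real DIM('a) + \<alpha> + 1)) *\<^sub>R (y - x)) = \<bar>v x - v y\<bar> * frac_kernel \<alpha> (x - y)"
proof (cases "y = x")
  case False
  define N where "N = norm (y - x)"
  have N: "0 < N" using False by (simp add: N_def)
  have e: "norm (x - y) = N" by (simp add: N_def norm_minus_commute)
  have "N powr (real DIM('a) + \<alpha> + 1) = N powr (real DIM('a) + \<alpha>) * N"
    using N by (simp add: powr_add)
  then show ?thesis
    using N unfolding frac_kernel_def e by (simp add: N_def[symmetric] abs_minus_commute)
qed (simp add: frac_kernel_def)

lemma frac_grad_integrand_measurable:
  assumes [measurable]: "v \<in> borel_measurable borel"
  shows "(\<lambda>y. ((v y - v x) / norm (y - x) powr (real DIM('a) + \<alpha> + 1)) *\<^sub>R (y - x :: 'a::euclidean_space)) \<in> borel_measurable borel"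
  by measurable

lemma frac_grad_eq_lborel:
  assumes "v \<in> borel_measurable borel"
  shows "frac_grad \<alpha> v x = frac_const DIM('a) \<alpha> *\<^sub>R
    (LINT y|lborel. ((v y - v x) / norm (y - x) powr (real DIM('a) + \<alpha> + 1)) *\<^sub>R (y - x :: 'a::euclidean_space))"
  unfolding frac_grad_def using frac_grad_integrand_measurable[OF assms]
  by (subst integral_completion) simp_all

lemma frac_grad_measurable:
  assumes [measurable]: "v \<in> borel_measurable borel"
  shows "frac_grad \<alpha> v \<in> borel_measurable (borel :: 'a::euclidean_space measure)"
proof -
  have "(\<lambda>x. LINT y|lborel. ((v y - v x) / norm (y - x) powr (real DIM('a) + \<alpha> + 1)) *\<^sub>R (y - x)) \<in> borel_measurable (lborel :: 'a measure)"
    by (rule lborel.borel_measurable_lebesgue_integral) measurable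
  then show ?thesis unfolding frac_grad_eq_lborel[OF assms, abs_def] by simp
qed

lemma frac_grad_integrable_at:
  fixes v :: "'a::euclidean_space \<Rightarrow> real"
  assumes "v \<in> borel_measurable borel" "frac_osc \<alpha> v x < \<infinity>"
  shows "integrable lborel (\<lambda>y. ((v y - v x) / norm (y - x) powr (real DIM('a) + \<alpha> + 1)) *\<^sub>R (y - x))"
proof (rule integrableI_bounded)
  show "(\<lambda>y. ((v y - v x) / norm (y - x) powr (real DIM('a) + \<alpha> + 1)) *\<^sub>R (y - x)) \<in> borel_measurable lborel"
    using frac_grad_integrand_measurable[OF assms(1)] by simp
  show "(\<integral>\<^sup>+y. ennreal (norm (((v y - v x) / norm (y - x) powr (real DIM('a) + \<alpha> + 1)) *\<^sub>R (y - x))) \<partial>lborel) < \<infinity>"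
    unfolding frac_grad_integrand_norm using assms(2) by (simp add: frac_osc_def)
qed

lemma frac_grad_norm_le:
  fixes v :: "'a::euclidean_space \<Rightarrow> real"
  assumes v: "v \<in> borel_measurable borel"
  shows "ennreal (norm (frac_grad \<alpha> v x)) \<le> ennreal \<bar>frac_const DIM('a) \<alpha>\<bar> * frac_osc \<alpha> v x"
proof (cases "frac_osc \<alpha> v x < \<infinity>")
  case True
  let ?I = "LINT y|lborel. ((v y - v x) / norm (y - x) powr (real DIM('a) + \<alpha> + 1)) *\<^sub>R (y - x)"
  have "ennreal (norm ?I) \<le> frac_osc \<alpha> v x"
    using integral_norm_bound_ennreal[OF frac_grad_integrable_at[OF v True]]
    unfolding frac_grad_integrand_norm by (simp add: frac_osc_def)
  then have "ennreal \<bar>frac_const DIM('a) \<alpha>\<bar> * ennreal (norm ?I) \<le> ennreal \<bar>frac_const DIM('a) \<alpha>\<bar> * frac_osc \<alpha> v x"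
    by (rule mult_left_mono) simp
  then show ?thesis by (simp add: frac_grad_eq_lborel[OF v] ennreal_mult)
next
  case False
  then have top: "frac_osc \<alpha> v x = top" by (simp add: less_top[symmetric])
  show ?thesis
  \<comment> \<open>In the extended reals \<open>0 * top = 0\<close>, so a vanishing constant has to
    be treated apart; the gradient then vanishes too.\<close>
  proof (cases "frac_const DIM('a) \<alpha> = 0")
    case True
    then show ?thesis by (simp add: frac_grad_def)
  next
    case False
    then show ?thesis unfolding top by (simp add: ennreal_mult_top)
  qed
qed

lemma frac_grad_integrable:
  fixes v :: "'a::euclidean_space \<Rightarrow> real"
  assumes v: "v \<in> borel_measurable borel" and g: "gagliardo \<alpha> v < \<infinity>"
  shows "integrable lborel (frac_grad \<alpha> v)"
    "(\<integral>\<^sup>+x. ennreal (norm (frac_grad \<alpha> v x)) \<partial>lborel) \<le> ennreal \<bar>frac_const DIM('a) \<alpha>\<bar> * gagliardo \<alpha> v"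
proof -
  have "(\<integral>\<^sup>+x. ennreal (norm (frac_grad \<alpha> v x)) \<partial>lborel) \<le> (\<integral>\<^sup>+x. ennreal \<bar>frac_const DIM('a) \<alpha>\<bar> * frac_osc \<alpha> v x \<partial>lborel)"
    by (rule nn_integral_mono) (rule frac_grad_norm_le[OF v])
  also have "\<dots> = ennreal \<bar>frac_const DIM('a) \<alpha>\<bar> * gagliardo \<alpha> v"
    unfolding gagliardo_def using frac_osc_measurable[OF v] by (intro nn_integral_cmult) simp
  finally show le: "(\<integral>\<^sup>+x. ennreal (norm (frac_grad \<alpha> v x)) \<partial>lborel) \<le> ennreal \<bar>frac_const DIM('a) \<alpha>\<bar> * gagliardo \<alpha> v" .
  show "integrable lborel (frac_grad \<alpha> v)"
  proof (rule integrableI_bounded)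
    show "frac_grad \<alpha> v \<in> borel_measurable lborel" using frac_grad_measurable[OF v] by simp
    show "(\<integral>\<^sup>+x. ennreal (norm (frac_grad \<alpha> v x)) \<partial>lborel) < \<infinity>"
      by (rule le_less_trans[OF le]) (use g in \<open>simp add: ennreal_mult_less_top less_top\<close>)
  qed
qed

lemma frac_osc_AE_finite:
  assumes v: "v \<in> borel_measurable borel" and g: "gagliardo \<alpha> v < \<infinity>"
  shows "AE x in lborel. frac_osc \<alpha> v x < \<infinity>"
proof -
  have "AE x in lborel. frac_osc \<alpha> v x \<noteq> \<infinity>"
    by (rule nn_integral_PInf_AE) (use frac_osc_measurable[OF v] g in \<open>auto simp: gagliardo_def\<close>)
  then show ?thesis by eventually_elim (simp add: less_top)
qed

lemma frac_grad_add:
  fixes u v :: "'a::euclidean_space \<Rightarrow> real"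
  assumes u: "u \<in> borel_measurable borel" "gagliardo \<alpha> u < \<infinity>"
    and v: "v \<in> borel_measurable borel" "gagliardo \<alpha> v < \<infinity>"
  shows "AE x in lborel. frac_grad \<alpha> (\<lambda>x. u x + v x) x = frac_grad \<alpha> u x + frac_grad \<alpha> v x"
  using frac_osc_AE_finite[OF u] frac_osc_AE_finite[OF v]
proof eventually_elim
  case (elim x)
  note [measurable] = u(1) v(1)
  have uv: "(\<lambda>x. u x + v x) \<in> borel_measurable borel" by measurable
  show ?case
    unfolding frac_grad_eq_lborel[OF uv] frac_grad_eq_lborel[OF u(1)] frac_grad_eq_lborel[OF v(1)]
    using frac_grad_integrable_at[OF u(1) elim(1)] frac_grad_integrable_at[OF v(1) elim(2)]
    by (simp add: scaleR_add_right[symmetric] scaleR_add_left[symmetric] add_divide_distrib[symmetric]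
        add_diff_add Bochner_Integration.integral_add[symmetric] del: Bochner_Integration.integral_add scaleR_add_right scaleR_add_left)
qed

text \<open>Unlike additivity this holds at every point: where the integral diverges, its default
  value 0 is compatible with scaling.\<close>

lemma frac_grad_cmult: "frac_grad \<alpha> (\<lambda>x. c * v x) x = c *\<^sub>R frac_grad \<alpha> v (x :: 'a::euclidean_space)"
proof -
  have "(\<lambda>y. ((c * v y - c * v x) / norm (y - x) powr (real DIM('a) + \<alpha> + 1)) *\<^sub>R (y - x))
    = (\<lambda>y. c *\<^sub>R (((v y - v x) / norm (y - x) powr (real DIM('a) + \<alpha> + 1)) *\<^sub>R (y - x)))"
    by (simp add: right_diff_distrib[symmetric])
  then show ?thesis unfolding frac_grad_def by (simp only: integral_scaleR_right scaleR_left_commute)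
qed

section \<open>The pairing of a bounded field with fractional gradients\<close>

definition frac_pairing :: "real \<Rightarrow> ('a::euclidean_space \<Rightarrow> 'a) \<Rightarrow> ('a \<Rightarrow> real) \<Rightarrow> real" where
  "frac_pairing \<alpha> F v = (LINT x|lebesgue. F x \<bullet> frac_grad \<alpha> v x)"

lemma frac_pairing_cmult: "frac_pairing \<alpha> F (\<lambda>x. c * v x) = c * frac_pairing \<alpha> F v"
  by (simp add: frac_pairing_def frac_grad_cmult)

context
  fixes \<alpha> :: real and F :: "'a::euclidean_space \<Rightarrow> 'a" and C :: real
  assumes F: "F \<in> borel_measurable lebesgue" and C: "AE x in lebesgue. norm (F x) \<le> C" "0 \<le> C"
begin

lemma frac_pairing_integrable:
  assumes v: "v \<in> borel_measurable borel" "gagliardo \<alpha> v < \<infinity>"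
  shows "integrable lebesgue (\<lambda>x. F x \<bullet> frac_grad \<alpha> v x)"
proof (rule Bochner_Integration.integrable_bound[of lebesgue "\<lambda>x. C * norm (frac_grad \<alpha> v x)"])
  have m: "frac_grad \<alpha> v \<in> borel_measurable lebesgue"
    using frac_grad_measurable[OF v(1), of \<alpha>] by (intro measurable_completion) simp
  have "integrable lebesgue (frac_grad \<alpha> v)"
    using frac_grad_integrable(1)[OF v] frac_grad_measurable[OF v(1), of \<alpha>] by (simp add: integrable_completion)
  then show "integrable lebesgue (\<lambda>x. C * norm (frac_grad \<alpha> v x))" by simp
  show "(\<lambda>x. F x \<bullet> frac_grad \<alpha> v x) \<in> borel_measurable lebesgue"
    by (rule borel_measurable_inner[OF F m])
  show "AE x in lebesgue. norm (F x \<bullet> frac_grad \<alpha> v x) \<le> norm (C * norm (frac_grad \<alpha> v x))"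
    using C(1)
  proof eventually_elim
    case (elim x)
    have "\<bar>F x \<bullet> frac_grad \<alpha> v x\<bar> \<le> norm (F x) * norm (frac_grad \<alpha> v x)" by (rule Cauchy_Schwarz_ineq2)
    also have "\<dots> \<le> C * norm (frac_grad \<alpha> v x)" by (rule mult_right_mono[OF elim]) simp
    finally show ?case using C(2) by (simp add: abs_mult)
  qed
qed

text \<open>Read through the representing measures, this becomes the bound \<open>cap\<close> on
  which the capacity argument rests.\<close>

lemma frac_pairing_le:
  assumes v: "v \<in> borel_measurable borel" "gagliardo \<alpha> v < \<infinity>"
  shows "ennreal \<bar>frac_pairing \<alpha> F v\<bar> \<le> ennreal (C * \<bar>frac_const DIM('a) \<alpha>\<bar>) * gagliardo \<alpha> v"
proof -
  have "ennreal \<bar>frac_pairing \<alpha> F v\<bar> \<le> (\<integral>\<^sup>+x. ennreal (norm (F x \<bullet> frac_grad \<alpha> v x)) \<partial>lebesgue)"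
    using integral_norm_bound_ennreal[OF frac_pairing_integrable[OF v]] by (simp add: frac_pairing_def)
  also have "\<dots> \<le> (\<integral>\<^sup>+x. ennreal C * ennreal (norm (frac_grad \<alpha> v x)) \<partial>lebesgue)"
  proof (rule nn_integral_mono_AE)
    show "AE x in lebesgue. ennreal (norm (F x \<bullet> frac_grad \<alpha> v x)) \<le> ennreal C * ennreal (norm (frac_grad \<alpha> v x))"
      using C(1)
    proof eventually_elim
      case (elim x)
      have "\<bar>F x \<bullet> frac_grad \<alpha> v x\<bar> \<le> norm (F x) * norm (frac_grad \<alpha> v x)" by (rule Cauchy_Schwarz_ineq2)
      also have "\<dots> \<le> C * norm (frac_grad \<alpha> v x)" by (rule mult_right_mono[OF elim]) simp
      finally show ?case using C(2) by (simp add: ennreal_mult[symmetric] ennreal_leI)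
    qed
  qed
  also have "\<dots> = (\<integral>\<^sup>+x. ennreal C * ennreal (norm (frac_grad \<alpha> v x)) \<partial>lborel)"
    by (rule nn_integral_completion)
  also have "\<dots> = ennreal C * (\<integral>\<^sup>+x. ennreal (norm (frac_grad \<alpha> v x)) \<partial>lborel)"
    using frac_grad_measurable[OF v(1), of \<alpha>] by (intro nn_integral_cmult) simp
  also have "\<dots> \<le> ennreal C * (ennreal \<bar>frac_const DIM('a) \<alpha>\<bar> * gagliardo \<alpha> v)"
    by (rule mult_left_mono[OF frac_grad_integrable(2)[OF v]]) simp
  finally show ?thesis using C(2) by (simp add: ennreal_mult mult.assoc)
qed

lemma frac_pairing_add:
  assumes u: "u \<in> borel_measurable borel" "gagliardo \<alpha> u < \<infinity>"
    and v: "v \<in> borel_measurable borel" "gagliardo \<alpha> v < \<infinity>"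
  shows "frac_pairing \<alpha> F (\<lambda>x. u x + v x) = frac_pairing \<alpha> F u + frac_pairing \<alpha> F v"
proof -
  note [measurable] = u(1) v(1)
  have g: "gagliardo \<alpha> (\<lambda>x. u x + v x) < \<infinity>"
    by (rule le_less_trans[OF gagliardo_add[OF u(1) v(1)]]) (use u v in \<open>auto simp: less_top[symmetric]\<close>)
  have uv: "(\<lambda>x. u x + v x) \<in> borel_measurable borel" by measurable
  have "frac_pairing \<alpha> F (\<lambda>x. u x + v x) = (LINT x|lebesgue. F x \<bullet> frac_grad \<alpha> u x + F x \<bullet> frac_grad \<alpha> v x)"
    unfolding frac_pairing_def
  proof (rule integral_cong_AE)
    show "(\<lambda>x. F x \<bullet> frac_grad \<alpha> (\<lambda>x. u x + v x) x) \<in> borel_measurable lebesgue"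
      using frac_pairing_integrable[OF uv g] by auto
    show "(\<lambda>x. F x \<bullet> frac_grad \<alpha> u x + F x \<bullet> frac_grad \<alpha> v x) \<in> borel_measurable lebesgue"
      using frac_pairing_integrable[OF u] frac_pairing_integrable[OF v] by auto
    show "AE x in lebesgue. F x \<bullet> frac_grad \<alpha> (\<lambda>x. u x + v x) x = F x \<bullet> frac_grad \<alpha> u x + F x \<bullet> frac_grad \<alpha> v x"
      using AE_completion[OF frac_grad_add[OF u v]] by eventually_elim (simp add: inner_add_right)
  qed
  also have "\<dots> = frac_pairing \<alpha> F u + frac_pairing \<alpha> F v"
    unfolding frac_pairing_def
    by (rule Bochner_Integration.integral_add[OF frac_pairing_integrable[OF u] frac_pairing_integrable[OF v]])
  finally show ?thesis .
qed

lemma frac_pairing_diff_le: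
  assumes u: "u \<in> borel_measurable borel" "gagliardo \<alpha> u < \<infinity>"
    and v: "v \<in> borel_measurable borel" "gagliardo \<alpha> v < \<infinity>"
  shows "ennreal \<bar>frac_pairing \<alpha> F u - frac_pairing \<alpha> F v\<bar>
    \<le> ennreal (C * \<bar>frac_const DIM('a) \<alpha>\<bar>) * gagliardo \<alpha> (\<lambda>x. u x - v x)"
proof -
  note [measurable] = u(1) v(1)
  have m: "(\<lambda>x. (-1) * v x) \<in> borel_measurable borel" by measurable
  have g: "gagliardo \<alpha> (\<lambda>x. (-1) * v x) < \<infinity>"
    by (rule le_less_trans[OF gagliardo_mono[OF v(1), of _ 1]]) (use v in auto)
  have e: "(\<lambda>x. u x + (-1) * v x) = (\<lambda>x. u x - v x)" by auto
  have "frac_pairing \<alpha> F (\<lambda>x. u x - v x) = frac_pairing \<alpha> F u - frac_pairing \<alpha> F v"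
    using frac_pairing_add[OF u m g] frac_pairing_cmult[of \<alpha> F "-1" v] unfolding e by simp
  moreover have "gagliardo \<alpha> (\<lambda>x. u x - v x) < \<infinity>"
    by (rule le_less_trans[OF gagliardo_add[OF u(1) v(1)]]) (use u v in \<open>auto simp: less_top[symmetric]\<close>)
  ultimately show ?thesis using frac_pairing_le[of "\<lambda>x. u x - v x"] by simp
qed

end

section \<open>Existence and uniqueness of the fractional divergence\<close>

lemma lipc_mollify_seq:
  fixes v :: "'a::euclidean_space \<Rightarrow> real"
  assumes \<alpha>: "0 < \<alpha>" "\<alpha> < 1" and v: "v \<in> lipc" "\<And>x. \<bar>v x\<bar> \<le> M"
  obtains \<xi> d where "\<And>k::nat. \<xi> k \<in> test_functions" "\<And>k x. \<bar>\<xi> k x\<bar> \<le> M" "\<And>k x. \<bar>\<xi> k x - v x\<bar> \<le> d k" "d \<longlonglongrightarrow> 0"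
    "(\<lambda>k. gagliardo \<alpha> (\<lambda>x. \<xi> k x - v x)) \<longlonglongrightarrow> 0"
proof -
  obtain L0 where L0: "L0-lipschitz_on UNIV v" using v(1) by (auto simp: lipc_def)
  \<comment> \<open>The scaling law of \<open>kernel_mass\<close> needs a strictly positive
    Lipschitz constant.\<close>
  define L where "L = L0 + 1"
  have L: "L-lipschitz_on UNIV v" "0 < L"
    using lipschitz_on_le[OF L0, of L] lipschitz_on_nonneg[OF L0] by (auto simp: L_def)
  have "bounded {x. v x \<noteq> 0}" using v(1) by (simp add: lipc_def)
  then obtain R where R: "{x. v x \<noteq> 0} \<subseteq> ball 0 R" using bounded_subset_ballD by blast
  have R': "v x = 0" if "R \<le> norm x" for x
  proof (rule ccontr)
    assume "v x \<noteq> 0"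
    then have "x \<in> ball 0 R" using R by blast
    then show False using that by simp
  qed
  define e where "e k = 1 / real (Suc k)" for k
  have e: "0 < e k" "e k \<le> 1" for k by (auto simp: e_def)
  have e0: "e \<longlonglongrightarrow> 0" unfolding e_def by (rule LIMSEQ_Suc[OF lim_1_over_n])
  have "\<exists>\<xi>. \<xi> \<in> test_functions \<and> (\<forall>x. \<bar>\<xi> x - v x\<bar> \<le> L * e k) \<and> (\<forall>x. \<bar>\<xi> x\<bar> \<le> M) \<and>
      L-lipschitz_on UNIV \<xi> \<and> (\<forall>x. R + e k \<le> norm x \<longrightarrow> \<xi> x = 0)" for k
    by (rule lipc_mollify[OF L(1) v(2) R' e(1)[of k]]) blast+
  then obtain \<xi> where \<xi>: "\<And>k. \<xi> k \<in> test_functions" "\<And>k x. \<bar>\<xi> k x - v x\<bar> \<le> L * e k" "\<And>k x. \<bar>\<xi> k x\<bar> \<le> M"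
    "\<And>k. L-lipschitz_on UNIV (\<xi> k)" "\<And>k x. R + e k \<le> norm x \<Longrightarrow> \<xi> k x = 0" by metis
  define B where "B = emeasure lborel (ball (0::'a) (R + 1))"
  have B: "B < \<infinity>" unfolding B_def by (rule emeasure_bounded_finite) simp
  have gb: "gagliardo \<alpha> (\<lambda>x. \<xi> k x - v x) \<le> 2 * B * kernel_mass \<alpha> TYPE('a) (2 * (L * e k)) (L + L)" for k
    unfolding B_def
  proof (rule gagliardo_Lipschitz_bound)
    show "(L + L)-lipschitz_on UNIV (\<lambda>x. \<xi> k x - v x)"
    proof (rule lipschitz_on_realI)
      fix x y
      show "\<xi> k x - v x - (\<xi> k y - v y) \<le> (L + L) * dist x y"
        using lipschitz_on_realD(2)[OF L(1), of x y] lipschitz_on_realD(2)[OF \<xi>(4), of k x y]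
        by (simp add: distrib_right abs_le_iff)
    qed (use L in simp)
    show "\<bar>\<xi> k x - v x\<bar> \<le> L * e k" for x by (rule \<xi>(2))
    show "\<xi> k x - v x = 0" if "R + 1 \<le> norm x" for x
      using \<xi>(5)[of k x] R'[of x] e(2)[of k] that by simp
  qed
  \<comment> \<open>The sup norms of the errors tend to 0 while their Lipschitz constants stay
    bounded by \<open>L + L\<close>; the positive exponent 1 - \<alpha> on the former makes the mass
    vanish.\<close>
  have "(\<lambda>k. kernel_mass \<alpha> TYPE('a) (2 * (L * e k)) (L + L)) \<longlonglongrightarrow> 0"
  proof (rule kernel_mass_tendsto_0[OF \<alpha>])
    show "0 < 2 * (L * e k)" for k using L e by simp
    show "0 < L + L" using L by simp
    have "(\<lambda>k. (2 * (L * e k)) powr (1 - \<alpha>)) \<longlonglongrightarrow> (2 * (L * 0)) powr (1 - \<alpha>)"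
      by (rule tendsto_powr2[OF tendsto_mult_left[OF tendsto_mult_left[OF e0]] tendsto_const])
        (use \<alpha> L e in \<open>auto intro!: always_eventually less_imp_le[OF mult_pos_pos]\<close>)
    then show "(\<lambda>k. (2 * (L * e k)) powr (1 - \<alpha>) * (L + L) powr \<alpha>) \<longlonglongrightarrow> 0"
      using tendsto_mult_right[of _ "0" sequentially "(L + L) powr \<alpha>"] by simp
  qed
  then have "(\<lambda>k. 2 * B * kernel_mass \<alpha> TYPE('a) (2 * (L * e k)) (L + L)) \<longlonglongrightarrow> 2 * B * 0"
    by (rule ennreal_tendsto_cmult[rotated]) (use B in \<open>simp add: ennreal_mult_less_top less_top\<close>)
  then have lim: "(\<lambda>k. 2 * B * kernel_mass \<alpha> TYPE('a) (2 * (L * e k)) (L + L)) \<longlonglongrightarrow> 0" by simp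
  have "(\<lambda>k. gagliardo \<alpha> (\<lambda>x. \<xi> k x - v x)) \<longlonglongrightarrow> 0"
    by (rule tendsto_sandwich[OF _ _ tendsto_const lim]) (use gb in auto)
  moreover have "(\<lambda>k. L * e k) \<longlonglongrightarrow> 0" using tendsto_mult_left[OF e0, of L] by simp
  ultimately show thesis using that[of \<xi> "\<lambda>k. L * e k"] \<xi> by blast
qed

text \<open>Indicators of boxes are limits of \<open>dist_cutoff\<close>, and boxes form a generator
  stable under intersection. The induction is on the equality of differences, as the individual
  measures need not agree. The step for complements needs the whole space, which is reached by
  exhausting it with boxes.\<close>

lemma finite_signed_eq_of_lipc:
  fixes P N P' N' :: "'a::euclidean_space measure"
  assumes fin: "finite_measure P" "finite_measure N" "finite_measure P'" "finite_measure N'"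
    and s: "sets P = sets borel" "sets N = sets borel" "sets P' = sets borel" "sets N' = sets borel"
    and eq: "\<And>f. f \<in> lipc \<Longrightarrow> (LINT x|P. f x) - (LINT x|N. f x) = (LINT x|P'. f x) - (LINT x|N'. f x)"
    and A: "A \<in> sets borel"
  shows "measure P A - measure N A = measure P' A - measure N' A"
proof -
  have lim: "(\<lambda>k. LINT x|Q. dist_cutoff U k x) \<longlonglongrightarrow> measure Q U"
    if U: "bounded U" "open U" and Q: "finite_measure Q" "sets Q = sets borel" for Q :: "'a measure" and U
  proof -
    interpret Q: finite_measure Q by (rule Q)
    have "(\<lambda>k. LINT x|Q. dist_cutoff U k x) \<longlonglongrightarrow> (LINT x|Q. indicat_real U x)"
    proof (rule integral_dominated_convergence[where w="\<lambda>_. 1"])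
      show "indicat_real U \<in> borel_measurable Q"
        by (rule borel_measurable_indicator) (simp add: Q(2) U(2))
      show "dist_cutoff U k \<in> borel_measurable Q" for k
        using lipc_measurable[OF dist_cutoff(1)[OF U(1)]] by (simp add: measurable_cong_sets[OF Q(2) refl])
      show "AE x in Q. (\<lambda>k. dist_cutoff U k x) \<longlonglongrightarrow> indicat_real U x"
      proof (rule AE_I2)
        fix x
        show "(\<lambda>k. dist_cutoff U k x) \<longlonglongrightarrow> indicat_real U x"
        proof (cases "x \<in> U")
          case True
          then obtain k where "\<And>j. k \<le> j \<Longrightarrow> dist_cutoff U j x = 1" using dist_cutoff_eq_1[OF U] by blast
          then have "\<forall>\<^sub>F j in sequentially. dist_cutoff U j x = indicat_real U x"
            using True by (auto simp: eventually_sequentially)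
          then show ?thesis by (rule tendsto_eventually)
        qed (simp add: dist_cutoff_eq_0)
      qed
      show "AE x in Q. norm (dist_cutoff U k x) \<le> 1" for k
        using dist_cutoff(2,3)[OF U(1)] by simp
    qed simp
    then show ?thesis using U(2) Q(2) by simp
  qed
  define G where "G = range (\<lambda>(a, b). box a (b :: 'a))"
  define S where "S A \<longleftrightarrow> measure P A - measure N A = measure P' A - measure N' A" for A
  have box: "S (box a b)" for a b
  proof -
    have "(\<lambda>k. (LINT x|P. dist_cutoff (box a b) k x) - (LINT x|N. dist_cutoff (box a b) k x))
        \<longlonglongrightarrow> measure P (box a b) - measure N (box a b)"
      by (intro tendsto_diff lim fin s) (auto simp: bounded_box)
    moreover have "(\<lambda>k. (LINT x|P. dist_cutoff (box a b) k x) - (LINT x|N. dist_cutoff (box a b) k x))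
        \<longlonglongrightarrow> measure P' (box a b) - measure N' (box a b)"
      unfolding eq[OF dist_cutoff(1)[OF bounded_box]]
      by (intro tendsto_diff lim fin s) (auto simp: bounded_box)
    ultimately show ?thesis unfolding S_def by (rule LIMSEQ_unique)
  qed
  define Bn where "Bn n = box (- (real n *\<^sub>R One)) (real n *\<^sub>R (One::'a))" for n :: nat
  have UBn: "(\<Union>n. Bn n) = UNIV" unfolding Bn_def by (rule UN_box_eq_UNIV)
  have inc: "incseq Bn"
  proof (rule incseq_SucI, rule subsetI)
    fix n x assume "x \<in> Bn n"
    then have "- real n < x \<bullet> i \<and> x \<bullet> i < real n" if "i \<in> Basis" for i
      using that by (simp add: Bn_def mem_box)
    then show "x \<in> Bn (Suc n)" by (fastforce simp: Bn_def mem_box)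
  qed
  have limU: "(\<lambda>n. measure Q (Bn n)) \<longlonglongrightarrow> measure Q UNIV" if "finite_measure Q" "sets Q = sets borel" for Q :: "'a measure"
  proof -
    have "range Bn \<subseteq> sets Q" by (auto simp: Bn_def that(2))
    from finite_measure.finite_Lim_measure_incseq[OF that(1) this inc] show ?thesis unfolding UBn .
  qed
  have univ: "S UNIV"
  proof -
    have "(\<lambda>n. measure P (Bn n) - measure N (Bn n)) \<longlonglongrightarrow> measure P UNIV - measure N UNIV"
      by (intro tendsto_diff limU fin s)
    moreover have "(\<lambda>n. measure P (Bn n) - measure N (Bn n)) \<longlonglongrightarrow> measure P' UNIV - measure N' UNIV"
    proof -
      have "measure P (Bn n) - measure N (Bn n) = measure P' (Bn n) - measure N' (Bn n)" for n
        using box unfolding S_def Bn_def by blast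
      then show ?thesis by (simp only:) (intro tendsto_diff limU fin s)
    qed
    ultimately show ?thesis unfolding S_def by (rule LIMSEQ_unique)
  qed
  have sG: "sigma_sets UNIV G = sets borel"
    unfolding G_def borel_eq_box by (simp add: sets_measure_of)
  have "A \<in> sigma_sets UNIV G" using A by (simp add: sG)
  then have "S A"
  proof (rule sigma_sets_induct_disjoint[rotated 2])
    show "Int_stable G"
    proof (rule Int_stableI)
      fix a b assume "a \<in> G" "b \<in> G"
      then obtain p q r t where "a = box p q" "b = box r t" by (auto simp: G_def)
      then show "a \<inter> b \<in> G" unfolding G_def by (auto simp: Int_interval[where 'a='a] box_Int_box)
    qed
    show "G \<subseteq> Pow UNIV" by simp
    show "S A" if "A \<in> G" for A using that box by (auto simp: G_def)
    show "S {}" by (simp add: S_def)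
    show "S (UNIV - A)" if "A \<in> sigma_sets UNIV G" "S A" for A
    proof -
      have "measure Q (UNIV - A) = measure Q UNIV - measure Q A" if "finite_measure Q" "sets Q = sets borel" for Q :: "'a measure"
        using finite_measure.finite_measure_compl[OF that(1), of A] that(2) \<open>A \<in> sigma_sets UNIV G\<close>
          sets_eq_imp_space_eq[OF that(2)] by (simp add: sG)
      then show ?thesis using that(2) univ fin s by (simp add: S_def)
    qed
    fix Ai :: "nat \<Rightarrow> 'a set" assume Ai: "disjoint_family Ai" "range Ai \<subseteq> sigma_sets UNIV G" "\<And>i. S (Ai i)"
    have "(\<lambda>i. measure Q (Ai i)) sums measure Q (\<Union>i. Ai i)" if "finite_measure Q" "sets Q = sets borel" for Q :: "'a measure"
      using finite_measure.finite_measure_UNION[OF that(1) _ Ai(1)] Ai(2) that(2) by (simp add: sG)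
    note sm = this
    have "(\<lambda>i. measure P (Ai i) - measure N (Ai i)) sums (measure P (\<Union>i. Ai i) - measure N (\<Union>i. Ai i))"
      by (intro sums_diff sm fin s)
    moreover have "(\<lambda>i. measure P (Ai i) - measure N (Ai i)) sums (measure P' (\<Union>i. Ai i) - measure N' (\<Union>i. Ai i))"
      using Ai(3) unfolding S_def by simp (intro sums_diff sm fin s)
    ultimately show "S (\<Union>i. Ai i)" unfolding S_def by (rule sums_unique2)
  qed
  then show ?thesis by (simp add: S_def)
qed

text \<open>The bound by the sup norm, given on test functions, extends to Lipschitz functions
  because mollification does not increase the sup norm and the pairing is continuous in the
  seminorm. The Riesz theorem then applies, and uniqueness identifies the result with the definite
  description in \<open>frac_div\<close>.\<close>

theorem frac_div_representation:
  fixes F :: "'a::euclidean_space \<Rightarrow> 'a"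
  assumes \<alpha>: "0 < \<alpha>" "\<alpha> < 1" and F: "F \<in> frac_DM \<alpha>"
  obtains P N where "finite_measure P" "finite_measure N" "sets P = sets borel" "sets N = sets borel"
    "\<And>v. v \<in> lipc \<Longrightarrow> frac_pairing \<alpha> F v = - ((LINT x|P. v x) - (LINT x|N. v x))"
    "\<And>A. A \<in> sets borel \<Longrightarrow> frac_div \<alpha> F A = measure P A - measure N A"
proof -
  have Fm: "F \<in> borel_measurable lebesgue" using F by (simp add: frac_DM_def)
  obtain C0 where C0: "AE x in lebesgue. norm (F x) \<le> C0" using F by (auto simp: frac_DM_def)
  define C where "C = max C0 0"
  have C: "AE x in lebesgue. norm (F x) \<le> C" "0 \<le> C"
    using C0 by (auto simp: C_def elim: eventually_mono)
  note pair = frac_pairing_le[OF Fm C] frac_pairing_add[OF Fm C] frac_pairing_cmult frac_pairing_diff_le[OF Fm C]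
  have lg: "v \<in> borel_measurable borel" "gagliardo \<alpha> v < \<infinity>" if "v \<in> lipc" for v :: "'a \<Rightarrow> real"
    using lipc_measurable[OF that] lipc_gagliardo_finite[OF \<alpha> that] by auto
  obtain B where B: "\<And>\<xi>. \<xi> \<in> test_functions \<Longrightarrow> (\<And>x. \<bar>\<xi> x\<bar> \<le> 1) \<Longrightarrow> frac_pairing \<alpha> F \<xi> \<le> B"
  proof -
    have "bdd_above {LINT x|lebesgue. F x \<bullet> frac_grad \<alpha> \<xi> x | \<xi>.
       \<xi> \<in> test_functions \<and> (AE x in lebesgue. \<bar>\<xi> x\<bar> \<le> 1)}" using F by (simp add: frac_DM_def)
    then obtain B where B: "\<And>r. r \<in> {LINT x|lebesgue. F x \<bullet> frac_grad \<alpha> \<xi> x | \<xi>.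
       \<xi> \<in> test_functions \<and> (AE x in lebesgue. \<bar>\<xi> x\<bar> \<le> 1)} \<Longrightarrow> r \<le> B" unfolding bdd_above_def by blast
    show thesis
    proof (rule that)
      fix \<xi> :: "'a \<Rightarrow> real" assume "\<xi> \<in> test_functions" "\<And>x. \<bar>\<xi> x\<bar> \<le> 1"
      then show "frac_pairing \<alpha> F \<xi> \<le> B"
        unfolding frac_pairing_def by (intro B CollectI exI[of _ \<xi>]) auto
    qed
  qed
  have test_scale: "(\<lambda>x. c * \<xi> x) \<in> test_functions" if \<xi>: "\<xi> \<in> test_functions" for \<xi> :: "'a \<Rightarrow> real" and c
  proof -
    have "C_times k (\<lambda>x. c * \<xi> x)" for k
    proof (rule C_times_coinduct[where F="(\<lambda>\<xi> x. c * \<xi> x) ` test_functions"])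
      fix f assume "f \<in> (\<lambda>\<xi> x. c * \<xi> x) ` (test_functions :: ('a \<Rightarrow> real) set)"
      then obtain \<zeta> where \<zeta>: "\<zeta> \<in> test_functions" "f = (\<lambda>x. c * \<zeta> x)" by auto
      show "\<exists>D. (\<forall>x. (f has_derivative D x) (at x)) \<and> (\<forall>b\<in>Basis. (\<lambda>x. D x b) \<in> (\<lambda>\<xi> x. c * \<xi> x) ` test_functions)"
        using test_functions_derivative[OF \<zeta>(1)] unfolding \<zeta>(2)
        by (intro exI[of _ "\<lambda>x h. c * frechet_derivative \<zeta> (at x) h"]) (auto intro: has_derivative_mult_right)
    qed (use \<xi> in auto)
    moreover have "bounded {x. c * \<xi> x \<noteq> 0}"
      by (rule bounded_subset[of "{x. \<xi> x \<noteq> 0}"]) (use \<xi> in \<open>auto simp: test_functions_iff\<close>)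
    ultimately show ?thesis by (simp add: test_functions_iff)
  qed
  \<comment> \<open>The zero function is obtained as 0 times some test function.\<close>
  have B0: "0 \<le> B"
  proof -
    obtain m :: "'a \<Rightarrow> real" where "m \<in> test_functions" using mollifier_exists[of 1] by (metis zero_less_one)
    then have "frac_pairing \<alpha> F (\<lambda>x. 0 * m x) \<le> B" by (intro B test_scale) auto
    then show ?thesis using frac_pairing_cmult[where F=F and \<alpha>=\<alpha> and c=0 and v=m] by simp
  qed
  have test_bound: "\<bar>frac_pairing \<alpha> F \<xi>\<bar> \<le> B * c" if \<xi>: "\<xi> \<in> test_functions" "\<And>x. \<bar>\<xi> x\<bar> \<le> c" "0 < c" for \<xi> c
  proof -
    have "frac_pairing \<alpha> F (\<lambda>x. (s / c) * \<xi> x) \<le> B" if "\<bar>s\<bar> = 1" for s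
      using \<xi> that by (intro B test_scale) (auto simp: abs_mult)
    from this[of 1] this[of "-1"] show ?thesis
      unfolding frac_pairing_cmult using \<xi>(3) by (simp add: field_simps abs_le_iff)
  qed
  have lim_pair: "(\<lambda>k. frac_pairing \<alpha> F (\<xi> k)) \<longlonglongrightarrow> frac_pairing \<alpha> F v"
    if "\<And>k::nat. \<xi> k \<in> lipc" "v \<in> lipc" "(\<lambda>k. gagliardo \<alpha> (\<lambda>x. \<xi> k x - v x)) \<longlonglongrightarrow> 0" for \<xi> v
  proof -
    let ?K = "ennreal (C * \<bar>frac_const DIM('a) \<alpha>\<bar>)"
    have l: "(\<lambda>k. ?K * gagliardo \<alpha> (\<lambda>x. \<xi> k x - v x)) \<longlonglongrightarrow> ?K * 0"
      by (rule ennreal_tendsto_cmult[OF _ that(3)]) simp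
    have "(\<lambda>k. ennreal \<bar>frac_pairing \<alpha> F (\<xi> k) - frac_pairing \<alpha> F v\<bar>) \<longlonglongrightarrow> 0"
      by (rule tendsto_sandwich[OF _ _ tendsto_const l[simplified]])
        (use pair(4)[OF lg[OF that(1)] lg[OF that(2)]] in auto)
    then have "(\<lambda>k. \<bar>frac_pairing \<alpha> F (\<xi> k) - frac_pairing \<alpha> F v\<bar>) \<longlonglongrightarrow> 0"
      using tendsto_ennreal_iff[where F=sequentially and x=0
          and f="\<lambda>k. \<bar>frac_pairing \<alpha> F (\<xi> k) - frac_pairing \<alpha> F v\<bar>"] by simp
    then show ?thesis by (simp add: tendsto_rabs_zero_iff LIM_zero_iff)
  qed
  have lipc_bound: "\<bar>frac_pairing \<alpha> F v\<bar> \<le> B * c" if v: "v \<in> lipc" "\<And>x. \<bar>v x\<bar> \<le> c" for v c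
  proof -
    have c0: "0 \<le> c" using v(2)[of 0] by linarith
    \<comment> \<open>The bound on test functions is proved by division by the sup bound, so that
      bound is first enlarged to be positive.\<close>
    have "\<bar>frac_pairing \<alpha> F v\<bar> \<le> B * (c + e)" if e: "0 < e" for e
    proof -
      have M: "\<bar>v x\<bar> \<le> c + e" for x using v(2)[of x] e by linarith
      obtain \<xi> d where \<xi>: "\<And>k::nat. \<xi> k \<in> test_functions" "\<And>k x. \<bar>\<xi> k x\<bar> \<le> c + e"
        "(\<lambda>k. gagliardo \<alpha> (\<lambda>x. \<xi> k x - v x)) \<longlonglongrightarrow> 0"
        using lipc_mollify_seq[OF \<alpha> v(1) M] by metis
      have "(\<lambda>k. \<bar>frac_pairing \<alpha> F (\<xi> k)\<bar>) \<longlonglongrightarrow> \<bar>frac_pairing \<alpha> F v\<bar>"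
        by (intro tendsto_rabs lim_pair test_functions_lipc \<xi> v)
      then show ?thesis
        by (rule LIMSEQ_le_const2) (use test_bound[OF \<xi>(1,2)] c0 e in auto)
    qed
    then have "\<bar>frac_pairing \<alpha> F v\<bar> \<le> B * c + B * e" if "0 < e" for e using that by (simp add: distrib_left)
    note * = this
    show ?thesis
    proof (rule field_le_epsilon)
      fix e :: real assume e: "0 < e"
      have "B * (e / (B + 1)) \<le> e" using B0 e by (simp add: field_simps)
      then show "\<bar>frac_pairing \<alpha> F v\<bar> \<le> B * c + e" using *[of "e / (B + 1)"] B0 e by simp
    qed
  qed
  define L where "L v = - frac_pairing \<alpha> F v" for v
  obtain P N where PN: "finite_measure P" "finite_measure N" "sets P = sets borel" "sets N = sets borel"
    "\<And>f. f \<in> lipc \<Longrightarrow> L f = (LINT x|P. f x) - (LINT x|N. f x)"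
  proof (rule lipc_Riesz_signed[of L B])
    show "L (\<lambda>x. f x + g x) = L f + L g" if "f \<in> lipc" "g \<in> lipc" for f g
      using pair(2)[OF lg[OF that(1)] lg[OF that(2)]] by (simp add: L_def)
    show "L (\<lambda>x. c * f x) = c * L f" for f c by (simp add: L_def frac_pairing_cmult)
    show "\<bar>L f\<bar> \<le> B * c" if "f \<in> lipc" "\<And>x. \<bar>f x\<bar> \<le> c" for f c
      using lipc_bound[OF that] by (simp add: L_def)
  qed blast
  define \<mu> where "\<mu> A = (if A \<in> sets borel then measure P A - measure N A else 0)" for A
  have "frac_div \<alpha> F = \<mu>"
    unfolding frac_div_def frac_pairing_def[symmetric]
  proof (rule the_equality)
    show "\<exists>P N. signed_decomp \<mu> P N \<and> (\<forall>\<xi>\<in>test_functions. frac_pairing \<alpha> F \<xi> = - ((LINT x|P. \<xi> x) - (LINT x|N. \<xi> x)))"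
    proof (rule exI[of _ P], rule exI[of _ N], intro conjI ballI)
      show "signed_decomp \<mu> P N" using PN(1-4) by (simp add: signed_decomp_def \<mu>_def)
      fix \<xi> :: "'a \<Rightarrow> real" assume "\<xi> \<in> test_functions"
      then show "frac_pairing \<alpha> F \<xi> = - ((LINT x|P. \<xi> x) - (LINT x|N. \<xi> x))"
        using PN(5)[OF test_functions_lipc, of \<xi>] unfolding L_def by linarith
    qed
  next
    \<comment> \<open>A competing decomposition is known to agree on test functions only. Uniform
      approximation by mollification transfers the agreement to Lipschitz functions, which determine
      the difference of the measures.\<close>
    fix \<mu>' assume "\<exists>P N. signed_decomp \<mu>' P N \<and> (\<forall>\<xi>\<in>test_functions. frac_pairing \<alpha> F \<xi> = - ((LINT x|P. \<xi> x) - (LINT x|N. \<xi> x)))"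
    then obtain P' N' where PN': "signed_decomp \<mu>' P' N'"
      "\<And>\<xi>. \<xi> \<in> test_functions \<Longrightarrow> frac_pairing \<alpha> F \<xi> = - ((LINT x|P'. \<xi> x) - (LINT x|N'. \<xi> x))" by blast
    have fin': "finite_measure P'" "finite_measure N'" and s': "sets P' = sets borel" "sets N' = sets borel"
      using PN'(1) by (auto simp: signed_decomp_def)
    have lim: "(\<lambda>k. LINT x|Q. \<xi> k x) \<longlonglongrightarrow> (LINT x|Q. v x)"
      if "finite_measure Q" "sets Q = sets borel" "\<And>k::nat. \<xi> k \<in> lipc" "v \<in> lipc" "\<And>k x. \<bar>\<xi> k x - v x\<bar> \<le> d k" "d \<longlonglongrightarrow> 0"
        "\<And>k x. \<bar>\<xi> k x\<bar> \<le> M" for Q \<xi> d and v :: "'a \<Rightarrow> real" and M :: real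
    proof (rule integral_dominated_convergence[where w="\<lambda>_. M"])
      interpret Q: finite_measure Q by fact
      show "integrable Q (\<lambda>_. M)" by simp
      show "v \<in> borel_measurable Q" "\<xi> k \<in> borel_measurable Q" for k
        using lipc_measurable[OF that(3)] lipc_measurable[OF that(4)] by (simp_all add: measurable_cong_sets[OF that(2) refl])
      show "AE x in Q. norm (\<xi> k x) \<le> M" for k using that(7) by simp
      have "(\<lambda>k. \<xi> k x) \<longlonglongrightarrow> v x" for x
        using Lim_null_comparison[of "\<lambda>k. \<xi> k x - v x" d sequentially] that(5,6) by (auto simp: LIM_zero_iff)
      then show "AE x in Q. (\<lambda>k. \<xi> k x) \<longlonglongrightarrow> v x" by simp
    qed
    have "(LINT x|P. v x) - (LINT x|N. v x) = (LINT x|P'. v x) - (LINT x|N'. v x)" if v: "v \<in> lipc" for v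
    proof -
      obtain M where M: "\<And>x. \<bar>v x\<bar> \<le> M" using lipc_bounded[OF v] by blast
      obtain \<xi> d where \<xi>: "\<And>k::nat. \<xi> k \<in> test_functions" "\<And>k x. \<bar>\<xi> k x\<bar> \<le> M" "\<And>k x. \<bar>\<xi> k x - v x\<bar> \<le> d k" "d \<longlonglongrightarrow> 0"
        using lipc_mollify_seq[OF \<alpha> v M] by metis
      note \<xi>l = test_functions_lipc[OF \<xi>(1)]
      have 1: "(\<lambda>k. (LINT x|P. \<xi> k x) - (LINT x|N. \<xi> k x)) \<longlonglongrightarrow> (LINT x|P. v x) - (LINT x|N. v x)"
        by (intro tendsto_diff lim[OF PN(1,3) \<xi>l v \<xi>(3,4,2)] lim[OF PN(2,4) \<xi>l v \<xi>(3,4,2)])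
      have 2: "(\<lambda>k. (LINT x|P'. \<xi> k x) - (LINT x|N'. \<xi> k x)) \<longlonglongrightarrow> (LINT x|P'. v x) - (LINT x|N'. v x)"
        by (intro tendsto_diff lim[OF fin'(1) s'(1) \<xi>l v \<xi>(3,4,2)] lim[OF fin'(2) s'(2) \<xi>l v \<xi>(3,4,2)])
      have "(LINT x|P'. \<xi> k x) - (LINT x|N'. \<xi> k x) = (LINT x|P. \<xi> k x) - (LINT x|N. \<xi> k x)" for k
        using PN'(2)[OF \<xi>(1)[of k]] PN(5)[OF \<xi>l[of k]] by (simp add: L_def)
      then show ?thesis using LIMSEQ_unique[OF 1] 2 by simp
    qed
    then have "measure P A - measure N A = measure P' A - measure N' A" if "A \<in> sets borel" for A
      using that by (intro finite_signed_eq_of_lipc[OF PN(1,2) fin' PN(3,4) s'])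
    then show "\<mu>' = \<mu>" using PN'(1) by (auto simp: signed_decomp_def \<mu>_def fun_eq_iff)
  qed
  then have "frac_div \<alpha> F A = measure P A - measure N A" if "A \<in> sets borel" for A
    using that by (simp add: \<mu>_def)
  moreover have "frac_pairing \<alpha> F v = - ((LINT x|P. v x) - (LINT x|N. v x))" if "v \<in> lipc" for v
    using PN(5)[OF that] unfolding L_def by linarith
  ultimately show thesis using that PN(1-4) by blast
qed

section \<open>Sets of vanishing capacity\<close>

lemma lipc_mult:
  fixes g :: "'a::euclidean_space \<Rightarrow> real"
  assumes g: "L-lipschitz_on UNIV g" "\<And>x. \<bar>g x\<bar> \<le> b" and f: "f \<in> lipc"
  shows "(\<lambda>x. g x * f x) \<in> lipc"
proof -
  obtain K where K: "K-lipschitz_on UNIV f" using f by (auto simp: lipc_def)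
  obtain M where M: "0 \<le> M" "\<And>x. \<bar>f x\<bar> \<le> M" using lipc_bounded[OF f] by blast
  have b: "0 \<le> b" using g(2)[of undefined] by linarith
  have "(b * K + L * M)-lipschitz_on UNIV (\<lambda>x. g x * f x)"
  proof (rule lipschitz_onI)
    fix x y
    have "g x * f x - g y * f y = g x * (f x - f y) + (g x - g y) * f y" by (simp add: algebra_simps)
    also have "\<bar>\<dots>\<bar> \<le> \<bar>g x\<bar> * \<bar>f x - f y\<bar> + \<bar>g x - g y\<bar> * \<bar>f y\<bar>"
      using abs_triangle_ineq by (simp add: abs_mult[symmetric])
    also have "\<dots> \<le> b * (K * dist x y) + (L * dist x y) * M"
      by (intro add_mono mult_mono g(2) M(2) lipschitz_on_realD(2)[OF K] lipschitz_on_realD(2)[OF g(1)])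
        (use b lipschitz_on_nonneg[OF g(1)] in auto)
    finally show "dist (g x * f x) (g y * f y) \<le> (b * K + L * M) * dist x y"
      by (simp add: dist_real_def algebra_simps)
  qed (use b M lipschitz_on_nonneg[OF g(1)] lipschitz_on_nonneg[OF K] in simp)
  moreover have "bounded {x. g x * f x \<noteq> 0}"
    by (rule bounded_subset[of "{x. f x \<noteq> 0}"]) (use f in \<open>auto simp: lipc_def\<close>)
  ultimately show ?thesis by (rule lipc_I)
qed

text \<open>In contrast to \<open>dist_cutoff\<close>, these approximate the indicator of a compact
  set from above, so that they equal 1 on \<open>K\<close>.\<close>

lemma compact_cutoff:
  fixes K :: "'a::euclidean_space set"
  assumes K: "compact K" "K \<noteq> {}"
  defines "\<eta> \<equiv> \<lambda>j::nat. \<lambda>x. max 0 (1 - real (Suc j) * infdist x K)"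
  shows "(real (Suc j))-lipschitz_on UNIV (\<eta> j)" "\<eta> j \<in> lipc" "0 \<le> \<eta> j x" "\<eta> j x \<le> 1"
    "x \<in> K \<Longrightarrow> \<eta> j x = 1" "(\<lambda>j. \<eta> j x) \<longlonglongrightarrow> indicat_real K x"
proof -
  show L: "(real (Suc j))-lipschitz_on UNIV (\<eta> j)" for j
  proof (rule lipschitz_on_realI)
    fix x y :: 'a
    have "infdist y K \<le> infdist x K + dist x y" using infdist_triangle[of y K x] by (simp add: dist_commute)
    then have "real (Suc j) * infdist y K \<le> real (Suc j) * (infdist x K + dist x y)"
      by (rule mult_left_mono) simp
    moreover have "0 \<le> real (Suc j) * dist x y" by simp
    ultimately show "\<eta> j x - \<eta> j y \<le> real (Suc j) * dist x y"
      unfolding \<eta>_def distrib_left by linarith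
  qed simp
  show "0 \<le> \<eta> j x" "\<eta> j x \<le> 1" by (auto simp: \<eta>_def infdist_nonneg)
  show "x \<in> K \<Longrightarrow> \<eta> j x = 1" by (simp add: \<eta>_def)
  show "\<eta> j \<in> lipc"
  proof (rule lipc_I[OF L])
    obtain a r where r: "K \<subseteq> cball a r" using compact_imp_bounded[OF K(1)] by (auto simp: bounded_def cball_def)
    have "{x. \<eta> j x \<noteq> 0} \<subseteq> cball a (r + 1)"
    proof
      fix x assume "x \<in> {x. \<eta> j x \<noteq> 0}"
      then have "real (Suc j) * infdist x K < 1" by (auto simp: \<eta>_def max_def split: if_splits)
      moreover have "1 * infdist x K \<le> real (Suc j) * infdist x K" by (rule mult_right_mono) (auto simp: infdist_nonneg)
      ultimately have "infdist x K < 1" by simp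
      moreover obtain y where y: "y \<in> K" "infdist x K = dist x y"
        using infdist_attains_inf[OF compact_imp_closed[OF K(1)] K(2)] by blast
      ultimately have "dist x y < 1" by simp
      moreover have "dist a y \<le> r" using r y(1) by auto
      ultimately show "x \<in> cball a (r + 1)" using dist_triangle[of a x y] by (simp add: dist_commute)
    qed
    then show "bounded {x. \<eta> j x \<noteq> 0}" by (rule bounded_subset[OF bounded_cball])
  qed
  show "(\<lambda>j. \<eta> j x) \<longlonglongrightarrow> indicat_real K x"
  proof (cases "x \<in> K")
    case True
    then show ?thesis by (simp add: \<eta>_def)
  next
    case False
    then have d: "0 < infdist x K"
      using K by (intro infdist_pos_not_in_closed compact_imp_closed) auto
    obtain n :: nat where n: "1 < real n * infdist x K" using reals_Archimedean3[OF d] by blast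
    have "\<eta> j x = 0" if "n \<le> j" for j
    proof -
      have "real n * infdist x K \<le> real (Suc j) * infdist x K" using that d by (intro mult_right_mono) auto
      then show ?thesis using n by (simp add: \<eta>_def)
    qed
    then have "\<forall>\<^sub>F j in sequentially. \<eta> j x = indicat_real K x"
      using False by (auto simp: eventually_sequentially)
    then show ?thesis by (rule tendsto_eventually)
  qed
qed

lemma ennreal_tail_small:
  fixes a :: "nat \<Rightarrow> ennreal"
  assumes "(\<Sum>k. a k) < \<infinity>" "0 < e"
  obtains m where "\<And>M. (\<Sum>k=m..<M. a k) < ennreal e"
proof -
  have fin: "a k < \<infinity>" for k using le_less_trans[OF term_le_suminf_ennreal assms(1)] .
  define b where "b k = enn2real (a k)" for k
  have ab: "a k = ennreal (b k)" for k using fin[of k] by (simp add: b_def less_top)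
  have b0: "0 \<le> b k" for k by (simp add: b_def)
  have "summable b"
    by (rule summable_suminf_not_top) (use b0 assms(1) in \<open>auto simp: ab\<close>)
  then obtain N where N: "\<And>m n. m \<ge> N \<Longrightarrow> norm (sum b {m..<n}) < e"
    using assms(2) unfolding summable_Cauchy by blast
  have "(\<Sum>k=N..<M. a k) < ennreal e" for M
  proof -
    have "(\<Sum>k=N..<M. a k) = ennreal (\<Sum>k=N..<M. b k)" unfolding ab by (rule sum_ennreal) (use b0 in auto)
    also have "\<dots> < ennreal e" using N[of N M] sum_nonneg[of "{N..<M}" b] b0 assms(2) by (intro ennreal_lessI) auto
    finally show ?thesis .
  qed
  then show thesis by (rule that)
qed

context
  fixes \<alpha> :: real and D :: "nat \<Rightarrow> 'a::euclidean_space \<Rightarrow> real" and P N :: "'a measure" and C :: real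
  assumes \<alpha>: "0 < \<alpha>" "\<alpha> < 1"
    and PN: "finite_measure P" "finite_measure N" "sets P = sets borel" "sets N = sets borel"
    and cap: "\<And>v. v \<in> lipc \<Longrightarrow> ennreal \<bar>(LINT x|P. v x) - (LINT x|N. v x)\<bar> \<le> ennreal C * gagliardo \<alpha> v"
    and D: "\<And>k. \<exists>L. L-lipschitz_on UNIV (D k)" "\<And>k x. 0 \<le> D k x"
    and sumg: "(\<Sum>k. gagliardo \<alpha> (D k)) < \<infinity>" and sum1: "(\<Sum>k. \<integral>\<^sup>+x. ennreal (D k x) \<partial>lborel) < \<infinity>"
begin

text \<open>Truncating a tail of \<open>\<Sum>D\<^sub>k\<close> yields admissible functions that equal \<open>1\<close> on \<open>K\<close> and are arbitrarily
  small in the Gagliardo seminorm: \<open>K\<close> has capacity zero.\<close>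

lemma signed_measure_compact_limsup:
  assumes K: "compact K" and t: "0 < t" and big: "\<And>x m. x \<in> K \<Longrightarrow> \<exists>k\<ge>m. t < D k x"
  shows "measure P K = measure N K"
proof (cases "K = {}")
  case False
  interpret P: finite_measure P by (rule PN)
  interpret N: finite_measure N by (rule PN)
  have [measurable]: "D k \<in> borel_measurable borel" for k
    using D(1)[of k] by (auto intro: borel_measurable_continuous_onI lipschitz_on_continuous_on)
  have Dc: "continuous_on UNIV (D k)" for k using D(1)[of k] by (auto intro: lipschitz_on_continuous_on)
  define \<eta> where "\<eta> j x = max 0 (1 - real (Suc j) * infdist x K)" for j and x
  note \<eta> = compact_cutoff[OF K False, folded \<eta>_def[abs_def], folded \<eta>_def]
  have Kb: "K \<in> sets borel" using K by (simp add: compact_imp_closed borel_closed)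
  \<comment> \<open>A function \<open>v\<close> of small seminorm will be squeezed between the
    indicator of \<open>K\<close> and \<open>\<eta> j\<close>. The right side is the error of that
    squeeze and vanishes as \<open>j\<close> grows; the seminorm only enters through an arbitrary
    \<open>e\<close>.\<close>
  have est: "\<bar>measure P K - measure N K\<bar> \<le> ((LINT x|P. \<eta> j x) - measure P K) + ((LINT x|N. \<eta> j x) - measure N K)" for j
  proof (rule field_le_epsilon)
    fix e :: real assume e: "0 < e"
    \<comment> \<open>The cost of multiplying by \<open>\<eta> j\<close>. It is fixed before the
      tail index \<open>m\<close> is chosen, since the Lipschitz constant of \<open>\<eta> j\<close>
      grows with \<open>j\<close>.\<close>
    define Q where "Q = kernel_mass \<alpha> TYPE('a) (2 * 1) (real (Suc j))"
    have Q: "Q < \<infinity>" unfolding Q_def by (rule kernel_mass_finite[OF \<alpha>])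
    obtain q where q: "Q = ennreal q" "0 \<le> q" using Q by (cases Q) auto
    \<comment> \<open>The bound on the pairing will be \<open>\<bar>C\<bar> / t * (1 + q)\<close>
      times the tail \<open>d\<close>; the \<open>+ 1\<close> keeps \<open>c\<close> positive, and
      \<open>d = e / c\<close> brings the bound below \<open>e\<close>.\<close>
    define c where "c = \<bar>C\<bar> / t * (1 + q) + 1"
    have c: "0 < c" using q t by (simp add: c_def add_nonneg_pos)
    define d where "d = e / c"
    have d: "0 < d" using e c by (simp add: d_def)
    obtain m1 where m1: "\<And>M. (\<Sum>k=m1..<M. gagliardo \<alpha> (D k)) < ennreal d" using ennreal_tail_small[OF sumg d] by blast
    obtain m2 where m2: "\<And>M. (\<Sum>k=m2..<M. \<integral>\<^sup>+x. ennreal (D k x) \<partial>lborel) < ennreal d" using ennreal_tail_small[OF sum1 d] by blast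
    define m where "m = max m1 m2"
    have m: "(\<Sum>k=m..<M. gagliardo \<alpha> (D k)) \<le> ennreal d" "(\<Sum>k=m..<M. \<integral>\<^sup>+x. ennreal (D k x) \<partial>lborel) \<le> ennreal d" for M
    proof -
      have "(\<Sum>k=m..<M. gagliardo \<alpha> (D k)) \<le> (\<Sum>k=m1..<M. gagliardo \<alpha> (D k))"
        by (rule sum_mono2) (auto simp: m_def)
      then show "(\<Sum>k=m..<M. gagliardo \<alpha> (D k)) \<le> ennreal d" using m1[of M] by simp
      have "(\<Sum>k=m..<M. \<integral>\<^sup>+x. ennreal (D k x) \<partial>lborel) \<le> (\<Sum>k=m2..<M. \<integral>\<^sup>+x. ennreal (D k x) \<partial>lborel)"
        by (rule sum_mono2) (auto simp: m_def)
      then show "(\<Sum>k=m..<M. \<integral>\<^sup>+x. ennreal (D k x) \<partial>lborel) \<le> ennreal d" using m2[of M] by simp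
    qed
    \<comment> \<open>Beyond any index some \<open>D k\<close> exceeds \<open>t\<close> at each
      point of \<open>K\<close>, and these conditions are open; compactness therefore reduces the
      tail to a finite sum, which is still Lipschitz.\<close>
    have "K \<subseteq> (\<Union>k\<in>{m..}. {x. t < D k x})" using big by force
    moreover have "open {x. t < D k x}" for k by (intro open_Collect_less continuous_intros Dc)
    ultimately obtain I where I: "I \<subseteq> {m..}" "finite I" "K \<subseteq> (\<Union>k\<in>I. {x. t < D k x})"
      using compactE_image[OF K, of "{m..}" "\<lambda>k. {x. t < D k x}"] by metis
    define M where "M = Suc (Max (insert 0 I))"
    have IM: "I \<subseteq> {m..<M}"
    proof
      fix i assume i: "i \<in> I"
      then have "i \<le> Max (insert 0 I)" using I(2) by simp
      then show "i \<in> {m..<M}" using i I(1) by (auto simp: M_def)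
    qed
    define S where "S x = (\<Sum>k=m..<M. D k x)" for x
    define \<Phi> where "\<Phi> x = min 1 ((1 / t) * S x)" for x
    have S0: "0 \<le> S x" for x unfolding S_def by (intro sum_nonneg D)
    have \<Phi>01: "0 \<le> \<Phi> x" "\<Phi> x \<le> 1" for x using S0[of x] t by (auto simp: \<Phi>_def)
    have \<Phi>K: "\<Phi> x = 1" if x: "x \<in> K" for x
    proof -
      obtain i where i: "i \<in> I" "t < D i x" using I(3) x by blast
      have "D i x \<le> S x" unfolding S_def by (rule member_le_sum) (use i IM D in auto)
      then show ?thesis using i(2) t by (simp add: \<Phi>_def field_simps)
    qed
    have "\<exists>L. L-lipschitz_on UNIV \<Phi>"
    proof -
      obtain L where L: "\<And>k. (L k)-lipschitz_on UNIV (D k)" using D(1) by metis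
      have "((1 / t) * (\<Sum>k=m..<M. L k))-lipschitz_on UNIV \<Phi>"
      proof (rule lipschitz_on_realI)
        fix x y
        have "S x - S y = (\<Sum>k=m..<M. D k x - D k y)" by (simp add: S_def sum_subtractf)
        also have "\<dots> \<le> (\<Sum>k=m..<M. L k * dist x y)" by (intro sum_mono lipschitz_on_realD[OF L])
        also have "\<dots> = (\<Sum>k=m..<M. L k) * dist x y" by (simp add: sum_distrib_right)
        finally have "(1 / t) * (S x - S y) \<le> (1 / t) * ((\<Sum>k=m..<M. L k) * dist x y)"
          using t by (intro mult_left_mono) auto
        moreover have "0 \<le> (1 / t) * ((\<Sum>k=m..<M. L k) * dist x y)"
          using t lipschitz_on_nonneg[OF L] by (intro mult_nonneg_nonneg sum_nonneg) auto
        ultimately show "\<Phi> x - \<Phi> y \<le> (1 / t) * (\<Sum>k=m..<M. L k) * dist x y"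
          unfolding \<Phi>_def right_diff_distrib mult.assoc by linarith
      qed (use t lipschitz_on_nonneg[OF L] in \<open>auto intro!: divide_nonneg_nonneg sum_nonneg\<close>)
      then show ?thesis by blast
    qed
    then obtain L where L: "L-lipschitz_on UNIV \<Phi>" by blast
    have [measurable]: "\<Phi> \<in> borel_measurable borel"
      by (intro borel_measurable_continuous_onI lipschitz_on_continuous_on[OF L])
    have [measurable]: "S \<in> borel_measurable borel" unfolding S_def by measurable
    \<comment> \<open>The truncated sum \<open>\<Phi>\<close> need not have bounded support; the
      factor \<open>\<eta> j\<close> supplies it.\<close>
    define v where "v x = \<Phi> x * \<eta> j x" for x
    have vl: "v \<in> lipc" unfolding v_def[abs_def] by (rule lipc_mult[OF L _ \<eta>(2), of 1]) (use \<Phi>01 in auto)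
    have g\<Phi>: "gagliardo \<alpha> \<Phi> \<le> ennreal (1 / t) * ennreal d"
    proof -
      have "gagliardo \<alpha> \<Phi> \<le> ennreal (1 / t) * gagliardo \<alpha> S"
      proof (rule gagliardo_mono)
        fix x y
        have "\<bar>\<Phi> x - \<Phi> y\<bar> \<le> \<bar>(1 / t) * S x - (1 / t) * S y\<bar>" unfolding \<Phi>_def by linarith
        also have "\<dots> = (1 / t) * \<bar>S x - S y\<bar>" unfolding right_diff_distrib[symmetric] abs_mult using t by simp
        finally show "\<bar>\<Phi> x - \<Phi> y\<bar> \<le> (1 / t) * \<bar>S x - S y\<bar>" .
      qed (use t in auto)
      also have "gagliardo \<alpha> S \<le> (\<Sum>k=m..<M. gagliardo \<alpha> (D k))" unfolding S_def[abs_def] by (rule gagliardo_sum) measurable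
      also have "\<dots> \<le> ennreal d" by (rule m)
      finally show ?thesis by (simp add: mult_left_mono)
    qed
    have n\<Phi>: "(\<integral>\<^sup>+x. ennreal \<bar>\<Phi> x\<bar> \<partial>lborel) \<le> ennreal (1 / t) * ennreal d"
    proof -
      have "(\<integral>\<^sup>+x. ennreal \<bar>\<Phi> x\<bar> \<partial>lborel) \<le> (\<integral>\<^sup>+x. ennreal (1 / t) * (\<Sum>k=m..<M. ennreal (D k x)) \<partial>lborel)"
      proof (rule nn_integral_mono)
        fix x
        have "(\<Sum>k=m..<M. ennreal (D k x)) = ennreal (S x)" unfolding S_def by (rule sum_ennreal) (use D in auto)
        moreover have "\<bar>\<Phi> x\<bar> \<le> (1 / t) * S x" using \<Phi>01(1)[of x] by (simp add: \<Phi>_def)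
        ultimately show "ennreal \<bar>\<Phi> x\<bar> \<le> ennreal (1 / t) * (\<Sum>k=m..<M. ennreal (D k x))"
          using t S0[of x] by (simp add: ennreal_mult[symmetric] ennreal_leI)
      qed
      also have "\<dots> = ennreal (1 / t) * (\<Sum>k=m..<M. \<integral>\<^sup>+x. ennreal (D k x) \<partial>lborel)"
        by (subst nn_integral_cmult) (auto simp: nn_integral_sum)
      also have "\<dots> \<le> ennreal (1 / t) * ennreal d" by (rule mult_left_mono[OF m(2)]) simp
      finally show ?thesis .
    qed
    have gv: "gagliardo \<alpha> v \<le> ennreal ((1 / t) * d * (1 + q))"
    proof -
      have "gagliardo \<alpha> v \<le> (\<integral>\<^sup>+x. ennreal \<bar>\<eta> j x\<bar> * frac_osc \<alpha> \<Phi> x \<partial>lborel) + (\<integral>\<^sup>+x. ennreal \<bar>\<Phi> x\<bar> \<partial>lborel) * Q"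
        unfolding Q_def v_def[abs_def] by (rule gagliardo_product[OF _ \<eta>(1)]) (use \<eta>(3,4) in auto)
      also have "\<dots> \<le> gagliardo \<alpha> \<Phi> + (\<integral>\<^sup>+x. ennreal \<bar>\<Phi> x\<bar> \<partial>lborel) * Q"
      proof (rule add_right_mono)
        show "(\<integral>\<^sup>+x. ennreal \<bar>\<eta> j x\<bar> * frac_osc \<alpha> \<Phi> x \<partial>lborel) \<le> gagliardo \<alpha> \<Phi>"
          unfolding gagliardo_def
        proof (rule nn_integral_mono)
          fix x
          have "ennreal \<bar>\<eta> j x\<bar> \<le> 1" using \<eta>(3)[of j x] \<eta>(4)[of j x] by simp
          then show "ennreal \<bar>\<eta> j x\<bar> * frac_osc \<alpha> \<Phi> x \<le> frac_osc \<alpha> \<Phi> x"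
            using mult_right_mono[of "ennreal \<bar>\<eta> j x\<bar>" 1 "frac_osc \<alpha> \<Phi> x"] by simp
        qed
      qed
      also have "\<dots> \<le> ennreal (1 / t) * ennreal d + (ennreal (1 / t) * ennreal d) * Q"
        by (intro add_mono g\<Phi> mult_right_mono n\<Phi>) simp
      also have "\<dots> = ennreal ((1 / t) * d * (1 + q))"
        using t d q by (simp add: ennreal_mult[symmetric] ennreal_plus[symmetric] distrib_left del: ennreal_plus)
      finally show ?thesis .
    qed
    have "ennreal \<bar>(LINT x|P. v x) - (LINT x|N. v x)\<bar> \<le> ennreal C * gagliardo \<alpha> v" by (rule cap[OF vl])
    also have "\<dots> \<le> ennreal \<bar>C\<bar> * ennreal ((1 / t) * d * (1 + q))"
      by (intro mult_mono gv ennreal_leI) auto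
    also have "\<dots> = ennreal (\<bar>C\<bar> * ((1 / t) * d * (1 + q)))"
      using t d q by (intro ennreal_mult[symmetric]) auto
    finally have "\<bar>(LINT x|P. v x) - (LINT x|N. v x)\<bar> \<le> \<bar>C\<bar> * ((1 / t) * d * (1 + q))"
      using t d q by (subst (asm) ennreal_le_iff) auto
    also have "\<dots> \<le> e"
    proof -
      have "\<bar>C\<bar> * ((1 / t) * d * (1 + q)) = (c - 1) * d" by (simp add: c_def)
      also have "\<dots> \<le> c * d" using d by (intro mult_right_mono) auto
      also have "\<dots> = e" using c by (simp add: d_def)
      finally show ?thesis .
    qed
    finally have main: "\<bar>(LINT x|P. v x) - (LINT x|N. v x)\<bar> \<le> e" .
    have close: "\<bar>(LINT x|R. v x) - measure R K\<bar> \<le> (LINT x|R. \<eta> j x) - measure R K"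
      if R: "finite_measure R" "sets R = sets borel" for R :: "'a measure"
    proof -
      interpret R: finite_measure R by (rule R)
      have iv: "integrable R v" and i\<eta>: "integrable R (\<eta> j)" using lipc_integrable[OF vl R] lipc_integrable[OF \<eta>(2) R] by auto
      have iK: "integrable R (indicat_real K)" using Kb R(2) by (simp add: R.emeasure_eq_measure)
      have mK: "measure R K = (LINT x|R. indicat_real K x)" using Kb R(2) by simp
      have le: "indicat_real K x \<le> v x" "v x \<le> \<eta> j x" for x
        using \<Phi>01[of x] \<eta>(3,4)[of j x] \<Phi>K[of x] \<eta>(5)[of x j]
        by (auto simp: v_def indicator_def mult_left_le_one_le)
      have "measure R K \<le> (LINT x|R. v x)" unfolding mK by (rule integral_mono[OF iK iv le(1)])
      moreover have "(LINT x|R. v x) \<le> (LINT x|R. \<eta> j x)" by (rule integral_mono[OF iv i\<eta> le(2)])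
      ultimately show ?thesis by linarith
    qed
    show "\<bar>measure P K - measure N K\<bar> \<le> ((LINT x|P. \<eta> j x) - measure P K) + ((LINT x|N. \<eta> j x) - measure N K) + e"
      using close[OF PN(1,3)] close[OF PN(2,4)] main by linarith
  qed
  have lim: "(\<lambda>j. LINT x|R. \<eta> j x) \<longlonglongrightarrow> measure R K" if R: "finite_measure R" "sets R = sets borel" for R :: "'a measure"
  proof -
    interpret R: finite_measure R by (rule R)
    have "(\<lambda>j. LINT x|R. \<eta> j x) \<longlonglongrightarrow> (LINT x|R. indicat_real K x)"
    proof (rule integral_dominated_convergence[where w="\<lambda>_. 1"])
      show "indicat_real K \<in> borel_measurable R" by (rule borel_measurable_indicator) (simp add: R(2) Kb)
      show "\<eta> j \<in> borel_measurable R" for j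
        using lipc_measurable[OF \<eta>(2)] by (simp add: measurable_cong_sets[OF R(2) refl])
      show "AE x in R. (\<lambda>j. \<eta> j x) \<longlonglongrightarrow> indicat_real K x" using \<eta>(6) by simp
      show "AE x in R. norm (\<eta> j x) \<le> 1" for j using \<eta>(3,4) by simp
    qed simp
    then show ?thesis using Kb R(2) by simp
  qed
  have "(\<lambda>j. ((LINT x|P. \<eta> j x) - measure P K) + ((LINT x|N. \<eta> j x) - measure N K))
      \<longlonglongrightarrow> (measure P K - measure P K) + (measure N K - measure N K)"
    by (intro tendsto_intros lim PN)
  then have "\<bar>measure P K - measure N K\<bar> \<le> (measure P K - measure P K) + (measure N K - measure N K)"
    by (rule LIMSEQ_le_const) (use est in blast)
  then show ?thesis by simp
qed simp

text \<open>\<open>B\<close> is the increasing union of the sets where \<open>D k\<close> exceeds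
  1/(j+1) infinitely often. On each of them inner regularity expresses both measures as suprema over
  the same compact sets, on which they are already known to agree.\<close>

lemma signed_measure_limsup:
  assumes B: "B \<in> sets borel" and big: "\<And>x. x \<in> B \<Longrightarrow> \<not> (\<lambda>k. D k x) \<longlonglongrightarrow> 0"
  shows "emeasure P B = emeasure N B"
proof -
  have [measurable]: "D k \<in> borel_measurable borel" for k
    using D(1)[of k] by (auto intro: borel_measurable_continuous_onI lipschitz_on_continuous_on)
  have [measurable]: "B \<in> sets borel" by (rule B)
  define A where "A j = {x \<in> B. \<forall>m. \<exists>k\<ge>m. 1 / real (Suc j) < D k x}" for j :: nat
  have Ab: "A j \<in> sets borel" for j
  proof -
    have "A j = B \<inter> {x\<in>space borel. \<forall>m. \<exists>k. k \<ge> m \<and> 1 / real (Suc j) < D k x}" by (auto simp: A_def)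
    moreover have "{x\<in>space borel. \<forall>m. \<exists>k. k \<ge> m \<and> 1 / real (Suc j) < D k x} \<in> sets borel" by measurable
    ultimately show ?thesis by simp
  qed
  have eqA: "emeasure P (A j) = emeasure N (A j)" for j
  proof -
    have top: "emeasure P (space P) \<noteq> \<infinity>" "emeasure N (space N) \<noteq> \<infinity>"
      using finite_measure.finite_emeasure_space[OF PN(1)] finite_measure.finite_emeasure_space[OF PN(2)] by auto
    have K: "emeasure P K = emeasure N K" if "K \<in> {K. K \<subseteq> A j \<and> compact K}" for K
    proof -
      have "measure P K = measure N K"
        by (rule signed_measure_compact_limsup[of _ "1 / real (Suc j)"]) (use that in \<open>auto simp: A_def\<close>)
      then show ?thesis
        using finite_measure.emeasure_eq_measure[OF PN(1)] finite_measure.emeasure_eq_measure[OF PN(2)] by simp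
    qed
    show ?thesis
      unfolding inner_regular[OF PN(3) top(1) Ab] inner_regular[OF PN(4) top(2) Ab]
      by (rule SUP_cong[OF refl K])
  qed
  have "incseq A"
  proof (rule incseq_SucI, rule subsetI)
    fix j x assume "x \<in> A j"
    moreover have "1 / real (Suc (Suc j)) \<le> 1 / real (Suc j)" by (simp add: frac_le)
    ultimately show "x \<in> A (Suc j)" unfolding A_def mem_Collect_eq by (meson le_less_trans)
  qed
  moreover have UA: "(\<Union>j. A j) = B"
  proof -
    have "\<exists>j. x \<in> A j" if x: "x \<in> B" for x
    proof (rule ccontr)
      assume "\<nexists>j. x \<in> A j"
      then have *: "\<exists>m. \<forall>k\<ge>m. D k x \<le> 1 / real (Suc j)" for j using x by (auto simp: A_def not_less)
      have "(\<lambda>k. D k x) \<longlonglongrightarrow> 0"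
      proof (rule LIMSEQ_I)
        fix r :: real assume "0 < r"
        then obtain j where j: "1 / real (Suc j) < r" using nat_approx_posE by blast
        obtain m where m: "\<And>k. m \<le> k \<Longrightarrow> D k x \<le> 1 / real (Suc j)" using * by blast
        have "norm (D k x - 0) < r" if "m \<le> k" for k using m[OF that] j D(2)[of k x] by simp
        then show "\<exists>no. \<forall>n\<ge>no. norm (D n x - 0) < r" by blast
      qed
      then show False using big[OF x] by simp
    qed
    then show ?thesis by (auto simp: A_def)
  qed
  moreover have "range A \<subseteq> sets borel" using Ab by blast
  ultimately have "(SUP j. emeasure P (A j)) = emeasure P B" "(SUP j. emeasure N (A j)) = emeasure N B"
    using SUP_emeasure_incseq[of A P] SUP_emeasure_incseq[of A N] PN(3,4) by simp_all
  then show ?thesis using eqA by simp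
qed

end

section \<open>The Gauss-Green formula\<close>

lemma lebesgue_measurable_AE_cong:
  fixes f g :: "'a::euclidean_space \<Rightarrow> 'b::topological_space"
  assumes g: "g \<in> borel_measurable lebesgue" and eq: "AE x in lebesgue. f x = g x"
  shows "f \<in> borel_measurable lebesgue"
proof (rule measurableI)
  fix A :: "'b set" assume A: "A \<in> sets borel"
  have "g -` A \<inter> space lebesgue \<in> sets lebesgue" by (rule measurable_sets[OF g A])
  moreover have "AE x in lebesgue. x \<in> g -` A \<inter> space lebesgue \<longleftrightarrow> x \<in> f -` A \<inter> space lebesgue"
    using eq by eventually_elim auto
  ultimately show "f -` A \<inter> space lebesgue \<in> sets lebesgue"
    using completion.in_sets_AE by blast
qed simp

text \<open>At almost every point the ball averages of \<open>G\<close> and of its norm converge to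
  \<open>G x\<close> and \<open>norm (G x)\<close>. If \<open>G x\<close> is nonzero, their quotient
  tends to the unit vector of \<open>G x\<close>, so \<open>x\<close> lies in the reduced boundary
  and the normal times the norm restores \<open>G x\<close>.\<close>

lemma frac_reduced_boundary_integral:
  fixes F G :: "'a::euclidean_space \<Rightarrow> 'a" and E :: "'a set"
  assumes F: "F \<in> borel_measurable lebesgue"
    and G: "integrable lborel G" and eq: "AE x in lebesgue. frac_grad \<alpha> (indicat_real E) x = G x"
  shows "(LINT x:frac_reduced_boundary \<alpha> E|lebesgue.
         (F x \<bullet> frac_normal \<alpha> E x) * norm (frac_grad \<alpha> (indicat_real E) x)) = (LINT x|lebesgue. F x \<bullet> G x)"
proof -
  define g where "g = frac_grad \<alpha> (indicat_real E)"
  have eq: "AE x in lebesgue. g x = G x" using eq by (simp add: g_def)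
  have Gb [measurable]: "G \<in> borel_measurable borel" using G by auto
  have Gl: "G \<in> borel_measurable lebesgue" using Gb by (intro measurable_completion) simp
  have gl: "g \<in> borel_measurable lebesgue" by (rule lebesgue_measurable_AE_cong[OF Gl eq])
  have iA: "integrable lborel (\<lambda>x. indicator A x *\<^sub>R G x)" "integrable lborel (\<lambda>x. indicat_real A x * norm (G x))"
    if "A \<in> sets borel" for A
    using that integrable_mult_indicator[OF _ G, of A] integrable_mult_indicator[OF _ integrable_norm[OF G], of A] by simp_all
  have var: "frac_var \<alpha> E A = (LINT x:A|lborel. G x)" if A [measurable]: "A \<in> sets borel" for A
  proof -
    have Al: "A \<in> sets lebesgue" using A by simp
    have "frac_var \<alpha> E A = (LINT x|lebesgue. indicator A x *\<^sub>R G x)"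
      unfolding frac_var_def set_lebesgue_integral_def g_def[symmetric]
    proof (rule integral_cong_AE)
      show "(\<lambda>x. indicator A x *\<^sub>R g x) \<in> borel_measurable lebesgue"
        by (intro borel_measurable_scaleR borel_measurable_indicator Al gl)
      show "(\<lambda>x. indicator A x *\<^sub>R G x) \<in> borel_measurable lebesgue"
        by (intro borel_measurable_scaleR borel_measurable_indicator Al Gl)
      show "AE x in lebesgue. indicat_real A x *\<^sub>R g x = indicat_real A x *\<^sub>R G x"
        using eq by eventually_elim simp
    qed
    also have "\<dots> = (LINT x:A|lborel. G x)"
      unfolding set_lebesgue_integral_def by (rule integral_completion) measurable
    finally show ?thesis .
  qed
  have tv: "emeasure (frac_total_var \<alpha> E) A = ennreal (LINT x:A|lborel. norm (G x))" if A [measurable]: "A \<in> sets borel" for A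
  proof -
    have "emeasure (frac_total_var \<alpha> E) A = (\<integral>\<^sup>+x. ennreal (norm (g x)) * indicator A x \<partial>lebesgue)"
      unfolding frac_total_var_def g_def[symmetric]
    proof (rule emeasure_density)
      have "(\<lambda>x. norm (g x)) \<in> borel_measurable lebesgue" by (rule measurable_compose[OF gl borel_measurable_norm])
      then show "(\<lambda>x. ennreal (norm (g x))) \<in> borel_measurable lebesgue" by (rule measurable_compose[OF _ measurable_ennreal])
    qed (use A in simp)
    also have "\<dots> = (\<integral>\<^sup>+x. ennreal (indicat_real A x * norm (G x)) \<partial>lebesgue)"
      by (rule nn_integral_cong_AE) (use eq in eventually_elim, simp add: indicator_def)
    also have "\<dots> = (\<integral>\<^sup>+x. ennreal (indicat_real A x * norm (G x)) \<partial>lborel)" by (rule nn_integral_completion)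
    also have "\<dots> = ennreal (LINT x:A|lborel. norm (G x))"
      unfolding set_lebesgue_integral_def by (subst nn_integral_eq_integral[OF iA(2)[OF A]]) auto
    finally show ?thesis .
  qed
  have mtv: "measure (frac_total_var \<alpha> E) A = (LINT x:A|lborel. norm (G x))" if A: "A \<in> sets borel" for A
  proof -
    have "0 \<le> (LINT x:A|lborel. norm (G x))"
      unfolding set_lebesgue_integral_def by (rule Bochner_Integration.integral_nonneg) simp
    then show ?thesis by (simp add: measure_def tv[OF A])
  qed
  have "AE x in lebesgue. ((\<lambda>r. (LINT y:ball x r|lborel. norm (G y)) /\<^sub>R measure lborel (ball x r)) \<longlongrightarrow> norm (G x)) (at_right 0)"
    by (rule lebesgue_differentiation[OF integrable_norm[OF G]])
  then have good: "AE x in lebesgue. indicator (frac_reduced_boundary \<alpha> E) x *\<^sub>R ((F x \<bullet> frac_normal \<alpha> E x) * norm (g x)) = F x \<bullet> G x"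
    using lebesgue_differentiation[OF G] eq
  proof eventually_elim
    fix x :: 'a
    define V where "V r = measure lborel (ball x r)" for r
    define a where "a r = (LINT y:ball x r|lborel. G y)" for r
    define b where "b r = (LINT y:ball x r|lborel. norm (G y))" for r
    assume lb: "((\<lambda>r. (LINT y:ball x r|lborel. norm (G y)) /\<^sub>R measure lborel (ball x r)) \<longlongrightarrow> norm (G x)) (at_right 0)"
      and la: "((\<lambda>r. (LINT y:ball x r|lborel. G y) /\<^sub>R measure lborel (ball x r)) \<longlongrightarrow> G x) (at_right 0)"
      and gx: "g x = G x"
    have lb: "((\<lambda>r. b r /\<^sub>R V r) \<longlongrightarrow> norm (G x)) (at_right 0)" using lb by (simp only: b_def V_def)
    have la: "((\<lambda>r. a r /\<^sub>R V r) \<longlongrightarrow> G x) (at_right 0)" using la by (simp only: a_def V_def)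
    show "indicator (frac_reduced_boundary \<alpha> E) x *\<^sub>R ((F x \<bullet> frac_normal \<alpha> E x) * norm (g x)) = F x \<bullet> G x"
    \<comment> \<open>Where the gradient vanishes both sides are 0, whether or not \<open>x\<close>
      lies in the reduced boundary and whatever value \<open>Lim\<close> assigns to the
      normal.\<close>
    proof (cases "G x = 0")
      case True
      then show ?thesis by (simp add: gx)
    next
      case False
      define \<nu> where "\<nu> = G x /\<^sub>R norm (G x)"
      have ratio: "frac_polar_ratio \<alpha> E x r = a r /\<^sub>R b r" for r
        unfolding frac_polar_ratio_def a_def b_def by (simp add: var mtv)
      have "((\<lambda>r. (a r /\<^sub>R V r) /\<^sub>R (b r /\<^sub>R V r)) \<longlongrightarrow> \<nu>) (at_right 0)"
        unfolding \<nu>_def by (intro tendsto_scaleR tendsto_inverse la lb) (use False in simp)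
      moreover have "\<forall>\<^sub>F r in at_right 0. (a r /\<^sub>R V r) /\<^sub>R (b r /\<^sub>R V r) = frac_polar_ratio \<alpha> E x r"
        unfolding eventually_at_right_field
      proof (intro exI[of _ 1] conjI allI impI)
        fix r :: real assume "0 < r"
        then have "V r \<noteq> 0" using content_ball_pos[of r x] by (simp add: V_def)
        then show "(a r /\<^sub>R V r) /\<^sub>R (b r /\<^sub>R V r) = frac_polar_ratio \<alpha> E x r" unfolding ratio by simp
      qed simp
      ultimately have lim: "(frac_polar_ratio \<alpha> E x \<longlongrightarrow> \<nu>) (at_right 0)"
        by (rule Lim_transform_eventually)
      have \<nu>1: "\<nu> \<in> sphere 0 1" using False by (simp add: \<nu>_def)
      have "x \<in> measure_support (frac_total_var \<alpha> E)"
        unfolding measure_support_def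
      proof (intro CollectI allI impI)
        fix U assume U: "open U \<and> x \<in> U"
        then obtain e where e: "0 < e" "ball x e \<subseteq> U" using open_contains_ball by blast
        have "\<forall>\<^sub>F r in at_right 0. 0 < b r /\<^sub>R V r"
          by (rule order_tendstoD(1)[OF lb]) (use False in simp)
        then obtain d where d: "0 < d" "\<And>r. 0 < r \<Longrightarrow> r < d \<Longrightarrow> 0 < b r /\<^sub>R V r"
          unfolding eventually_at_right_field by blast
        define r where "r = min d e / 2"
        have r: "0 < r" "r < d" "r \<le> e" using d(1) e(1) by (auto simp: r_def)
        have "b r \<noteq> 0" using d(2)[OF r(1,2)] by auto
        moreover have "0 \<le> b r" unfolding b_def set_lebesgue_integral_def by (rule Bochner_Integration.integral_nonneg) simp
        ultimately have "0 < emeasure (frac_total_var \<alpha> E) (ball x r)"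
          by (simp add: tv b_def)
        also have "\<dots> \<le> emeasure (frac_total_var \<alpha> E) U"
        proof (rule emeasure_mono)
          show "ball x r \<subseteq> U" using e(2) subset_ball[OF r(3), of x] by blast
          show "U \<in> sets (frac_total_var \<alpha> E)" using U by (simp add: frac_total_var_def)
        qed
        finally show "0 < emeasure (frac_total_var \<alpha> E) U" .
      qed
      then have "x \<in> frac_reduced_boundary \<alpha> E"
        unfolding frac_reduced_boundary_def using lim \<nu>1 by blast
      moreover have "frac_normal \<alpha> E x = \<nu>"
        unfolding frac_normal_def by (rule tendsto_Lim[OF _ lim]) simp
      ultimately show ?thesis using False by (simp add: gx \<nu>_def)
    qed
  qed
  \<comment> \<open>Measurability of the left integrand comes from completeness of Lebesgue measure,
    through its almost everywhere equality with this function.\<close>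
  have m: "(\<lambda>x. F x \<bullet> G x) \<in> borel_measurable lebesgue" by (rule borel_measurable_inner[OF F Gl])
  show ?thesis
    unfolding set_lebesgue_integral_def g_def[symmetric]
    by (rule integral_cong_AE[OF lebesgue_measurable_AE_cong[OF m good] m good])
qed

section \<open>Dyadic densities, doubling and cutoffs\<close>

lemma density_compare:
  fixes E :: "'a::euclidean_space set"
  assumes [measurable]: "E \<in> sets borel" and sr: "0 < s" "s \<le> r" "r \<le> 2 * s"
  shows "ball_density E s x \<le> 2 ^ DIM('a) * ball_density E r x"
    "1 - ball_density E s x \<le> 2 ^ DIM('a) * (1 - ball_density E r x)"
proof -
  define V where "V \<rho> = measure lborel (ball x \<rho>)" for \<rho>
  have V: "0 < V s" "0 < V r" using sr content_ball_pos[of s x] content_ball_pos[of r x] by (auto simp: V_def)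
  have Vr: "V r \<le> 2 ^ DIM('a) * V s"
  proof -
    have "r ^ DIM('a) \<le> (2 * s) ^ DIM('a)" using sr by (intro power_mono) auto
    then show ?thesis using sr by (simp add: V_def content_ball power_mult_distrib mult_left_mono)
  qed
  have fm: "ball x \<rho> \<in> fmeasurable lborel" for \<rho>
    using emeasure_bounded_finite[of "ball x \<rho>"] by (auto simp: fmeasurable_def)
  have sub: "ball x s \<subseteq> ball x r" using sr by (intro subset_ball) auto
  have fmE: "E \<inter> ball x \<rho> \<in> fmeasurable lborel" "ball x \<rho> - E \<in> fmeasurable lborel" for \<rho>
    using fmeasurable_Int_fmeasurable[OF fm[of \<rho>], of E] fmeasurable_Diff[OF fm[of \<rho>], of E] by (simp_all add: Int_commute)
  have key: "m1 / V s \<le> 2 ^ DIM('a) * (m2 / V r)" if "m1 \<le> m2" "0 \<le> m1" for m1 m2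
  proof -
    have "m1 * V r \<le> m2 * (2 ^ DIM('a) * V s)" using that Vr V by (intro mult_mono) auto
    then show ?thesis using V by (simp add: field_simps)
  qed
  have "measure lborel (E \<inter> ball x s) \<le> measure lborel (E \<inter> ball x r)"
    by (rule measure_mono_fmeasurable) (use sub fmE in auto)
  from key[OF this] show "ball_density E s x \<le> 2 ^ DIM('a) * ball_density E r x"
    by (simp add: ball_density_def V_def)
  have c: "1 - ball_density E \<rho> x = measure lborel (ball x \<rho> - E) / V \<rho>" if "0 < \<rho>" for \<rho>
  proof -
    have "measure lborel (ball x \<rho> - E) = measure lborel (ball x \<rho> - (E \<inter> ball x \<rho>))"
      by (rule arg_cong[where f="measure lborel"]) auto
    also have "\<dots> = measure lborel (ball x \<rho>) - measure lborel (E \<inter> ball x \<rho>)"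
      by (rule measurable_measure_Diff[OF fm]) auto
    finally show ?thesis using content_ball_pos[OF that, of x]
      by (simp add: ball_density_def V_def diff_divide_distrib)
  qed
  have "measure lborel (ball x s - E) \<le> measure lborel (ball x r - E)"
    by (rule measure_mono_fmeasurable) (use sub fmE in auto)
  from key[OF this] show "1 - ball_density E s x \<le> 2 ^ DIM('a) * (1 - ball_density E r x)"
    using sr by (simp add: c)
qed

lemma filterlim_half_power: "filterlim (\<lambda>k. 1 / 2 ^ k :: real) (at_right 0) sequentially"
proof (rule tendsto_imp_filterlim_at_right)
  show "(\<lambda>k. 1 / 2 ^ k :: real) \<longlonglongrightarrow> 0" by (rule LIMSEQ_divide_realpow_zero) simp
qed simp

text \<open>\<open>E\<close> may be unbounded, so the densities have to be cut off to become
  admissible. The transition layer widens with \<open>k\<close>: the Lipschitz constant tends to 0,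
  and with it the cost of the cutoff in the seminorm. \<open>Suc\<close> avoids division by
  zero.\<close>

definition radial_cutoff :: "nat \<Rightarrow> 'a::euclidean_space \<Rightarrow> real" where
  "radial_cutoff k x = max 0 (min 1 (2 - norm x / real (Suc k)))"

lemma radial_cutoff:
  fixes x :: "'a::euclidean_space"
  shows "(1 / real (Suc k))-lipschitz_on UNIV (radial_cutoff k :: 'a \<Rightarrow> real)"
    "0 \<le> radial_cutoff k x" "radial_cutoff k x \<le> 1"
    "(radial_cutoff k :: 'a \<Rightarrow> real) \<in> lipc" "(\<lambda>k. radial_cutoff k x) \<longlonglongrightarrow> 1"
proof -
  show L: "(1 / real (Suc k))-lipschitz_on UNIV (radial_cutoff k :: 'a \<Rightarrow> real)" for k
  proof (rule lipschitz_on_realI)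
    fix x y :: 'a
    have "norm y \<le> norm x + dist x y" using norm_triangle_sub[of y x] by (simp add: dist_norm norm_minus_commute)
    then have "norm y / real (Suc k) \<le> (norm x + dist x y) / real (Suc k)" by (rule divide_right_mono) simp
    moreover have "0 \<le> dist x y / real (Suc k)" by simp
    moreover have "1 / real (Suc k) * dist x y = dist x y / real (Suc k)" by simp
    ultimately show "radial_cutoff k x - radial_cutoff k y \<le> 1 / real (Suc k) * dist x y"
      unfolding radial_cutoff_def add_divide_distrib by linarith
  qed simp
  show "0 \<le> radial_cutoff k x" "radial_cutoff k x \<le> 1" by (auto simp: radial_cutoff_def)
  show "(radial_cutoff k :: 'a \<Rightarrow> real) \<in> lipc"
  proof (rule lipc_I[OF L], rule bounded_subset[OF bounded_ball[of 0 "2 * real (Suc k)"]])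
    show "{x::'a. radial_cutoff k x \<noteq> 0} \<subseteq> ball 0 (2 * real (Suc k))"
    proof
      fix x :: 'a assume "x \<in> {x. radial_cutoff k x \<noteq> 0}"
      then have "norm x / real (Suc k) < 2" by (auto simp: radial_cutoff_def max_def split: if_splits)
      then show "x \<in> ball 0 (2 * real (Suc k))" by (simp add: divide_less_eq)
    qed
  qed
  obtain n :: nat where n: "norm x \<le> real n" using real_arch_simple by blast
  have "radial_cutoff k x = 1" if "n \<le> k" for k
  proof -
    have "norm x / real (Suc k) \<le> 1" using n that by (simp add: divide_le_eq)
    then show ?thesis by (simp add: radial_cutoff_def)
  qed
  then have "\<forall>\<^sub>F k in sequentially. radial_cutoff k x = 1" by (auto simp: eventually_sequentially)
  then show "(\<lambda>k. radial_cutoff k x) \<longlonglongrightarrow> 1" by (rule tendsto_eventually)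
qed

definition density_cutoff :: "'a::euclidean_space set \<Rightarrow> nat \<Rightarrow> 'a \<Rightarrow> real" where
  "density_cutoff E k x = ball_density E (1 / 2 ^ k) x * radial_cutoff k x"

context
  fixes \<alpha> :: real and E :: "'a::euclidean_space set"
  assumes \<alpha>: "0 < \<alpha>" "\<alpha> < 1"
    and E [measurable]: "E \<in> sets borel" and Efin: "emeasure lborel E < \<infinity>"
    and gE: "gagliardo \<alpha> (indicat_real E) < \<infinity>"
begin

private definition "\<theta> k = ball_density E (1 / 2 ^ k)" for k :: nat

private lemma \<theta>_bounds: "0 \<le> \<theta> k x" "\<theta> k x \<le> 1"
  unfolding \<theta>_def using density_bounds[OF \<alpha> E Efin gE, of "1 / 2 ^ k" x] by auto

private lemma \<theta>_Suc: "\<theta> (Suc k) x \<le> 2 ^ DIM('a) * \<theta> k x" "1 - \<theta> (Suc k) x \<le> 2 ^ DIM('a) * (1 - \<theta> k x)"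
  unfolding \<theta>_def using density_compare[OF E, of "1 / 2 ^ Suc k" "1 / 2 ^ k" x] by (auto simp: field_simps)

text \<open>Each small radius \<open>r\<close> lies within a factor 2 below some 1/2^k, and doubling
  bounds the missing density at \<open>r\<close> by 2^n times that at 1/2^k.\<close>

lemma density_one_points_iff_dyadic:
  "x \<in> density_one_points E \<longleftrightarrow> (\<lambda>k. ball_density E (1 / 2 ^ k) x) \<longlonglongrightarrow> 1"
proof -
  have eq: "measure lebesgue (E \<inter> ball x r) / measure lebesgue (ball x r) = ball_density E r x" for r
    by (simp add: ball_density_def)
  show ?thesis
    unfolding density_one_points_def mem_Collect_eq eq
  proof
    assume "((\<lambda>r. ball_density E r x) \<longlongrightarrow> 1) (at_right 0)"
    then show "(\<lambda>k. ball_density E (1 / 2 ^ k) x) \<longlonglongrightarrow> 1"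
      by (rule filterlim_compose[OF _ filterlim_half_power])
  next
    assume lim: "(\<lambda>k. ball_density E (1 / 2 ^ k) x) \<longlonglongrightarrow> 1"
    show "((\<lambda>r. ball_density E r x) \<longlongrightarrow> 1) (at_right 0)"
    proof (rule tendstoI)
      fix e :: real assume e: "0 < e"
      then have "0 < e / 2 ^ DIM('a)" by simp
      then obtain N where N: "\<And>k. N \<le> k \<Longrightarrow> \<bar>ball_density E (1 / 2 ^ k) x - 1\<bar> < e / 2 ^ DIM('a)"
        using LIMSEQ_D[OF lim, of "e / 2 ^ DIM('a)"] by auto
      have "dist (ball_density E r x) 1 < e" if r: "0 < r" "r < 1 / 2 ^ N" for r
      proof -
        have "r \<le> 1" using r by (smt (verit) divide_le_eq_1 one_le_power)
        then have "1 \<le> 1 / r" using r by simp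
        then obtain k where k: "2 ^ k \<le> 1 / r" "1 / r < 2 ^ (k + 1)" using dyadic_bracket by blast
        have "2 ^ N < 1 / r" using r by (simp add: field_simps)
        then have "(2::real) ^ N < 2 ^ (k + 1)" using k(2) by simp
        then have "N < k + 1" by (rule power_less_imp_less_exp[rotated]) simp
        then have "N \<le> k" by simp
        have rk: "r \<le> 1 / 2 ^ k" "1 / 2 ^ k \<le> 2 * r" using k r by (simp_all add: field_simps)
        have "1 - ball_density E r x \<le> 2 ^ DIM('a) * (1 - ball_density E (1 / 2 ^ k) x)"
          by (rule density_compare(2)[OF E r(1) rk])
        also have "\<dots> < 2 ^ DIM('a) * (e / 2 ^ DIM('a))"
          using N[OF \<open>N \<le> k\<close>] by (intro mult_strict_left_mono) auto
        finally show ?thesis using density_bounds[OF \<alpha> E Efin gE r(1), of x] by (simp add: dist_real_def)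
      qed
      then show "\<forall>\<^sub>F r in at_right 0. dist (ball_density E r x) 1 < e"
        unfolding eventually_at_right_field by (intro exI[of _ "1 / 2 ^ N"]) auto
    qed
  qed
qed

text \<open>If the mixing \<open>\<theta>(1 - \<theta>)\<close> vanishes in the limit, doubling keeps \<open>\<theta>\<close> from jumping between \<open>0\<close> and \<open>1\<close>.\<close>

lemma density_tendsto_indicator:
  assumes mix: "(\<lambda>k. mixing E (1 / 2 ^ k) x) \<longlonglongrightarrow> 0"
  shows "(\<lambda>k. ball_density E (1 / 2 ^ k) x) \<longlonglongrightarrow> indicat_real (density_one_points E) x"
proof -
  \<comment> \<open>Once the mixing is below \<open>d\<close>, a density of at most 1/2 is in fact
    at most \<open>2 * d\<close>. Halving the radius multiplies it by at most 2^n, which leads to at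
    most 1/2 again; the same holds for one minus the density.\<close>
  define d where "d = (1::real) / (4 * 2 ^ DIM('a))"
  have d: "0 < d" by (simp add: d_def)
  define D where "D k = mixing E (1 / 2 ^ k) x" for k
  have Deq: "D k = \<theta> k x * (1 - \<theta> k x)" for k by (simp add: D_def mixing_def \<theta>_def)
  obtain K where K: "\<And>k. K \<le> k \<Longrightarrow> \<bar>D k\<bar> < d" using LIMSEQ_D[OF mix d] by (auto simp: D_def)
  have small: "\<theta> k x \<le> 2 * D k" if "\<theta> k x \<le> 1 / 2" for k
  proof -
    have "\<theta> k x * 1 \<le> \<theta> k x * (2 * (1 - \<theta> k x))" by (rule mult_left_mono) (use that \<theta>_bounds in auto)
    then show ?thesis unfolding Deq by (simp add: algebra_simps)
  qed
  have large: "1 - \<theta> k x \<le> 2 * D k" if "1 / 2 \<le> \<theta> k x" for k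
  proof -
    have "(1 - \<theta> k x) * 1 \<le> (1 - \<theta> k x) * (2 * \<theta> k x)" by (rule mult_left_mono) (use that \<theta>_bounds in auto)
    then show ?thesis unfolding Deq by (simp add: algebra_simps)
  qed
  have D0: "(\<lambda>k. 2 * D k) \<longlonglongrightarrow> 0" using tendsto_mult_left[OF mix, of 2] by (simp add: D_def)
  have dd: "2 ^ DIM('a) * (2 * d) = 1 / 2" by (simp add: d_def)
  show ?thesis
  proof (cases "\<theta> K x \<le> 1 / 2")
    case True
    have "\<theta> k x \<le> 1 / 2" if "K \<le> k" for k
      using that
    proof (induction k rule: dec_induct)
      case (step k)
      have "\<theta> k x \<le> 2 * d" using small[OF step.IH] K[OF step.hyps(1)] by linarith
      then have "2 ^ DIM('a) * \<theta> k x \<le> 2 ^ DIM('a) * (2 * d)" by (rule mult_left_mono) simp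
      then show ?case using \<theta>_Suc(1)[of k x] dd by linarith
    qed (rule True)
    then have "\<forall>\<^sub>F k in sequentially. \<theta> k x \<le> 2 * D k" using small by (auto simp: eventually_sequentially)
    then have "(\<lambda>k. \<theta> k x) \<longlonglongrightarrow> 0"
      by (rule tendsto_sandwich[OF _ _ tendsto_const D0, rotated]) (use \<theta>_bounds in simp)
    moreover then have "x \<notin> density_one_points E"
      unfolding density_one_points_iff_dyadic using LIMSEQ_unique by (fastforce simp: \<theta>_def)
    ultimately show ?thesis by (simp add: \<theta>_def)
  next
    case False
    have "1 / 2 \<le> \<theta> k x" if "K \<le> k" for k
      using that
    proof (induction k rule: dec_induct)
      case (step k)
      have "1 - \<theta> k x \<le> 2 * d" using large[OF step.IH] K[OF step.hyps(1)] by linarith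
      then have "2 ^ DIM('a) * (1 - \<theta> k x) \<le> 2 ^ DIM('a) * (2 * d)" by (rule mult_left_mono) simp
      then show ?case using \<theta>_Suc(2)[of k x] dd by linarith
    qed (use False in simp)
    then have "\<forall>\<^sub>F k in sequentially. 1 - \<theta> k x \<le> 2 * D k" using large by (auto simp: eventually_sequentially)
    then have "(\<lambda>k. 1 - \<theta> k x) \<longlonglongrightarrow> 0"
      by (rule tendsto_sandwich[OF _ _ tendsto_const D0, rotated]) (use \<theta>_bounds in simp)
    then have "(\<lambda>k. 1 - (1 - \<theta> k x)) \<longlonglongrightarrow> 1 - 0" by (intro tendsto_intros)
    then have "(\<lambda>k. \<theta> k x) \<longlonglongrightarrow> 1" by simp
    moreover then have "x \<in> density_one_points E" unfolding density_one_points_iff_dyadic by (simp add: \<theta>_def)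
    ultimately show ?thesis by (simp add: \<theta>_def)
  qed
qed

lemma density_cutoff_lipc: "density_cutoff E k \<in> lipc"
  unfolding density_cutoff_def[abs_def]
  by (rule lipc_mult[OF density_Lipschitz[OF \<alpha> E Efin gE] _ radial_cutoff(4), of _ 1])
    (use density_bounds[OF \<alpha> E Efin gE] in auto)

text \<open>The error is the cut off difference \<open>w k * radial_cutoff k\<close> minus the part
  \<open>1 - radial_cutoff k\<close> of the indicator that is cut away. The product rule applies to
  both: the first is small since \<open>w k\<close> is, the second by dominated convergence of the
  weighted oscillation of \<open>E\<close>, and the cutoff cost \<open>Q k\<close> tends to
  0.\<close>

lemma density_cutoff_gagliardo_tendsto:
  "(\<lambda>k. gagliardo \<alpha> (\<lambda>x. density_cutoff E k x - indicat_real E x)) \<longlonglongrightarrow> 0"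
proof -
  note \<theta>m = density_measurable[OF \<alpha> E Efin gE]
  have [measurable]: "ball_density E (1 / 2 ^ k) \<in> borel_measurable borel" for k :: nat by (rule \<theta>m) simp
  have [measurable]: "radial_cutoff k \<in> borel_measurable borel" for k
    by (rule lipc_measurable[OF radial_cutoff(4)])
  define w where "w k x = ball_density E (1 / 2 ^ k) x - indicat_real E x" for k :: nat and x
  have [measurable]: "w k \<in> borel_measurable borel" for k unfolding w_def by measurable
  define Q where "Q k = kernel_mass \<alpha> TYPE('a) (2 * 1) (1 / real (Suc k))" for k
  have QL: "Q \<longlonglongrightarrow> 0"
    unfolding Q_def
  proof (rule kernel_mass_tendsto_0[OF \<alpha>])
    have "(\<lambda>k. (1 / real (Suc k)) powr \<alpha>) \<longlonglongrightarrow> 0 powr \<alpha>"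
      by (rule tendsto_powr2[OF LIMSEQ_Suc[OF lim_1_over_n] tendsto_const]) (use \<alpha> in auto)
    then show "(\<lambda>k. (2 * 1) powr (1 - \<alpha>) * (1 / real (Suc k)) powr \<alpha>) \<longlonglongrightarrow> 0"
      using tendsto_mult_left[of _ 0 sequentially "2 powr (1 - \<alpha>)"] by simp
  qed auto
  have u1: "(\<integral>\<^sup>+x. ennreal \<bar>indicat_real E x\<bar> \<partial>lborel) = emeasure lborel E"
    by (simp add: nn_integral_indicator[symmetric] ennreal_indicator del: nn_integral_indicator)
  define a where "a k = gagliardo \<alpha> (w k) + (\<integral>\<^sup>+x. ennreal \<bar>w k x\<bar> \<partial>lborel) * Q k" for k
  define b where "b k = (\<integral>\<^sup>+x. ennreal \<bar>1 - radial_cutoff k x\<bar> * frac_osc \<alpha> (indicat_real E) x \<partial>lborel) + emeasure lborel E * Q k" for k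
  have bound: "gagliardo \<alpha> (\<lambda>x. density_cutoff E k x - indicat_real E x) \<le> a k + b k" for k
  proof -
    have "gagliardo \<alpha> (\<lambda>x. density_cutoff E k x - indicat_real E x)
      \<le> gagliardo \<alpha> (\<lambda>x. w k x * radial_cutoff k x) + gagliardo \<alpha> (\<lambda>x. indicat_real E x * (1 - radial_cutoff k x))"
    proof (rule gagliardo_add)
      fix x y
      have e: "density_cutoff E k x - indicat_real E x = w k x * radial_cutoff k x - indicat_real E x * (1 - radial_cutoff k x)" for x
        by (simp add: density_cutoff_def w_def algebra_simps)
      show "\<bar>density_cutoff E k x - indicat_real E x - (density_cutoff E k y - indicat_real E y)\<bar>
        \<le> \<bar>w k x * radial_cutoff k x - w k y * radial_cutoff k y\<bar>
          + \<bar>indicat_real E x * (1 - radial_cutoff k x) - indicat_real E y * (1 - radial_cutoff k y)\<bar>"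
        unfolding e by linarith
    qed measurable
    also have "\<dots> \<le> a k + b k"
    proof (rule add_mono)
      have "gagliardo \<alpha> (\<lambda>x. w k x * radial_cutoff k x) \<le> (\<integral>\<^sup>+x. ennreal \<bar>radial_cutoff k x\<bar> * frac_osc \<alpha> (w k) x \<partial>lborel)
          + (\<integral>\<^sup>+x. ennreal \<bar>w k x\<bar> \<partial>lborel) * Q k"
        unfolding Q_def by (rule gagliardo_product[OF _ radial_cutoff(1)]) (simp_all add: abs_of_nonneg radial_cutoff(2,3))
      also have "\<dots> \<le> a k"
        unfolding a_def
      proof (rule add_right_mono)
        show "(\<integral>\<^sup>+x. ennreal \<bar>radial_cutoff k x\<bar> * frac_osc \<alpha> (w k) x \<partial>lborel) \<le> gagliardo \<alpha> (w k)"
          unfolding gagliardo_def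
        proof (rule nn_integral_mono)
          fix x :: 'a
          have "ennreal \<bar>radial_cutoff k x\<bar> \<le> 1" using radial_cutoff(2)[of k x] radial_cutoff(3)[of k x] by simp
          then show "ennreal \<bar>radial_cutoff k x\<bar> * frac_osc \<alpha> (w k) x \<le> frac_osc \<alpha> (w k) x"
            using mult_right_mono[of "ennreal \<bar>radial_cutoff k x\<bar>" 1 "frac_osc \<alpha> (w k) x"] by simp
        qed
      qed
      finally show "gagliardo \<alpha> (\<lambda>x. w k x * radial_cutoff k x) \<le> a k" .
      have l: "(1 / real (Suc k))-lipschitz_on UNIV (\<lambda>x::'a. 1 - radial_cutoff k x)"
      proof (rule lipschitz_on_realI)
        fix x y :: 'a
        show "1 - radial_cutoff k x - (1 - radial_cutoff k y) \<le> 1 / real (Suc k) * dist x y"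
          using lipschitz_on_realD(1)[OF radial_cutoff(1)[of k], of y x] by (simp add: dist_commute)
      qed simp
      show "gagliardo \<alpha> (\<lambda>x. indicat_real E x * (1 - radial_cutoff k x)) \<le> b k"
        unfolding b_def Q_def u1[symmetric]
        by (rule gagliardo_product[OF _ l]) (simp_all add: abs_of_nonneg radial_cutoff(2,3))
    qed
    finally show ?thesis .
  qed
  have la: "a \<longlonglongrightarrow> 0"
  proof -
    have w1: "(\<lambda>k. \<integral>\<^sup>+x. ennreal \<bar>w k x\<bar> \<partial>lborel) \<longlonglongrightarrow> 0" unfolding w_def by (rule density_L1_tendsto[OF \<alpha> E Efin gE])
    have w2: "(\<lambda>k. gagliardo \<alpha> (w k)) \<longlonglongrightarrow> 0"
      unfolding w_def[abs_def] by (rule density_gagliardo_tendsto[OF \<alpha> E Efin gE])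
    have "(\<lambda>k. gagliardo \<alpha> (w k) + (\<integral>\<^sup>+x. ennreal \<bar>w k x\<bar> \<partial>lborel) * Q k) \<longlonglongrightarrow> 0 + 0 * 0"
      by (intro tendsto_add tendsto_mult_ennreal w1 w2 QL) auto
    then show ?thesis unfolding a_def by simp
  qed
  have lb: "b \<longlonglongrightarrow> 0"
  proof -
    have "(\<lambda>k. \<integral>\<^sup>+x. ennreal \<bar>1 - radial_cutoff k x\<bar> * frac_osc \<alpha> (indicat_real E) x \<partial>lborel) \<longlonglongrightarrow> (\<integral>\<^sup>+x. 0 \<partial>(lborel :: 'a measure))"
    proof (rule nn_integral_dominated_convergence[where w="frac_osc \<alpha> (indicat_real E)"])
      show "AE x in lborel. ennreal \<bar>1 - radial_cutoff k x\<bar> * frac_osc \<alpha> (indicat_real E) x \<le> frac_osc \<alpha> (indicat_real E) x" for k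
      proof (rule AE_I2)
        fix x :: 'a
        have "ennreal \<bar>1 - radial_cutoff k x\<bar> \<le> 1" using radial_cutoff(2)[of k x] radial_cutoff(3)[of k x] by simp
        then show "ennreal \<bar>1 - radial_cutoff k x\<bar> * frac_osc \<alpha> (indicat_real E) x \<le> frac_osc \<alpha> (indicat_real E) x"
          using mult_right_mono[of "ennreal \<bar>1 - radial_cutoff k x\<bar>" 1 "frac_osc \<alpha> (indicat_real E) x"] by simp
      qed
      show "(\<integral>\<^sup>+x. frac_osc \<alpha> (indicat_real E) x \<partial>lborel) < \<infinity>" using gE by (simp add: gagliardo_def)
      have "AE x in lborel. frac_osc \<alpha> (indicat_real E) x < \<infinity>" by (rule frac_osc_AE_finite[OF _ gE]) measurable
      then show "AE x in lborel. (\<lambda>k. ennreal \<bar>1 - radial_cutoff k x\<bar> * frac_osc \<alpha> (indicat_real E) x) \<longlonglongrightarrow> 0"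
      proof eventually_elim
        fix x :: 'a assume fin: "frac_osc \<alpha> (indicat_real E) x < \<infinity>"
        have "(\<lambda>k. \<bar>1 - radial_cutoff k x\<bar>) \<longlonglongrightarrow> \<bar>1 - 1\<bar>" by (intro tendsto_intros radial_cutoff(5))
        then have "(\<lambda>k. ennreal \<bar>1 - radial_cutoff k x\<bar>) \<longlonglongrightarrow> 0" using tendsto_ennrealI[of _ 0] by simp
        then have "(\<lambda>k. frac_osc \<alpha> (indicat_real E) x * ennreal \<bar>1 - radial_cutoff k x\<bar>) \<longlonglongrightarrow> frac_osc \<alpha> (indicat_real E) x * 0"
          by (rule ennreal_tendsto_cmult[rotated]) (use fin in \<open>simp add: less_top\<close>)
        then show "(\<lambda>k. ennreal \<bar>1 - radial_cutoff k x\<bar> * frac_osc \<alpha> (indicat_real E) x) \<longlonglongrightarrow> 0"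
          by (simp add: mult.commute)
      qed
    qed measurable
    moreover have "(\<lambda>k. emeasure lborel E * Q k) \<longlonglongrightarrow> emeasure lborel E * 0"
      by (rule ennreal_tendsto_cmult[OF _ QL]) (use Efin in \<open>simp add: less_top\<close>)
    ultimately have "(\<lambda>k. (\<integral>\<^sup>+x. ennreal \<bar>1 - radial_cutoff k x\<bar> * frac_osc \<alpha> (indicat_real E) x \<partial>lborel) + emeasure lborel E * Q k) \<longlonglongrightarrow> 0 + 0"
      by (intro tendsto_add) auto
    then show ?thesis unfolding b_def by simp
  qed
  have lab: "(\<lambda>k. a k + b k) \<longlonglongrightarrow> 0" using tendsto_add[OF la lb] by simp
  show ?thesis by (rule tendsto_sandwich[OF _ _ tendsto_const lab]) (use bound in auto)
qed

text \<open>Off the exceptional set \<open>B\<close> the admissible functions \<open>v k\<close>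
  converge pointwise, dominated by 1, to the indicator of the density one points. On
  \<open>B\<close> they may oscillate, but there \<open>P\<close> and \<open>N\<close> cancel.
  Meanwhile the pairing converges because the seminorm does.\<close>

theorem frac_gauss_green_borel:
  fixes F :: "'a \<Rightarrow> 'a"
  assumes F: "F \<in> frac_DM \<alpha>"
  shows "frac_div \<alpha> F (density_one_points E) = - frac_pairing \<alpha> F (indicat_real E)"
proof -
  obtain P N where PN: "finite_measure P" "finite_measure N" "sets P = sets borel" "sets N = sets borel"
    and rep: "\<And>v. v \<in> lipc \<Longrightarrow> frac_pairing \<alpha> F v = - ((LINT x|P. v x) - (LINT x|N. v x))"
    and div: "\<And>A. A \<in> sets borel \<Longrightarrow> frac_div \<alpha> F A = measure P A - measure N A"
    using frac_div_representation[OF \<alpha> F] by metis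
  interpret P: finite_measure P by (rule PN)
  interpret N: finite_measure N by (rule PN)
  have Fm: "F \<in> borel_measurable lebesgue" using F by (simp add: frac_DM_def)
  obtain C0 where C0: "AE x in lebesgue. norm (F x) \<le> C0" using F by (auto simp: frac_DM_def)
  define C where "C = max C0 0"
  have C: "AE x in lebesgue. norm (F x) \<le> C" "0 \<le> C"
    using C0 by (auto simp: C_def elim: eventually_mono)
  have lg: "v \<in> borel_measurable borel" "gagliardo \<alpha> v < \<infinity>" if "v \<in> lipc" for v :: "'a \<Rightarrow> real"
    using lipc_measurable[OF that] lipc_gagliardo_finite[OF \<alpha> that] by auto
  have \<theta>m [measurable]: "ball_density E (1 / 2 ^ k) \<in> borel_measurable borel" for k :: nat
    by (rule density_measurable[OF \<alpha> E Efin gE]) simp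
  define D where "D k = mixing E (1 / 2 ^ k)" for k :: nat
  have Dm [measurable]: "D k \<in> borel_measurable borel" for k
    unfolding D_def by (rule mixing_measurable[OF \<alpha> E Efin gE]) simp
  define E1 where "E1 = density_one_points E"
  define B where "B = {x. \<not> (\<lambda>k. D k x) \<longlonglongrightarrow> 0}"
  have lim_sets: "{x. (\<lambda>k. f k x) \<longlonglongrightarrow> c} \<in> sets borel" if [measurable]: "\<And>k. f k \<in> borel_measurable borel"
    for f :: "nat \<Rightarrow> 'a \<Rightarrow> real" and c
  proof -
    have "{x. (\<lambda>k. f k x) \<longlonglongrightarrow> c} = {x\<in>space borel. \<forall>j::nat. \<exists>m. \<forall>k. k \<ge> m \<longrightarrow> \<bar>f k x - c\<bar> < 1 / real (Suc j)}"
    proof (intro set_eqI iffI CollectI conjI allI)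
      fix x j assume "x \<in> {x. (\<lambda>k. f k x) \<longlonglongrightarrow> c}"
      then show "\<exists>m. \<forall>k. k \<ge> m \<longrightarrow> \<bar>f k x - c\<bar> < 1 / real (Suc j)"
        using LIMSEQ_D[of "\<lambda>k. f k x" c "1 / real (Suc j)"] by auto
    next
      fix x assume x: "x \<in> {x\<in>space borel. \<forall>j::nat. \<exists>m. \<forall>k. k \<ge> m \<longrightarrow> \<bar>f k x - c\<bar> < 1 / real (Suc j)}"
      show "(\<lambda>k. f k x) \<longlonglongrightarrow> c"
      proof (rule LIMSEQ_I)
        fix r :: real assume "0 < r"
        then obtain j where j: "1 / real (Suc j) < r" using nat_approx_posE by blast
        obtain m where "\<forall>k. k \<ge> m \<longrightarrow> \<bar>f k x - c\<bar> < 1 / real (Suc j)" using x by blast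
        then have "\<forall>k\<ge>m. norm (f k x - c) < r" using j by fastforce
        then show "\<exists>no. \<forall>n\<ge>no. norm (f n x - c) < r" by blast
      qed
    qed simp
    also have "\<dots> \<in> sets borel" by measurable
    finally show ?thesis .
  qed
  have E1b [measurable]: "E1 \<in> sets borel"
  proof -
    have "E1 = {x. (\<lambda>k. ball_density E (1 / 2 ^ k) x) \<longlonglongrightarrow> 1}" unfolding E1_def using density_one_points_iff_dyadic by blast
    then show ?thesis using lim_sets[OF \<theta>m] by simp
  qed
  have Bb [measurable]: "B \<in> sets borel"
  proof -
    have "B = UNIV - {x. (\<lambda>k. D k x) \<longlonglongrightarrow> 0}" by (auto simp: B_def)
    then show ?thesis using lim_sets[OF Dm] by simp
  qed
  \<comment> \<open>Equality is established for every Borel subset of \<open>B\<close>, since the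
    integrals of the functions \<open>v k\<close> over \<open>B\<close> have to be compared and not
    only the masses.\<close>
  have eqB: "emeasure P A = emeasure N A" if A: "A \<in> sets borel" "A \<subseteq> B" for A
  proof (rule signed_measure_limsup[OF \<alpha> PN, where D=D and C="C * \<bar>frac_const DIM('a) \<alpha>\<bar>"])
    show "ennreal \<bar>(LINT x|P. v x) - (LINT x|N. v x)\<bar> \<le> ennreal (C * \<bar>frac_const DIM('a) \<alpha>\<bar>) * gagliardo \<alpha> v" if "v \<in> lipc" for v
      using frac_pairing_le[OF Fm C lg[OF that]] unfolding rep[OF that] by (simp add: abs_minus_commute)
    show "\<exists>L. L-lipschitz_on UNIV (D k)" for k
      unfolding D_def using mixing_Lipschitz[OF \<alpha> E Efin gE, of "1 / 2 ^ k"] by auto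
    show "0 \<le> D k x" for k x unfolding D_def by (rule mixing_bounds[OF \<alpha> E Efin gE]) simp
    show "(\<Sum>k. gagliardo \<alpha> (D k)) < \<infinity>" unfolding D_def by (rule mixing_gagliardo_summable[OF \<alpha> E Efin gE])
    show "(\<Sum>k. \<integral>\<^sup>+x. ennreal (D k x) \<partial>lborel) < \<infinity>" unfolding D_def by (rule mixing_L1_summable[OF \<alpha> E Efin gE])
    show "A \<in> sets borel" by (rule A)
    show "\<not> (\<lambda>k. D k x) \<longlonglongrightarrow> 0" if "x \<in> A" for x using A(2) that by (auto simp: B_def)
  qed
  have dens: "density P (indicator B) = density N (indicator B)"
  proof (rule measure_eqI)
    fix A assume "A \<in> sets (density P (indicator B))"
    then have [measurable]: "A \<in> sets borel" using PN(3) by simp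
    have "emeasure (density R (indicator B)) A = emeasure R (B \<inter> A)" if "sets R = sets borel" for R :: "'a measure"
      using that by (subst emeasure_density) (auto simp: nn_integral_indicator[symmetric] indicator_inter_arith simp del: nn_integral_indicator)
    then show "emeasure (density P (indicator B)) A = emeasure (density N (indicator B)) A"
      using PN(3,4) eqB[of "B \<inter> A"] by simp
  qed (use PN in simp)
  define v where "v = density_cutoff E"
  have vl: "v k \<in> lipc" for k unfolding v_def by (rule density_cutoff_lipc)
  have v01: "0 \<le> v k x" "v k x \<le> 1" for k x
    using density_bounds[OF \<alpha> E Efin gE, of "1 / 2 ^ k" x] radial_cutoff(2)[of k x] radial_cutoff(3)[of k x]
    by (auto simp: v_def density_cutoff_def mult_le_one)
  have vlim: "(\<lambda>k. v k x) \<longlonglongrightarrow> indicat_real E1 x" if "x \<notin> B" for x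
  proof -
    have "(\<lambda>k. D k x) \<longlonglongrightarrow> 0" using that by (simp add: B_def)
    then have "(\<lambda>k. ball_density E (1 / 2 ^ k) x) \<longlonglongrightarrow> indicat_real E1 x"
      unfolding D_def E1_def by (rule density_tendsto_indicator)
    from tendsto_mult[OF this radial_cutoff(5)[of x]] show ?thesis by (simp add: v_def density_cutoff_def)
  qed
  have intB: "(LINT x|P. indicat_real B x * v k x) = (LINT x|N. indicat_real B x * v k x)" for k
  proof -
    have "(LINT x|R. indicat_real B x * v k x) = (LINT x|density R (indicator B). v k x)" if "sets R = sets borel" for R :: "'a measure"
    proof -
      have "v k \<in> borel_measurable R" "indicat_real B \<in> borel_measurable R"
        using lipc_measurable[OF vl] Bb that by (auto simp: measurable_cong_sets[OF that refl])
      then have "(LINT x|density R (\<lambda>x. ennreal (indicat_real B x)). v k x) = (LINT x|R. indicat_real B x *\<^sub>R v k x)"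
        by (intro integral_density) auto
      then show ?thesis by (simp add: ennreal_indicator)
    qed
    then show ?thesis using PN(3,4) dens by simp
  qed
  have lim: "(\<lambda>k. LINT x|R. indicat_real (- B) x * v k x) \<longlonglongrightarrow> measure R (E1 - B)"
    and split: "(LINT x|R. v k x) = (LINT x|R. indicat_real B x * v k x) + (LINT x|R. indicat_real (- B) x * v k x)"
    if R: "finite_measure R" "sets R = sets borel" for R :: "'a measure" and k
  proof -
    interpret R: finite_measure R by (rule R)
    have mR: "f \<in> borel_measurable borel \<Longrightarrow> f \<in> borel_measurable R" for f :: "'a \<Rightarrow> real"
      by (simp add: measurable_cong_sets[OF R(2) refl])
    have [measurable]: "v k \<in> borel_measurable borel" for k by (rule lipc_measurable[OF vl])
    have "(\<lambda>k. LINT x|R. indicat_real (- B) x * v k x) \<longlonglongrightarrow> (LINT x|R. indicat_real (E1 - B) x)"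
    proof (rule integral_dominated_convergence[where w="\<lambda>_. 1"])
      show "indicat_real (E1 - B) \<in> borel_measurable R" by (rule mR) measurable
      show "(\<lambda>x. indicat_real (- B) x * v k x) \<in> borel_measurable R" for k by (rule mR) measurable
      show "AE x in R. (\<lambda>k. indicat_real (- B) x * v k x) \<longlonglongrightarrow> indicat_real (E1 - B) x"
      proof (rule AE_I2)
        fix x show "(\<lambda>k. indicat_real (- B) x * v k x) \<longlonglongrightarrow> indicat_real (E1 - B) x"
          using vlim[of x] by (cases "x \<in> B") (auto simp: indicator_def)
      qed
      show "AE x in R. norm (indicat_real (- B) x * v k x) \<le> 1" for k using v01 by (simp add: indicator_def)
    qed simp
    moreover have "E1 - B \<in> sets R" using R(2) by simp
    ultimately show "(\<lambda>k. LINT x|R. indicat_real (- B) x * v k x) \<longlonglongrightarrow> measure R (E1 - B)" by simp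
    have i: "integrable R (\<lambda>x. indicat_real S x * v k x)" if [measurable]: "S \<in> sets borel" for S
      by (rule R.integrable_const_bound[of _ 1]) (use v01 in \<open>auto simp: indicator_def intro!: mR, measurable\<close>)
    have "(LINT x|R. v k x) = (LINT x|R. indicat_real B x * v k x + indicat_real (- B) x * v k x)"
      by (intro Bochner_Integration.integral_cong) (auto simp: indicator_def)
    also have "\<dots> = (LINT x|R. indicat_real B x * v k x) + (LINT x|R. indicat_real (- B) x * v k x)"
      by (rule Bochner_Integration.integral_add) (auto intro!: i)
    finally show "(LINT x|R. v k x) = (LINT x|R. indicat_real B x * v k x) + (LINT x|R. indicat_real (- B) x * v k x)" .
  qed
  have "(\<lambda>k. (LINT x|P. indicat_real (- B) x * v k x) - (LINT x|N. indicat_real (- B) x * v k x))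
      \<longlonglongrightarrow> measure P (E1 - B) - measure N (E1 - B)"
    by (intro tendsto_diff lim PN)
  moreover have "(LINT x|P. indicat_real (- B) x * v k x) - (LINT x|N. indicat_real (- B) x * v k x) = - frac_pairing \<alpha> F (v k)" for k
    unfolding rep[OF vl] split[OF PN(1,3)] split[OF PN(2,4)] using intB[of k] by simp
  ultimately have lim1: "(\<lambda>k. - frac_pairing \<alpha> F (v k)) \<longlonglongrightarrow> measure P (E1 - B) - measure N (E1 - B)" by simp
  have lim2: "(\<lambda>k. frac_pairing \<alpha> F (v k)) \<longlonglongrightarrow> frac_pairing \<alpha> F (indicat_real E)"
  proof -
    let ?K = "ennreal (C * \<bar>frac_const DIM('a) \<alpha>\<bar>)"
    have um: "indicat_real E \<in> borel_measurable borel" by measurable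
    have l: "(\<lambda>k. ?K * gagliardo \<alpha> (\<lambda>x. v k x - indicat_real E x)) \<longlonglongrightarrow> ?K * 0"
      unfolding v_def by (rule ennreal_tendsto_cmult[OF _ density_cutoff_gagliardo_tendsto]) simp
    have "(\<lambda>k. ennreal \<bar>frac_pairing \<alpha> F (v k) - frac_pairing \<alpha> F (indicat_real E)\<bar>) \<longlonglongrightarrow> 0"
      by (rule tendsto_sandwich[OF _ _ tendsto_const l[simplified]])
        (use frac_pairing_diff_le[OF Fm C lg[OF vl] um gE] in auto)
    then have "(\<lambda>k. \<bar>frac_pairing \<alpha> F (v k) - frac_pairing \<alpha> F (indicat_real E)\<bar>) \<longlonglongrightarrow> 0"
      using tendsto_ennreal_iff[where F=sequentially and x=0
          and f="\<lambda>k. \<bar>frac_pairing \<alpha> F (v k) - frac_pairing \<alpha> F (indicat_real E)\<bar>"] by simp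
    then show ?thesis by (simp add: tendsto_rabs_zero_iff LIM_zero_iff)
  qed
  have "measure P (E1 - B) - measure N (E1 - B) = - frac_pairing \<alpha> F (indicat_real E)"
    by (rule LIMSEQ_unique[OF lim1 tendsto_minus[OF lim2]])
  moreover have "measure P E1 - measure N E1 = measure P (E1 - B) - measure N (E1 - B)"
  proof -
    have m: "measure R E1 = measure R (E1 \<inter> B) + measure R (E1 - B)" if "finite_measure R" "sets R = sets borel" for R :: "'a measure"
    proof -
      have "measure R ((E1 \<inter> B) \<union> (E1 - B)) = measure R (E1 \<inter> B) + measure R (E1 - B)"
        by (rule finite_measure.finite_measure_Union[OF that(1)]) (use that(2) in auto)
      moreover have "(E1 \<inter> B) \<union> (E1 - B) = E1" by auto
      ultimately show ?thesis by simp
    qed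
    have "emeasure P (E1 \<inter> B) = emeasure N (E1 \<inter> B)" by (rule eqB) auto
    then have "measure P (E1 \<inter> B) = measure N (E1 \<inter> B)" by (simp add: measure_def)
    then show ?thesis using m[OF PN(1,3)] m[OF PN(2,4)] by simp
  qed
  ultimately show ?thesis using div[OF E1b] by (simp add: E1_def)
qed

end

section \<open>Passage to Lebesgue measurable sets\<close>

lemma frac_Sobolev_indicator_borel:
  fixes E :: "'a::euclidean_space set"
  assumes "indicat_real E \<in> frac_Sobolev \<alpha>"
  obtains E' where "E' \<in> sets borel" "emeasure lborel E' < \<infinity>" "gagliardo \<alpha> (indicat_real E') < \<infinity>"
    "AE x in lebesgue. x \<in> E \<longleftrightarrow> x \<in> E'" "E \<in> sets lebesgue"
proof -
  have int: "integrable lebesgue (indicat_real E)" using assms by (simp add: frac_Sobolev_def)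
  then have "indicat_real E \<in> borel_measurable lebesgue" by auto
  then have E: "E \<in> sets lebesgue" by (simp add: borel_measurable_indicator_iff)
  have Efin: "emeasure lebesgue E < \<infinity>" using int E by (simp add: integrable_indicator_iff)
  \<comment> \<open>A Borel set that differs from \<open>E\<close> by a null set only, which the
    seminorm does not see.\<close>
  define E' where "E' = main_part lborel E"
  have E': "E' \<in> sets borel" using main_part_sets[OF E] by (simp add: E'_def)
  have ae: "AE x in lborel. x \<in> E \<longleftrightarrow> x \<in> E'"
    using AE_notin_null_part[OF E]
  proof eventually_elim
    case (elim x)
    then show ?case using main_part_null_part_Un[OF E] by (auto simp: E'_def)
  qed
  have em: "emeasure lborel E' < \<infinity>" using Efin E by (simp add: E'_def emeasure_completion)
  have "gagliardo \<alpha> (indicat_real E') = (\<integral>\<^sup>+x. \<integral>\<^sup>+y. ennreal (\<bar>indicat_real E x - indicat_real E y\<bar> / norm (x - y) powr (real DIM('a) + \<alpha>)) \<partial>lebesgue \<partial>lebesgue)"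
    unfolding gagliardo_def frac_osc_def nn_integral_completion
    by (intro nn_integral_cong_AE, use ae in eventually_elim, intro nn_integral_cong_AE, use ae in eventually_elim)
      (simp add: frac_kernel_def indicator_def)
  also have "\<dots> < \<infinity>" using assms by (simp add: frac_Sobolev_def)
  finally show thesis using that[OF E' em _ AE_completion[OF ae] E] by blast
qed

theorem frac_gauss_green:
  fixes F :: "'a::euclidean_space \<Rightarrow> 'a" and E :: "'a set"
  assumes \<alpha>: "0 < \<alpha>" "\<alpha> < 1" and F: "F \<in> frac_DM \<alpha>" and E: "indicat_real E \<in> frac_Sobolev \<alpha>"
  shows "frac_div \<alpha> F (density_one_points E) =
    - (LINT x:frac_reduced_boundary \<alpha> E|lebesgue.
         (F x \<bullet> frac_normal \<alpha> E x) * norm (frac_grad \<alpha> (indicat_real E) x))"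
proof -
  obtain E' where E': "E' \<in> sets borel" "emeasure lborel E' < \<infinity>" "gagliardo \<alpha> (indicat_real E') < \<infinity>"
    and ae: "AE x in lebesgue. x \<in> E \<longleftrightarrow> x \<in> E'" and El: "E \<in> sets lebesgue"
    using frac_Sobolev_indicator_borel[OF E] by metis
  have Fm: "F \<in> borel_measurable lebesgue" using F by (simp add: frac_DM_def)
  have um: "indicat_real E' \<in> borel_measurable borel" using E'(1) by simp
  have El': "E' \<in> sets lebesgue" using E'(1) by simp
  \<comment> \<open>The value of the indicator at \<open>x\<close> itself enters the gradient, so
    the two gradients are compared only at points where \<open>E\<close> and \<open>E'\<close>
    agree.\<close>
  have grad: "AE x in lebesgue. frac_grad \<alpha> (indicat_real E) x = frac_grad \<alpha> (indicat_real E') x"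
    using ae
  proof eventually_elim
    fix x assume x: "x \<in> E \<longleftrightarrow> x \<in> E'"
    have id: "(\<lambda>y :: 'a. y) \<in> borel_measurable lebesgue" by (rule measurable_completion) simp
    have m: "(\<lambda>y. ((indicat_real S y - indicat_real S x) / norm (y - x) powr (real DIM('a) + \<alpha> + 1)) *\<^sub>R (y - x)) \<in> borel_measurable lebesgue"
      if S: "S \<in> sets lebesgue" for S
    proof (intro borel_measurable_scaleR borel_measurable_divide borel_measurable_diff borel_measurable_indicator S)
      have "(\<lambda>y. norm (y - x) powr (real DIM('a) + \<alpha> + 1)) \<in> borel_measurable lborel" by measurable
      then show "(\<lambda>y. norm (y - x) powr (real DIM('a) + \<alpha> + 1)) \<in> borel_measurable lebesgue" by (rule measurable_completion)
    qed (auto intro: id)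
    show "frac_grad \<alpha> (indicat_real E) x = frac_grad \<alpha> (indicat_real E') x"
      unfolding frac_grad_def
    proof (rule arg_cong[where f="scaleR _"], rule integral_cong_AE[OF m[OF El] m[OF El']])
      show "AE y in lebesgue. ((indicat_real E y - indicat_real E x) / norm (y - x) powr (real DIM('a) + \<alpha> + 1)) *\<^sub>R (y - x) =
        ((indicat_real E' y - indicat_real E' x) / norm (y - x) powr (real DIM('a) + \<alpha> + 1)) *\<^sub>R (y - x)"
        using ae by eventually_elim (use x in \<open>simp add: indicator_def\<close>)
    qed
  qed
  \<comment> \<open>Here equality at every point is required, because the divergence may charge null
    sets; it holds since ball measures do not see the null difference of \<open>E\<close> and
    \<open>E'\<close>.\<close>
  have "density_one_points E = density_one_points E'"
  proof -
    have "measure lebesgue (E \<inter> ball x r) = measure lebesgue (E' \<inter> ball x r)" for x r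
      by (rule measure_eq_AE) (use ae El El' in \<open>auto elim: eventually_mono\<close>)
    then show ?thesis by (simp add: density_one_points_def)
  qed
  then have "frac_div \<alpha> F (density_one_points E) = - frac_pairing \<alpha> F (indicat_real E')"
    using frac_gauss_green_borel[OF \<alpha> E' F] by simp
  also have "frac_pairing \<alpha> F (indicat_real E') = (LINT x:frac_reduced_boundary \<alpha> E|lebesgue.
         (F x \<bullet> frac_normal \<alpha> E x) * norm (frac_grad \<alpha> (indicat_real E) x))"
    unfolding frac_pairing_def
    by (rule frac_reduced_boundary_integral[OF Fm frac_grad_integrable(1)[OF um E'(3)] grad, symmetric])
  finally show ?thesis .
qed

theorem corollary1p9:
  fixes F :: "real ^ 'n \<Rightarrow> real ^ 'n" and E :: "(real ^ 'n) set" and \<alpha> :: real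
  assumes "CARD('n) \<ge> 2"
    and "0 < \<alpha>" and "\<alpha> < 1"
    and "F \<in> frac_DM \<alpha>"
    and "indicat_real E \<in> frac_Sobolev \<alpha>"
  shows "frac_div \<alpha> F (density_one_points E) =
    - (LINT x:frac_reduced_boundary \<alpha> E|lebesgue.
         (F x \<bullet> frac_normal \<alpha> E x) * norm (frac_grad \<alpha> (indicat_real E) x))"
  using frac_gauss_green[OF assms(2-5)] .

end
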